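(* For each $k\in\mathbb{N}=\{1,2,\ldots\}$ the number $$\kappa(k):=\sup_{\substack{\boldsymbol{\nu}\in\mathcal{F}_1\\ |\boldsymbol{\nu}|=k}}\widetilde{\kappa}(\boldsymbol{\nu})$$ satisfies $\widetilde{\kappa}(\boldsymbol{\nu})\le\kappa(k)\le\kappa<1$ for all $\boldsymbol{\nu}\in\mathcal{F}_1$ with $|\boldsymbol{\nu}|=k$. Moreover, for every $\boldsymbol{\nu}\in\mathcal{F}_1$, every $f\in V^*$ and every $\boldsymbol{y}\in U$, the weak solution $u(\cdot,\boldsymbol{y})$ satisfies $$\|\partial^{\boldsymbol{\nu}}u(\cdot,\boldsymbol{y})\|_V\;\le\;\boldsymbol{b}^{\boldsymbol{\nu}}\left(\frac{2\,\kappa(|\boldsymbol{\nu}|)}{1-\overline{\kappa}}\right)^{|\boldsymbol{\nu}|}\frac{\|f\|_{V^*}}{(1-\overline{\kappa})\,a_{0,\min}} .$$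
   Context: Let $D\subset\mathbb{R}^d$, $d\in\{1,2,3\}$, be a bounded convex Lipschitz polyhedral domain, $V=H_0^1(D)$ with norm $\|v\|_V=\|\nabla v\|_{L^2(D)}$, $V^*=H^{-1}(D)$ its dual (pivot space $L^2(D)$), and $U=[-\frac12,\frac12]^{\mathbb{N}}$. The diffusion coefficient is $a(\boldsymbol{x},\boldsymbol{y})=a_0(\boldsymbol{x})+\sum_{j\ge1}y_j\psi_j(\boldsymbol{x})$ for $\boldsymbol{x}\in D$, $\boldsymbol{y}=(y_j)_{j\ge1}\in U$, with functions $\psi_j$ on $D$ and $a_0\in L^\infty(D)$ such that $0<a_{0,\min}\le a_0(\boldsymbol{x})\le a_{0,\max}<\infty$ a.e. on $D$ for constants $a_{0,\min},a_{0,\max}$. For $f\in V^*$ and $\boldsymbol{y}\in U$, $u(\cdot,\boldsymbol{y})\in V$ is the unique weak solution of $-\nabla\cdot(a(\cdot,\boldsymbol{y})\nabla u)=f$ in $D$, $u=0$ on $\partial D$: $\int_D a(\boldsymbol{x},\boldsymbol{y})\nabla u(\boldsymbol{x},\boldsymbol{y})\cdot\nabla v(\boldsymbol{x})\,d\boldsymbol{x}=\langle f,v\rangle_{V^*\times V}$ for all $v\in V$. Assumptions: there is $\overline{\kappa}\in(0,1)$ with $\big\|\sum_{j\ge1}\frac{|\psi_j|}{2a_0}\big\|_{L^\infty(D)}\le\overline{\kappa}$, and there is a real sequence $\boldsymbol{b}=(b_j)_{j\ge1}$ with $0<b_j\le1$ for all $j$ such that $\kappa:=\big\|\sum_{j\ge1}\frac{|\psi_j|/b_j}{2a_0}\big\|_{L^\infty(D)}<1$;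 here $0<\overline{\kappa}\le\kappa<1$. Multi-indices: for $\boldsymbol{\nu}=(\nu_j)_{j\ge1}$, $|\boldsymbol{\nu}|=\sum_j\nu_j$, $\mathrm{supp}(\boldsymbol{\nu})=\{j\ge1:\nu_j>0\}$; $\mathcal{F}_1$ is the set of $\boldsymbol{\nu}\in\{0,1\}^{\mathbb{N}}$ with finite support. $\boldsymbol{b}^{\boldsymbol{\nu}}=\prod_{j}b_j^{\nu_j}$. $\partial^{\boldsymbol{\nu}}$ is the mixed partial derivative of order $\nu_j$ in each parameter $y_j$ (of the map $\boldsymbol{y}\mapsto u(\cdot,\boldsymbol{y})\in V$). For $\boldsymbol{\nu}\in\mathcal{F}_1$, $$\widetilde{\kappa}(\boldsymbol{\nu})=\Big\|\sum_{j\in\mathrm{supp}(\boldsymbol{\nu})}\frac{|\psi_j|/b_j}{2a_0}\Big\|_{L^\infty(D)}.$$ Convention: for $\boldsymbol{\nu}=\boldsymbol{0}$ the factor $(\cdot)^{|\boldsymbol{\nu}|}$ equals $1$. *)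

theory Defs
  imports "HOL-Analysis.Analysis" "HOL-Probability.Essential_Supremum"
begin

section \<open>Lipschitz domains\<close>

text \<open>Near every boundary point, after a rotation, the set is the strict epigraph of a Lipschitz
  function of the coordinates orthogonal to a unit vector \<open>e\<close>. The function is evaluated only on
  the hyperplane orthogonal to \<open>e\<close>.\<close>

definition lipschitz_boundary :: "'a::euclidean_space set \<Rightarrow> bool" where
  "lipschitz_boundary D \<longleftrightarrow>
     (\<forall>p\<in>frontier D. \<exists>r>0. \<exists>e. norm e = 1 \<and>
        (\<exists>L \<gamma>. L-lipschitz_on UNIV \<gamma> \<and>
           D \<inter> ball p r = {x \<in> ball p r. \<gamma> (x - (x \<bullet> e) *\<^sub>R e) < x \<bullet> e}))"


section \<open>The Sobolev space $H^1_0(D)$\<close>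

text \<open>Elements of the function spaces on \<open>D\<close> are represented by functions on the whole space whose
  values outside \<open>D\<close> are irrelevant. Two representatives denote the same element iff they agree
  almost everywhere on \<open>D\<close>; all notions below respect this identification.\<close>

fun Ck :: "nat \<Rightarrow> ('a::euclidean_space \<Rightarrow> real) \<Rightarrow> bool" where
  "Ck 0 \<phi> \<longleftrightarrow> continuous_on UNIV \<phi>"
| "Ck (Suc k) \<phi> \<longleftrightarrow> (\<forall>x. \<phi> differentiable (at x)) \<and>
     (\<forall>i\<in>Basis. Ck k (\<lambda>x. frechet_derivative \<phi> (at x) i))"

definition test_function :: "'a::euclidean_space set \<Rightarrow> ('a \<Rightarrow> real) \<Rightarrow> bool" where
  "test_function D \<phi> \<longleftrightarrow> (\<forall>k. Ck k \<phi>) \<and>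
     compact (closure {x. \<phi> x \<noteq> 0}) \<and> closure {x. \<phi> x \<noteq> 0} \<subseteq> D"

definition classical_gradient :: "('a::euclidean_space \<Rightarrow> real) \<Rightarrow> 'a \<Rightarrow> 'a" where
  "classical_gradient \<phi> x = (\<Sum>i\<in>Basis. frechet_derivative \<phi> (at x) i *\<^sub>R i)"

definition L2 :: "'a::euclidean_space set \<Rightarrow> ('a \<Rightarrow> 'b::euclidean_space) \<Rightarrow> bool" where
  "L2 D v \<longleftrightarrow> v \<in> borel_measurable (lebesgue_on D) \<and>
     integrable (lebesgue_on D) (\<lambda>x. (norm (v x))\<^sup>2)"

definition L2_norm :: "'a::euclidean_space set \<Rightarrow> ('a \<Rightarrow> 'b::euclidean_space) \<Rightarrow> real" where
  "L2_norm D v = sqrt (LINT x|lebesgue_on D. (norm (v x))\<^sup>2)"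

definition weak_gradient ::
  "'a::euclidean_space set \<Rightarrow> ('a \<Rightarrow> real) \<Rightarrow> ('a \<Rightarrow> 'a) \<Rightarrow> bool" where
  "weak_gradient D v g \<longleftrightarrow> (\<forall>\<phi>. test_function D \<phi> \<longrightarrow> (\<forall>i\<in>Basis.
     (LINT x|lebesgue_on D. v x * (classical_gradient \<phi> x \<bullet> i)) =
     - (LINT x|lebesgue_on D. (g x \<bullet> i) * \<phi> x)))"

text \<open>\<open>v\<close> lies in $H^1(D)$ with weak gradient \<open>g\<close>, and in the $H^1$-closure of the test
  functions.\<close>

definition H01_gradient ::
  "'a::euclidean_space set \<Rightarrow> ('a \<Rightarrow> real) \<Rightarrow> ('a \<Rightarrow> 'a) \<Rightarrow> bool" where
  "H01_gradient D v g \<longleftrightarrow> L2 D v \<and> L2 D g \<and> weak_gradient D v g \<and>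
     (\<exists>\<phi>. (\<forall>n::nat. test_function D (\<phi> n)) \<and>
        (\<lambda>n. L2_norm D (\<lambda>x. \<phi> n x - v x)) \<longlonglongrightarrow> 0 \<and>
        (\<lambda>n. L2_norm D (\<lambda>x. classical_gradient (\<phi> n) x - g x)) \<longlonglongrightarrow> 0)"

definition H01 :: "'a::euclidean_space set \<Rightarrow> ('a \<Rightarrow> real) set" where
  "H01 D = {v. \<exists>g. H01_gradient D v g}"

text \<open>The gradient is unique up to null sets only; \<open>SOME\<close> picks a representative.\<close>

definition grad :: "'a::euclidean_space set \<Rightarrow> ('a \<Rightarrow> real) \<Rightarrow> 'a \<Rightarrow> 'a" where
  "grad D v = (SOME g. H01_gradient D v g)"

definition V_norm :: "'a::euclidean_space set \<Rightarrow> ('a \<Rightarrow> real) \<Rightarrow> real" where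
  "V_norm D v = L2_norm D (grad D v)"


section \<open>The dual space and weak solutions\<close>

text \<open>Boundedness forces a functional to take equal values on functions that agree almost
  everywhere, so these are exactly the bounded linear functionals on the quotient space.\<close>

definition V_dual :: "'a::euclidean_space set \<Rightarrow> (('a \<Rightarrow> real) \<Rightarrow> real) set" where
  "V_dual D = {f.
     (\<forall>v\<in>H01 D. \<forall>w\<in>H01 D. f (\<lambda>x. v x + w x) = f v + f w) \<and>
     (\<forall>c. \<forall>v\<in>H01 D. f (\<lambda>x. c * v x) = c * f v) \<and>
     (\<exists>C. \<forall>v\<in>H01 D. \<bar>f v\<bar> \<le> C * V_norm D v)}"

definition V_dual_norm :: "'a::euclidean_space set \<Rightarrow> (('a \<Rightarrow> real) \<Rightarrow> real) \<Rightarrow> real" where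
  "V_dual_norm D f = (SUP v\<in>{v \<in> H01 D. V_norm D v \<le> 1}. \<bar>f v\<bar>)"

definition weak_solution ::
  "'a::euclidean_space set \<Rightarrow> ('a \<Rightarrow> real) \<Rightarrow> (('a \<Rightarrow> real) \<Rightarrow> real) \<Rightarrow> ('a \<Rightarrow> real) \<Rightarrow> bool" where
  "weak_solution D a f u \<longleftrightarrow> u \<in> H01 D \<and>
     (\<forall>v\<in>H01 D. (LINT x|lebesgue_on D. a x * (grad D u x \<bullet> grad D v x)) = f v)"


section \<open>Parameters and the diffusion coefficient\<close>

text \<open>The index set $\{1,2,\ldots\}$ of the parameters is relabelled as $\{0,1,\ldots\}$.\<close>

definition param_domain :: "(nat \<Rightarrow> real) set" where
  "param_domain = {y. \<forall>j. -1/2 \<le> y j \<and> y j \<le> 1/2}"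

definition diffusion ::
  "('a \<Rightarrow> real) \<Rightarrow> (nat \<Rightarrow> 'a \<Rightarrow> real) \<Rightarrow> (nat \<Rightarrow> real) \<Rightarrow> 'a \<Rightarrow> real" where
  "diffusion a0 \<psi> y x = a0 x + (\<Sum>j. y j * \<psi> j x)"


section \<open>Multi-indices\<close>

definition supp :: "(nat \<Rightarrow> nat) \<Rightarrow> nat set" where
  "supp \<nu> = {j. \<nu> j > 0}"

definition F1 :: "(nat \<Rightarrow> nat) set" where
  "F1 = {\<nu>. (\<forall>j. \<nu> j \<in> {0, 1}) \<and> finite (supp \<nu>)}"

definition mi_order :: "(nat \<Rightarrow> nat) \<Rightarrow> nat" where
  "mi_order \<nu> = (\<Sum>j\<in>supp \<nu>. \<nu> j)"

definition mi_power :: "(nat \<Rightarrow> real) \<Rightarrow> (nat \<Rightarrow> nat) \<Rightarrow> real" where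
  "mi_power b \<nu> = (\<Prod>j\<in>supp \<nu>. b j ^ \<nu> j)"


section \<open>Mixed partial derivatives of $V$-valued maps\<close>

text \<open>\<open>w\<close> is the derivative of \<open>v\<close> at \<open>y\<close> in the \<open>j\<close>-th parameter, as a limit in \<open>V\<close>
  (one-sided if \<open>y j\<close> is an endpoint of the parameter interval).\<close>

definition has_partial_derivative ::
  "'a::euclidean_space set \<Rightarrow> nat \<Rightarrow> ((nat \<Rightarrow> real) \<Rightarrow> 'a \<Rightarrow> real) \<Rightarrow> (nat \<Rightarrow> real) \<Rightarrow>
   ('a \<Rightarrow> real) \<Rightarrow> bool" where
  "has_partial_derivative D j v y w \<longleftrightarrow> w \<in> H01 D \<and>
     ((\<lambda>h. V_norm D (\<lambda>x. (v (y(j := y j + h)) x - v y x) / h - w x)) \<longlongrightarrow> 0)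
       (at 0 within {h. y(j := y j + h) \<in> param_domain})"

fun iterated_partials ::
  "'a::euclidean_space set \<Rightarrow> nat list \<Rightarrow> ((nat \<Rightarrow> real) \<Rightarrow> 'a \<Rightarrow> real) \<Rightarrow>
   ((nat \<Rightarrow> real) \<Rightarrow> 'a \<Rightarrow> real) \<Rightarrow> bool" where
  "iterated_partials D [] u w \<longleftrightarrow>
     (\<forall>y\<in>param_domain. w y \<in> H01 D \<and> (AE x in lebesgue_on D. w y x = u y x))"
| "iterated_partials D (j # js) u w \<longleftrightarrow>
     (\<exists>v. iterated_partials D js u v \<and>
        (\<forall>y\<in>param_domain. has_partial_derivative D j v y (w y)))"

text \<open>\<open>w\<close> is the mixed derivative \<open>\<partial>\<^sup>\<nu> u\<close> on the whole parameter domain, whatever the order of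
  differentiation.\<close>

definition has_mixed_partial ::
  "'a::euclidean_space set \<Rightarrow> (nat \<Rightarrow> nat) \<Rightarrow> ((nat \<Rightarrow> real) \<Rightarrow> 'a \<Rightarrow> real) \<Rightarrow>
   ((nat \<Rightarrow> real) \<Rightarrow> 'a \<Rightarrow> real) \<Rightarrow> bool" where
  "has_mixed_partial D \<nu> u w \<longleftrightarrow>
     (\<forall>js. (\<forall>j. count_list js j = \<nu> j) \<longrightarrow> iterated_partials D js u w)"


section \<open>The $L^\infty$ quantities\<close>

text \<open>All functions involved are nonnegative almost everywhere, and the infinite series may
  diverge a priori, so the norms are taken of \<open>ennreal\<close>-valued functions.\<close>

definition Linf_norm :: "'a::euclidean_space set \<Rightarrow> ('a \<Rightarrow> ennreal) \<Rightarrow> ennreal" where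
  "Linf_norm D g = esssup (lebesgue_on D) g"

definition kappa_total ::
  "'a::euclidean_space set \<Rightarrow> ('a \<Rightarrow> real) \<Rightarrow> (nat \<Rightarrow> 'a \<Rightarrow> real) \<Rightarrow> (nat \<Rightarrow> real) \<Rightarrow> ennreal" where
  "kappa_total D a0 \<psi> b =
     Linf_norm D (\<lambda>x. \<Sum>j. ennreal ((\<bar>\<psi> j x\<bar> / b j) / (2 * a0 x)))"

definition kappa_tilde ::
  "'a::euclidean_space set \<Rightarrow> ('a \<Rightarrow> real) \<Rightarrow> (nat \<Rightarrow> 'a \<Rightarrow> real) \<Rightarrow> (nat \<Rightarrow> real) \<Rightarrow>
   (nat \<Rightarrow> nat) \<Rightarrow> ennreal" where
  "kappa_tilde D a0 \<psi> b \<nu> =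
     Linf_norm D (\<lambda>x. \<Sum>j\<in>supp \<nu>. ennreal ((\<bar>\<psi> j x\<bar> / b j) / (2 * a0 x)))"

definition kappa_order ::
  "'a::euclidean_space set \<Rightarrow> ('a \<Rightarrow> real) \<Rightarrow> (nat \<Rightarrow> 'a \<Rightarrow> real) \<Rightarrow> (nat \<Rightarrow> real) \<Rightarrow>
   nat \<Rightarrow> ennreal" where
  "kappa_order D a0 \<psi> b k = (SUP \<nu>\<in>{\<nu> \<in> F1. mi_order \<nu> = k}. kappa_tilde D a0 \<psi> b \<nu>)"

end

theory Submission
  imports Defs
begin

text \<open>Differentiating the equation formally in the directions of a finite set \<open>S\<close> of parameters, and
using that the coefficient is affine in each of them, shows what the gradient \<open>U S\<close> of the mixed
derivative has to be: it is a gradient field with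
\<open>\<integral> a(y) U S \<bullet> v = - (\<Sum>j\<in>S. \<integral> \<psi> j (U (S - {j})) \<bullet> v)\<close> for every gradient field \<open>v\<close>, and \<open>U {}\<close> is the
gradient of the solution. Such fields exist by the Riesz representation theorem
(\<open>weak_equation_solvable\<close>). They are the derivatives because the error of a difference quotient
satisfies an equation of the same form whose right-hand side consists of errors for smaller
sets and of one term of size \<open>\<bar>h\<bar>\<close> (\<open>quotient_error_equation\<close>), so that it tends to 0 by
induction on \<open>S\<close>. The recursion is symmetric in \<open>S\<close>; hence the order of differentiation is
immaterial, and a derivative is determined by \<open>S\<close> up to its gradient almost everywhere.

Estimating the recursion for one set \<open>S\<close> at a time would produce a factor \<open>(card S)!\<close>. The bound
without factorial (\<open>mixed_field_energy_bound\<close>) comes from treating all subsets of \<open>S\<close> of one size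
together. Test the equation for \<open>T \<subseteq> S\<close> with the rescaled field \<open>U T / b\<^sup>T\<close> itself and split each product
on the right by Young's inequality with the weight \<open>\<bar>\<psi> j\<bar> / b j\<close>. After summation over the \<open>T\<close> with
\<open>m + 1\<close> elements, a set \<open>R\<close> with \<open>m\<close> elements is charged once for every \<open>j \<in> S - R\<close>, that is, with the total
weight \<open>\<Sum>j\<in>S - R. \<bar>\<psi> j\<bar> / b j \<le> 2 \<kappa> a0\<close>. So the energy of a layer is at most \<open>(2 \<kappa> / (1 - \<kappa>_bar))\<^sup>2\<close>
times the energy of the layer below it, and the top layer consists of \<open>S\<close> alone.

What remains is functional analysis. The gradients of functions in $H^1_0(D)$ have to form a
closed subspace of $L^2$ (\<open>H01_complete\<close>); this rests on the completeness of $L^2$ and on the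
Poincare inequality. They also have to be unique up to null sets (\<open>H01_gradient_unique\<close>), which
makes all norms independent of the chosen representatives.\<close>

section \<open>Square-integrable fields\<close>

lemma L2_measurable [measurable_dest]: "L2 D F \<Longrightarrow> F \<in> borel_measurable (lebesgue_on D)"
  by (simp add: L2_def)

lemma L2_integrable_square: "L2 D F \<Longrightarrow> integrable (lebesgue_on D) (\<lambda>x. (norm (F x))\<^sup>2)"
  by (simp add: L2_def)

lemma L2_norm_nonneg: "0 \<le> L2_norm D F"
  by (simp add: L2_norm_def)

lemma L2_norm_square: "(L2_norm D F)\<^sup>2 = (LINT x|lebesgue_on D. (norm (F x))\<^sup>2)"
  by (simp add: L2_norm_def)

lemma L2_norm_cong_AE:
  assumes "AE x in lebesgue_on D. F x = G x" "L2 D F" "L2 D G"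
  shows "L2_norm D F = L2_norm D G"
proof -
  note [measurable] = assms(2,3)[THEN L2_measurable]
  show ?thesis
    unfolding L2_norm_def using assms(1) by (intro arg_cong[where f=sqrt] integral_cong_AE) auto
qed

lemma L2_dominated:
  assumes G: "L2 D G" and F: "F \<in> borel_measurable (lebesgue_on D)"
    and le: "AE x in lebesgue_on D. norm (F x) \<le> C * norm (G x)"
  shows "L2 D F"
  unfolding L2_def
proof (intro conjI F)
  note [measurable] = F
  have "AE x in lebesgue_on D. norm ((norm (F x))\<^sup>2) \<le> norm (C\<^sup>2 * (norm (G x))\<^sup>2)"
    using le
  proof eventually_elim
    case (elim x)
    then have "(norm (F x))\<^sup>2 \<le> (C * norm (G x))\<^sup>2" by (intro power_mono) auto
    then show ?case by (simp add: power_mult_distrib)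
  qed
  then show "integrable (lebesgue_on D) (\<lambda>x. (norm (F x))\<^sup>2)"
    by (rule Bochner_Integration.integrable_bound[rotated 2]) (auto intro: L2_integrable_square G)
qed

lemma L2_norm_dominated:
  assumes G: "L2 D G" and F: "F \<in> borel_measurable (lebesgue_on D)" and C: "0 \<le> C"
    and le: "AE x in lebesgue_on D. norm (F x) \<le> C * norm (G x)"
  shows "L2_norm D F \<le> C * L2_norm D G"
proof -
  have LF: "L2 D F" by (rule L2_dominated[OF G F le])
  have "(LINT x|lebesgue_on D. (norm (F x))\<^sup>2) \<le> (LINT x|lebesgue_on D. C\<^sup>2 * (norm (G x))\<^sup>2)"
  proof (rule integral_mono_AE)
    show "AE x in lebesgue_on D. (norm (F x))\<^sup>2 \<le> C\<^sup>2 * (norm (G x))\<^sup>2"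
      using le
    proof eventually_elim
      case (elim x)
      then have "(norm (F x))\<^sup>2 \<le> (C * norm (G x))\<^sup>2" by (intro power_mono) auto
      then show ?case by (simp add: power_mult_distrib)
    qed
  qed (auto intro: L2_integrable_square LF G)
  then have "(L2_norm D F)\<^sup>2 \<le> (C * L2_norm D G)\<^sup>2"
    by (simp add: L2_norm_square power_mult_distrib)
  then show ?thesis
    by (rule power2_le_imp_le) (simp add: C L2_norm_nonneg)
qed

lemma L2_cmult:
  fixes F :: "'a::euclidean_space \<Rightarrow> 'b::euclidean_space"
  assumes "L2 D F" shows "L2 D (\<lambda>x. c *\<^sub>R F x)"
  by (rule L2_dominated[OF assms, of _ "\<bar>c\<bar>"]) (use assms in \<open>auto dest: L2_measurable\<close>)

lemma L2_norm_cmult: "L2_norm D (\<lambda>x. c *\<^sub>R F x) = \<bar>c\<bar> * L2_norm D F"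
  by (simp add: L2_norm_def power_mult_distrib real_sqrt_mult)

lemma L2_add:
  fixes F G :: "'a::euclidean_space \<Rightarrow> 'b::euclidean_space"
  assumes "L2 D F" "L2 D G" shows "L2 D (\<lambda>x. F x + G x)"
  unfolding L2_def
proof
  note [measurable] = assms[THEN L2_measurable]
  show "(\<lambda>x. F x + G x) \<in> borel_measurable (lebesgue_on D)" by simp
  have *: "(norm (a + b))\<^sup>2 \<le> 2 * (norm a)\<^sup>2 + 2 * (norm b)\<^sup>2" for a b :: 'b
  proof -
    have "(norm (a + b))\<^sup>2 \<le> (norm (a + b))\<^sup>2 + (norm (a - b))\<^sup>2" by simp
    also have "\<dots> = 2 * (norm a)\<^sup>2 + 2 * (norm b)\<^sup>2"
      by (simp add: power2_norm_eq_inner inner_diff inner_add inner_commute)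
    finally show ?thesis .
  qed
  have "integrable (lebesgue_on D) (\<lambda>x. 2 * (norm (F x))\<^sup>2 + 2 * (norm (G x))\<^sup>2)"
    by (intro Bochner_Integration.integrable_add integrable_mult_right L2_integrable_square assms)
  then show "integrable (lebesgue_on D) (\<lambda>x. (norm (F x + G x))\<^sup>2)"
    by (rule Bochner_Integration.integrable_bound) (simp, rule AE_I2, simp add: *)
qed

lemma L2_uminus:
  fixes F :: "'a::euclidean_space \<Rightarrow> 'b::euclidean_space"
  shows "L2 D F \<Longrightarrow> L2 D (\<lambda>x. - F x)"
  using L2_cmult[of D F "-1"] by simp

lemma L2_diff:
  fixes F G :: "'a::euclidean_space \<Rightarrow> 'b::euclidean_space"
  assumes "L2 D F" "L2 D G" shows "L2 D (\<lambda>x. F x - G x)"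
  using L2_add[OF assms(1) L2_uminus[OF assms(2)]] by simp

lemma L2_zero: "L2 D (\<lambda>x. 0 :: 'b::euclidean_space)"
  by (simp add: L2_def)

lemma L2_norm_zero: "L2_norm D (\<lambda>x. 0 :: 'b::euclidean_space) = 0"
  by (simp add: L2_norm_def)

lemma L2_sum:
  fixes F :: "'i \<Rightarrow> 'a::euclidean_space \<Rightarrow> 'b::euclidean_space"
  assumes "\<And>i. i \<in> I \<Longrightarrow> L2 D (F i)" shows "L2 D (\<lambda>x. \<Sum>i\<in>I. F i x)"
  using assms by (induction I rule: infinite_finite_induct) (auto intro: L2_zero L2_add)

lemma L2_weight:
  fixes F :: "'a::euclidean_space \<Rightarrow> 'b::euclidean_space"
  assumes F: "L2 D F" and m: "m \<in> borel_measurable (lebesgue_on D)"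
    and C: "AE x in lebesgue_on D. \<bar>m x\<bar> \<le> C"
  shows "L2 D (\<lambda>x. m x *\<^sub>R F x)"
proof (rule L2_dominated[OF F])
  note [measurable] = m F[THEN L2_measurable]
  show "(\<lambda>x. m x *\<^sub>R F x) \<in> borel_measurable (lebesgue_on D)" by simp
  show "AE x in lebesgue_on D. norm (m x *\<^sub>R F x) \<le> C * norm (F x)"
    using C by eventually_elim (simp add: mult_right_mono)
qed

lemma L2_norm_weight:
  fixes F :: "'a::euclidean_space \<Rightarrow> 'b::euclidean_space"
  assumes F: "L2 D F" and m: "m \<in> borel_measurable (lebesgue_on D)" and C0: "0 \<le> C"
    and C: "AE x in lebesgue_on D. \<bar>m x\<bar> \<le> C"
  shows "L2_norm D (\<lambda>x. m x *\<^sub>R F x) \<le> C * L2_norm D F"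
proof (rule L2_norm_dominated[OF F _ C0])
  note [measurable] = m F[THEN L2_measurable]
  show "(\<lambda>x. m x *\<^sub>R F x) \<in> borel_measurable (lebesgue_on D)" by simp
  show "AE x in lebesgue_on D. norm (m x *\<^sub>R F x) \<le> C * norm (F x)"
    using C by eventually_elim (simp add: mult_right_mono)
qed

lemma L2_inner_integrable:
  fixes F G :: "'a::euclidean_space \<Rightarrow> 'b::euclidean_space"
  assumes "L2 D F" "L2 D G" shows "integrable (lebesgue_on D) (\<lambda>x. F x \<bullet> G x)"
proof -
  note [measurable] = assms[THEN L2_measurable]
  have *: "\<bar>a \<bullet> b\<bar> \<le> (norm a)\<^sup>2 + (norm b)\<^sup>2" for a b :: 'b
  proof -
    have "\<bar>a \<bullet> b\<bar> \<le> norm a * norm b" by (rule Cauchy_Schwarz_ineq2)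
    also have "\<dots> \<le> (norm a)\<^sup>2 + (norm b)\<^sup>2"
      using sum_squares_bound[of "norm a" "norm b"] mult_nonneg_nonneg[OF norm_ge_zero[of a] norm_ge_zero[of b]]
      by linarith
    finally show ?thesis .
  qed
  have "integrable (lebesgue_on D) (\<lambda>x. (norm (F x))\<^sup>2 + (norm (G x))\<^sup>2)"
    by (intro Bochner_Integration.integrable_add L2_integrable_square assms)
  then show ?thesis
    by (rule Bochner_Integration.integrable_bound) (simp, rule AE_I2, simp add: *)
qed

lemma L2_weighted_inner_integrable:
  fixes F G :: "'a::euclidean_space \<Rightarrow> 'b::euclidean_space"
  assumes "L2 D F" "L2 D G" "m \<in> borel_measurable (lebesgue_on D)"
    and "AE x in lebesgue_on D. \<bar>m x\<bar> \<le> C"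
  shows "integrable (lebesgue_on D) (\<lambda>x. m x * (F x \<bullet> G x))"
  using L2_inner_integrable[OF L2_weight[OF assms(1,3,4)] assms(2)] by simp

lemma L2_norm_eq_0:
  assumes "L2 D F" "L2_norm D F = 0"
  shows "AE x in lebesgue_on D. F x = 0"
proof -
  have "(LINT x|lebesgue_on D. (norm (F x))\<^sup>2) = 0"
    using assms(2) by (simp add: L2_norm_def)
  then have "AE x in lebesgue_on D. (norm (F x))\<^sup>2 = 0"
    by (subst (asm) integral_nonneg_eq_0_iff_AE) (auto intro: L2_integrable_square assms)
  then show ?thesis by eventually_elim simp
qed

text \<open>The integral form of \<open>2 \<bar>a \<bullet> b\<bar> \<le> (q / p) \<bar>a\<bar>\<^sup>2 + (p / q) \<bar>b\<bar>\<^sup>2\<close>, where \<open>p\<close> and \<open>q\<close> are the two norms.\<close>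

lemma L2_Cauchy_Schwarz:
  fixes F G :: "'a::euclidean_space \<Rightarrow> 'b::euclidean_space"
  assumes F: "L2 D F" and G: "L2 D G"
  shows "\<bar>LINT x|lebesgue_on D. F x \<bullet> G x\<bar> \<le> L2_norm D F * L2_norm D G"
proof (cases "L2_norm D F = 0 \<or> L2_norm D G = 0")
  case True
  then have "AE x in lebesgue_on D. F x \<bullet> G x = 0"
    using L2_norm_eq_0[OF F] L2_norm_eq_0[OF G] by auto
  then have "(LINT x|lebesgue_on D. F x \<bullet> G x) = (LINT x|lebesgue_on D. 0)"
    using L2_inner_integrable[OF F G] by (intro integral_cong_AE) auto
  with True show ?thesis by auto
next
  case False
  define p q where "p = L2_norm D F" and "q = L2_norm D G"
  have pq: "0 < p" "0 < q" using False L2_norm_nonneg[of D F] L2_norm_nonneg[of D G]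
    by (auto simp: p_def q_def)
  have *: "\<bar>a \<bullet> b\<bar> \<le> (q / p * (norm a)\<^sup>2 + p / q * (norm b)\<^sup>2) / 2" for a b :: 'b
  proof -
    have "\<bar>a \<bullet> b\<bar> \<le> norm a * norm b" by (rule Cauchy_Schwarz_ineq2)
    moreover have "0 \<le> (q * norm a - p * norm b)\<^sup>2 / (p * q)" using pq by simp
    then have "2 * (norm a * norm b) \<le> q / p * (norm a)\<^sup>2 + p / q * (norm b)\<^sup>2"
      using pq by (simp add: power2_eq_square field_simps)
    ultimately show ?thesis by simp
  qed
  have "\<bar>LINT x|lebesgue_on D. F x \<bullet> G x\<bar> \<le> (LINT x|lebesgue_on D. \<bar>F x \<bullet> G x\<bar>)"
    by (rule integral_abs_bound)
  also have "\<dots> \<le> (LINT x|lebesgue_on D. (q / p * (norm (F x))\<^sup>2 + p / q * (norm (G x))\<^sup>2) / 2)"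
    by (intro integral_mono integrable_abs L2_inner_integrable F G * integrable_divide
        Bochner_Integration.integrable_add integrable_mult_right L2_integrable_square)
  also have "\<dots> = (q / p * p\<^sup>2 + p / q * q\<^sup>2) / 2"
    unfolding p_def q_def
    by (simp add: F G L2_integrable_square L2_norm_square[symmetric])
  also have "\<dots> = p * q" using pq by (simp add: power2_eq_square)
  finally show ?thesis by (simp add: p_def q_def)
qed

lemma L2_norm_triangle:
  fixes F G :: "'a::euclidean_space \<Rightarrow> 'b::euclidean_space"
  assumes F: "L2 D F" and G: "L2 D G"
  shows "L2_norm D (\<lambda>x. F x + G x) \<le> L2_norm D F + L2_norm D G"
proof (rule power2_le_imp_le)
  have "(L2_norm D (\<lambda>x. F x + G x))\<^sup>2
      = (LINT x|lebesgue_on D. (norm (F x))\<^sup>2 + (norm (G x))\<^sup>2 + 2 * (F x \<bullet> G x))"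
    by (simp add: L2_norm_square power2_norm_eq_inner inner_add inner_commute algebra_simps)
  also have "\<dots> = (L2_norm D F)\<^sup>2 + (L2_norm D G)\<^sup>2 + 2 * (LINT x|lebesgue_on D. F x \<bullet> G x)"
    by (simp add: L2_norm_square F G L2_integrable_square L2_inner_integrable)
  also have "\<dots> \<le> (L2_norm D F + L2_norm D G)\<^sup>2"
    using L2_Cauchy_Schwarz[OF F G] by (simp add: power2_sum)
  finally show "(L2_norm D (\<lambda>x. F x + G x))\<^sup>2 \<le> (L2_norm D F + L2_norm D G)\<^sup>2" .
qed (simp add: L2_norm_nonneg)

lemma L2_norm_minus_commute: "L2_norm D (\<lambda>x. F x - G x) = L2_norm D (\<lambda>x. G x - F x)"
  by (simp add: L2_norm_def norm_minus_commute)

lemma L2_norm_triangle_diff: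
  fixes F G H :: "'a::euclidean_space \<Rightarrow> 'b::euclidean_space"
  assumes "L2 D F" "L2 D G" "L2 D H"
  shows "L2_norm D (\<lambda>x. F x - H x) \<le> L2_norm D (\<lambda>x. F x - G x) + L2_norm D (\<lambda>x. G x - H x)"
  using L2_norm_triangle[OF L2_diff[OF assms(1,2)] L2_diff[OF assms(2,3)]] by simp

lemma L2_norm_tendsto:
  fixes F :: "nat \<Rightarrow> 'a::euclidean_space \<Rightarrow> 'b::euclidean_space"
  assumes F: "\<And>n. L2 D (F n)" and G: "L2 D G"
    and lim: "(\<lambda>n. L2_norm D (\<lambda>x. F n x - G x)) \<longlonglongrightarrow> 0"
  shows "(\<lambda>n. L2_norm D (F n)) \<longlonglongrightarrow> L2_norm D G"
proof -
  have "(\<lambda>n. L2_norm D (F n) - L2_norm D G) \<longlonglongrightarrow> 0"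
  proof (rule Lim_null_comparison[OF _ lim], intro always_eventually allI)
    fix n
    have "L2_norm D (F n) \<le> L2_norm D (\<lambda>x. F n x - G x) + L2_norm D G"
      using L2_norm_triangle[OF L2_diff[OF F[of n] G] G] by simp
    moreover have "L2_norm D G \<le> L2_norm D (\<lambda>x. F n x - G x) + L2_norm D (F n)"
      using L2_norm_triangle[OF L2_diff[OF G F[of n]] F[of n]]
      by (simp add: L2_norm_minus_commute[of D G])
    ultimately show "norm (L2_norm D (F n) - L2_norm D G) \<le> L2_norm D (\<lambda>x. F n x - G x)" by simp
  qed
  then show ?thesis by (simp add: LIM_zero_iff)
qed

lemma L2_inner_tendsto:
  fixes F :: "nat \<Rightarrow> 'a::euclidean_space \<Rightarrow> 'b::euclidean_space"
  assumes F: "\<And>n. L2 D (F n)" and G: "L2 D G" and H: "L2 D H"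
    and lim: "(\<lambda>n. L2_norm D (\<lambda>x. F n x - G x)) \<longlonglongrightarrow> 0"
  shows "(\<lambda>n. LINT x|lebesgue_on D. F n x \<bullet> H x) \<longlonglongrightarrow> (LINT x|lebesgue_on D. G x \<bullet> H x)"
proof -
  have "(\<lambda>n. (LINT x|lebesgue_on D. F n x \<bullet> H x) - (LINT x|lebesgue_on D. G x \<bullet> H x)) \<longlonglongrightarrow> 0"
  proof (rule Lim_null_comparison, intro always_eventually allI)
    fix n
    have "(LINT x|lebesgue_on D. F n x \<bullet> H x) - (LINT x|lebesgue_on D. G x \<bullet> H x)
        = (LINT x|lebesgue_on D. (F n x - G x) \<bullet> H x)"
      by (simp add: inner_diff_left F G H L2_inner_integrable)
    then show "norm ((LINT x|lebesgue_on D. F n x \<bullet> H x) - (LINT x|lebesgue_on D. G x \<bullet> H x))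
        \<le> L2_norm D (\<lambda>x. F n x - G x) * L2_norm D H"
      using L2_Cauchy_Schwarz[OF L2_diff[OF F[of n] G] H] by simp
    show "(\<lambda>n. L2_norm D (\<lambda>x. F n x - G x) * L2_norm D H) \<longlonglongrightarrow> 0"
      using tendsto_mult_right[OF lim, of "L2_norm D H"] by simp
  qed
  then show ?thesis by (simp add: LIM_zero_iff)
qed

lemma L2_nn_integral:
  assumes "L2 D F"
  shows "(\<integral>\<^sup>+x. ennreal ((norm (F x))\<^sup>2) \<partial>lebesgue_on D) = ennreal ((L2_norm D F)\<^sup>2)"
  unfolding L2_norm_square by (rule nn_integral_eq_integral) (auto intro: L2_integrable_square assms)

text \<open>The weights \<open>4 ^ n\<close> turn summability in norm into pointwise decay: the integral of
\<open>\<Sum>n. 4 ^ n * \<bar>F (n + 1) - F n\<bar>\<^sup>2\<close> is at most \<open>\<Sum>n. 4 ^ n * 16 ^ - n\<close>, so the series is finite almost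
everywhere, and where it is, the increments are \<open>O(2 ^ - n)\<close>.\<close>

lemma L2_fast_Cauchy_AE_convergent:
  fixes F :: "nat \<Rightarrow> 'a::euclidean_space \<Rightarrow> 'b::euclidean_space"
  assumes F: "\<And>n. L2 D (F n)"
    and fast: "\<And>n. L2_norm D (\<lambda>x. F (Suc n) x - F n x) \<le> (1/4) ^ n"
  shows "AE x in lebesgue_on D. convergent (\<lambda>n. F n x)"
proof -
  note [measurable] = F[THEN L2_measurable]
  define d where "d n x = norm (F (Suc n) x - F n x)" for n x
  have [measurable]: "d n \<in> borel_measurable (lebesgue_on D)" for n
    unfolding d_def[abs_def] by measurable
  have "(\<integral>\<^sup>+x. (\<Sum>n. ennreal (4 ^ n * (d n x)\<^sup>2)) \<partial>lebesgue_on D)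
      = (\<Sum>n. \<integral>\<^sup>+x. ennreal (4 ^ n * (d n x)\<^sup>2) \<partial>lebesgue_on D)"
    by (rule nn_integral_suminf) simp
  also have "\<dots> \<le> (\<Sum>n. ennreal ((1/4) ^ n))"
  proof (rule suminf_le)
    fix n
    have "(\<integral>\<^sup>+x. ennreal (4 ^ n * (d n x)\<^sup>2) \<partial>lebesgue_on D)
        = ennreal (4 ^ n) * (\<integral>\<^sup>+x. ennreal ((d n x)\<^sup>2) \<partial>lebesgue_on D)"
      by (simp add: ennreal_mult nn_integral_cmult)
    also have "\<dots> = ennreal (4 ^ n * (L2_norm D (\<lambda>x. F (Suc n) x - F n x))\<^sup>2)"
      unfolding d_def by (subst L2_nn_integral) (auto intro: L2_diff F simp: ennreal_mult)
    also have "\<dots> \<le> ennreal (4 ^ n * ((1/4) ^ n)\<^sup>2)"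
      using fast[of n] by (intro ennreal_leI mult_left_mono power_mono) (auto simp: L2_norm_nonneg)
    also have "4 ^ n * ((1/4) ^ n)\<^sup>2 = ((1/4::real) ^ n)"
      by (simp add: power2_eq_square flip: power_mult_distrib)
    finally show "(\<integral>\<^sup>+x. ennreal (4 ^ n * (d n x)\<^sup>2) \<partial>lebesgue_on D) \<le> ennreal ((1/4) ^ n)" .
  qed auto
  also have "\<dots> = ennreal (\<Sum>n. (1/4) ^ n)"
    by (rule suminf_ennreal2) (auto intro: summable_geometric)
  also have "\<dots> < \<infinity>" by simp
  finally have "AE x in lebesgue_on D. (\<Sum>n. ennreal (4 ^ n * (d n x)\<^sup>2)) \<noteq> \<infinity>"
    by (intro nn_integral_PInf_AE) auto
  then show ?thesis
  proof eventually_elim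
    case (elim x)
    then have "summable (\<lambda>n. 4 ^ n * (d n x)\<^sup>2)"
      by (intro summable_suminf_not_top) simp_all
    then have "Bseq (\<lambda>n. 4 ^ n * (d n x)\<^sup>2)"
      by (rule convergent_imp_Bseq[OF convergentI[OF summable_LIMSEQ_zero]])
    then obtain K where K: "\<And>n. norm (4 ^ n * (d n x)\<^sup>2) \<le> K" and "0 < K"
      by (rule BseqE) blast
    have decay: "norm (F (Suc n) x - F n x) \<le> sqrt K * (1/2) ^ n" for n
    proof -
      have "(2 ^ n * d n x)\<^sup>2 = (2 ^ n * 2 ^ n) * (d n x)\<^sup>2"
        by (simp only: power2_eq_square mult_ac)
      also have "2 ^ n * 2 ^ n = (4::real) ^ n"
        by (simp flip: power_mult_distrib)
      also have "4 ^ n * (d n x)\<^sup>2 \<le> K"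
        using K[of n] by simp
      finally have "(2 ^ n * d n x)\<^sup>2 \<le> K" .
      then have "2 ^ n * d n x \<le> sqrt K" by (rule real_le_rsqrt)
      then show ?thesis by (simp add: d_def power_one_over field_simps)
    qed
    have "summable (\<lambda>n. sqrt K * (1/2) ^ n)"
      by (intro summable_mult summable_geometric) simp
    then have "summable (\<lambda>n. F (Suc n) x - F n x)"
      by (rule summable_comparison_test'[where N=0]) (rule decay)
    then have "(\<lambda>n. \<Sum>i<n. F (Suc i) x - F i x) \<longlonglongrightarrow> (\<Sum>n. F (Suc n) x - F n x)"
      by (rule summable_LIMSEQ)
    then have "(\<lambda>n. F n x - F 0 x) \<longlonglongrightarrow> (\<Sum>n. F (Suc n) x - F n x)"
      by (simp add: sum_lessThan_telescope[of "\<lambda>n. F n x"])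
    then have "(\<lambda>n. F n x - F 0 x + F 0 x) \<longlonglongrightarrow> (\<Sum>n. F (Suc n) x - F n x) + F 0 x"
      by (intro tendsto_intros)
    then show ?case by (auto intro: convergentI)
  qed
qed

definition L2_Cauchy :: "'a::euclidean_space set \<Rightarrow> (nat \<Rightarrow> 'a \<Rightarrow> 'b::euclidean_space) \<Rightarrow> bool" where
  "L2_Cauchy D F \<longleftrightarrow> (\<forall>e>0. \<exists>N. \<forall>m\<ge>N. \<forall>n\<ge>N. L2_norm D (\<lambda>x. F m x - F n x) < e)"

text \<open>A subsequence converges almost everywhere; Fatou's lemma transfers the Cauchy estimate to the
pointwise limit.\<close>

theorem L2_complete:
  fixes F :: "nat \<Rightarrow> 'a::euclidean_space \<Rightarrow> 'b::euclidean_space"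
  assumes F: "\<And>n. L2 D (F n)" and Cauchy: "L2_Cauchy D F"
  obtains G where "L2 D G" "(\<lambda>n. L2_norm D (\<lambda>x. F n x - G x)) \<longlonglongrightarrow> 0"
proof -
  note [measurable] = F[THEN L2_measurable]
  obtain r :: "nat \<Rightarrow> nat" where r: "strict_mono r"
    and fast: "\<And>k m n. r k \<le> m \<Longrightarrow> r k \<le> n \<Longrightarrow> L2_norm D (\<lambda>x. F m x - F n x) < (1/4) ^ k"
  proof -
    have "\<exists>r. \<forall>k. (\<forall>m\<ge>r k. \<forall>n\<ge>r k. L2_norm D (\<lambda>x. F m x - F n x) < (1/4) ^ k) \<and> r k < r (Suc k)"
    proof (rule dependent_nat_choice)
      show "\<exists>N. \<forall>m\<ge>N. \<forall>n\<ge>N. L2_norm D (\<lambda>x. F m x - F n x) < (1/4) ^ 0"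
        using Cauchy[unfolded L2_Cauchy_def, rule_format, of 1] by simp
      fix N k
      have "(0::real) < (1/4) ^ Suc k" by simp
      then obtain N' where "\<forall>m\<ge>N'. \<forall>n\<ge>N'. L2_norm D (\<lambda>x. F m x - F n x) < (1/4) ^ Suc k"
        using Cauchy[unfolded L2_Cauchy_def, rule_format, of "(1/4) ^ Suc k"] by blast
      then show "\<exists>N'. (\<forall>m\<ge>N'. \<forall>n\<ge>N'. L2_norm D (\<lambda>x. F m x - F n x) < (1/4) ^ Suc k) \<and> N < N'"
        by (intro exI[of _ "max N' (Suc N)"]) auto
    qed
    then show ?thesis by (auto intro: that strict_mono_Suc_iff[THEN iffD2])
  qed
  define G where "G x = lim (\<lambda>k. F (r k) x)" for x
  have [measurable]: "G \<in> borel_measurable (lebesgue_on D)"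
    unfolding G_def by measurable
  have "AE x in lebesgue_on D. convergent (\<lambda>k. F (r k) x)"
    using r by (intro L2_fast_Cauchy_AE_convergent F less_imp_le[OF fast]) (auto simp: strict_mono_less_eq)
  then have G_lim: "AE x in lebesgue_on D. (\<lambda>k. F (r k) x) \<longlonglongrightarrow> G x"
    by eventually_elim (simp add: G_def convergent_LIMSEQ_iff)
  have *: "L2 D (\<lambda>x. F n x - G x) \<and> L2_norm D (\<lambda>x. F n x - G x) \<le> (1/4) ^ k"
    if n: "r k \<le> n" for n k
  proof -
    have "(\<integral>\<^sup>+x. ennreal ((norm (F n x - G x))\<^sup>2) \<partial>lebesgue_on D)
        = (\<integral>\<^sup>+x. liminf (\<lambda>i. ennreal ((norm (F n x - F (r i) x))\<^sup>2)) \<partial>lebesgue_on D)"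
    proof (rule nn_integral_cong_AE)
      show "AE x in lebesgue_on D. ennreal ((norm (F n x - G x))\<^sup>2)
          = liminf (\<lambda>i. ennreal ((norm (F n x - F (r i) x))\<^sup>2))"
        using G_lim
        by eventually_elim (intro lim_imp_Liminf[symmetric] tendsto_ennrealI tendsto_intros; simp)
    qed
    also have "\<dots> \<le> liminf (\<lambda>i. \<integral>\<^sup>+x. ennreal ((norm (F n x - F (r i) x))\<^sup>2) \<partial>lebesgue_on D)"
      by (rule nn_integral_liminf) simp
    also have "\<dots> \<le> ennreal (((1/4) ^ k)\<^sup>2)"
    proof (rule Liminf_le)
      have "r k \<le> r i" if "i \<ge> k" for i
        using r that by (simp add: strict_mono_less_eq)
      then have "(\<integral>\<^sup>+x. ennreal ((norm (F n x - F (r i) x))\<^sup>2) \<partial>lebesgue_on D) \<le> ennreal (((1/4) ^ k)\<^sup>2)"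
        if "i \<ge> k" for i
      proof -
        have "L2_norm D (\<lambda>x. F n x - F (r i) x) \<le> (1/4) ^ k"
          using fast[of k n "r i"] n \<open>\<And>i. k \<le> i \<Longrightarrow> r k \<le> r i\<close>[OF that] by simp
        then show ?thesis
          by (subst L2_nn_integral[OF L2_diff[OF F F]]) (intro ennreal_leI power_mono L2_norm_nonneg)
      qed
      then show "\<forall>\<^sub>F i in sequentially.
          (\<integral>\<^sup>+x. ennreal ((norm (F n x - F (r i) x))\<^sup>2) \<partial>lebesgue_on D) \<le> ennreal (((1/4) ^ k)\<^sup>2)"
        by (auto simp: eventually_sequentially)
    qed auto
    finally have le: "(\<integral>\<^sup>+x. ennreal ((norm (F n x - G x))\<^sup>2) \<partial>lebesgue_on D) \<le> ennreal (((1/4) ^ k)\<^sup>2)" .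
    then have L2: "L2 D (\<lambda>x. F n x - G x)"
      unfolding L2_def by (intro conjI integrableI_bounded) (simp_all add: le_less_trans)
    from le have "(L2_norm D (\<lambda>x. F n x - G x))\<^sup>2 \<le> ((1/4) ^ k)\<^sup>2"
      by (simp add: L2_nn_integral[OF L2])
    then have "L2_norm D (\<lambda>x. F n x - G x) \<le> (1/4) ^ k"
      by (rule power2_le_imp_le) simp
    with L2 show ?thesis by simp
  qed
  have "L2 D (\<lambda>x. F (r 0) x - (F (r 0) x - G x))"
    by (rule L2_diff[OF F conjunct1[OF *[OF order_refl]]])
  then have "L2 D G" by simp
  moreover have "(\<lambda>n. L2_norm D (\<lambda>x. F n x - G x)) \<longlonglongrightarrow> 0"
  proof (rule LIMSEQ_I)
    fix e :: real assume "0 < e"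
    then obtain k where "(1/4) ^ k < e"
      using real_arch_pow_inv[of e "1/4"] by auto
    have "norm (L2_norm D (\<lambda>x. F n x - G x) - 0) < e" if "r k \<le> n" for n
    proof -
      have "L2_norm D (\<lambda>x. F n x - G x) \<le> (1/4) ^ k"
        using *[OF that] ..
      also have "\<dots> < e" by fact
      finally show ?thesis by (simp add: L2_norm_nonneg)
    qed
    then show "\<exists>N. \<forall>n\<ge>N. norm (L2_norm D (\<lambda>x. F n x - G x) - 0) < e"
      by blast
  qed
  ultimately show ?thesis by (rule that)
qed

section \<open>Test functions and the Poincare inequality\<close>

lemma Ck_add: "Ck k \<phi> \<Longrightarrow> Ck k \<eta> \<Longrightarrow> Ck k (\<lambda>x. \<phi> x + \<eta> x)"
proof (induction k arbitrary: \<phi> \<eta>)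
  case 0
  then show ?case by (auto intro: continuous_on_add)
next
  case (Suc k)
  have "frechet_derivative (\<lambda>x. \<phi> x + \<eta> x) (at x)
      = (\<lambda>h. frechet_derivative \<phi> (at x) h + frechet_derivative \<eta> (at x) h)" for x
    using Suc.prems
    by (intro frechet_derivative_at[symmetric] has_derivative_add)
      (auto simp: frechet_derivative_works[symmetric])
  with Suc show ?case by (auto intro: differentiable_add)
qed

lemma Ck_cmult: "Ck k \<phi> \<Longrightarrow> Ck k (\<lambda>x. c * \<phi> x)"
proof (induction k arbitrary: \<phi>)
  case 0
  then show ?case by (auto intro: continuous_intros)
next
  case (Suc k)
  have "frechet_derivative (\<lambda>x. c * \<phi> x) (at x) = (\<lambda>h. c * frechet_derivative \<phi> (at x) h)" for x
    using Suc.prems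
    by (intro frechet_derivative_at[symmetric] has_derivative_mult_right)
      (auto simp: frechet_derivative_works[symmetric])
  with Suc show ?case by (auto intro: differentiable_mult)
qed

lemma test_functionI:
  assumes Ck: "\<And>k. Ck k \<phi>" and K: "compact K" "K \<subseteq> D" and zero: "\<And>x. x \<notin> K \<Longrightarrow> \<phi> x = 0"
  shows "test_function D \<phi>"
proof -
  have "closure {x. \<phi> x \<noteq> 0} \<subseteq> K"
    using zero by (intro closure_minimal compact_imp_closed K) auto
  then have "compact (closure {x. \<phi> x \<noteq> 0})" "closure {x. \<phi> x \<noteq> 0} \<subseteq> D"
    using K compact_Int_closed[OF K(1) closed_closure[of "{x. \<phi> x \<noteq> 0}"]] by (auto simp: Int_absorb1)
  with Ck show ?thesis by (simp add: test_function_def)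
qed

lemma test_functionE:
  assumes "test_function D \<phi>"
  obtains K where "compact K" "K \<subseteq> D" "\<And>x. x \<notin> K \<Longrightarrow> \<phi> x = 0"
proof (rule that[of "closure {x. \<phi> x \<noteq> 0}"])
  show "x \<notin> closure {x. \<phi> x \<noteq> 0} \<Longrightarrow> \<phi> x = 0" for x
    using closure_subset[of "{x. \<phi> x \<noteq> 0}"] by auto
qed (use assms in \<open>auto simp: test_function_def\<close>)

lemma test_function_Ck: "test_function D \<phi> \<Longrightarrow> Ck k \<phi>"
  by (simp add: test_function_def)

lemma test_function_continuous: "test_function D \<phi> \<Longrightarrow> continuous_on UNIV \<phi>"
  using test_function_Ck[of D \<phi> 0] by simp

lemma test_function_has_derivative:
  "test_function D \<phi> \<Longrightarrow> (\<phi> has_derivative frechet_derivative \<phi> (at x)) (at x)"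
  using test_function_Ck[of D \<phi> "Suc 0"] by (simp add: frechet_derivative_works[symmetric])

lemma test_function_add:
  assumes "test_function D \<phi>" "test_function D \<eta>"
  shows "test_function D (\<lambda>x. \<phi> x + \<eta> x)"
proof -
  obtain K where K: "compact K" "K \<subseteq> D" "\<And>x. x \<notin> K \<Longrightarrow> \<phi> x = 0"
    using assms(1) by (rule test_functionE) blast
  obtain L where L: "compact L" "L \<subseteq> D" "\<And>x. x \<notin> L \<Longrightarrow> \<eta> x = 0"
    using assms(2) by (rule test_functionE) blast
  show ?thesis
  proof (rule test_functionI)
    show "Ck k (\<lambda>x. \<phi> x + \<eta> x)" for k
      by (intro Ck_add test_function_Ck[OF assms(1)] test_function_Ck[OF assms(2)])
    show "compact (K \<union> L)" "K \<union> L \<subseteq> D"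
      using K L by (simp_all add: compact_Un)
    show "\<phi> x + \<eta> x = 0" if "x \<notin> K \<union> L" for x
      using K(3) L(3) that by simp
  qed
qed

lemma test_function_cmult:
  assumes "test_function D \<phi>" shows "test_function D (\<lambda>x. c * \<phi> x)"
proof -
  obtain K where K: "compact K" "K \<subseteq> D" "\<And>x. x \<notin> K \<Longrightarrow> \<phi> x = 0"
    using assms by (rule test_functionE) blast
  then show ?thesis
    by (intro test_functionI[of _ K] Ck_cmult test_function_Ck[OF assms]) auto
qed

lemma derivative_zero_outside_support:
  fixes \<phi> :: "'a::euclidean_space \<Rightarrow> real"
  assumes K: "closed K" and zero: "\<And>x. x \<notin> K \<Longrightarrow> \<phi> x = 0"
    and deriv: "(\<phi> has_derivative \<phi>') (at x)" and x: "x \<notin> K"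
  shows "\<phi>' h = 0"
proof -
  have "((\<lambda>x. 0) has_derivative (\<lambda>h. 0)) (at x)" by simp
  then have "(\<phi> has_derivative (\<lambda>h. 0)) (at x)"
    by (rule has_derivative_transform_within_open[of _ _ _ _ "- K"]) (use K zero x in auto)
  then show ?thesis using has_derivative_unique[OF deriv] by metis
qed

lemma test_function_partial:
  assumes \<phi>: "test_function D \<phi>" and i: "i \<in> Basis"
  shows "test_function D (\<lambda>x. frechet_derivative \<phi> (at x) i)"
proof -
  obtain K where K: "compact K" "K \<subseteq> D" "\<And>x. x \<notin> K \<Longrightarrow> \<phi> x = 0"
    using \<phi> by (rule test_functionE) blast
  show ?thesis
  proof (rule test_functionI[OF _ K(1,2)])
    show "Ck k (\<lambda>x. frechet_derivative \<phi> (at x) i)" for k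
      using test_function_Ck[OF \<phi>, of "Suc k"] i by simp
    show "frechet_derivative \<phi> (at x) i = 0" if "x \<notin> K" for x
      by (rule derivative_zero_outside_support[OF compact_imp_closed[OF K(1)] K(3)
            test_function_has_derivative[OF \<phi>] that])
  qed
qed

lemma classical_gradient_inner:
  "i \<in> Basis \<Longrightarrow> classical_gradient \<phi> x \<bullet> i = frechet_derivative \<phi> (at x) i"
  by (simp add: classical_gradient_def)

lemma classical_gradient_add:
  assumes "test_function D \<phi>" "test_function D \<eta>"
  shows "classical_gradient (\<lambda>x. \<phi> x + \<eta> x) x = classical_gradient \<phi> x + classical_gradient \<eta> x"
proof -
  have "frechet_derivative (\<lambda>x. \<phi> x + \<eta> x) (at x)
      = (\<lambda>h. frechet_derivative \<phi> (at x) h + frechet_derivative \<eta> (at x) h)"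
    by (intro frechet_derivative_at[symmetric] has_derivative_add
        test_function_has_derivative[OF assms(1)] test_function_has_derivative[OF assms(2)])
  then show ?thesis
    by (simp add: classical_gradient_def scaleR_add_left sum.distrib)
qed

lemma classical_gradient_cmult:
  assumes "test_function D \<phi>"
  shows "classical_gradient (\<lambda>x. c * \<phi> x) x = c *\<^sub>R classical_gradient \<phi> x"
proof -
  have "frechet_derivative (\<lambda>x. c * \<phi> x) (at x) = (\<lambda>h. c * frechet_derivative \<phi> (at x) h)"
    by (intro frechet_derivative_at[symmetric] has_derivative_mult_right
        test_function_has_derivative[OF assms])
  then show ?thesis
    by (simp add: classical_gradient_def scaleR_sum_right)
qed

lemma continuous_compact_support_bounded:
  fixes f :: "'a::euclidean_space \<Rightarrow> real"
  assumes "continuous_on UNIV f" "compact K" "\<And>x. x \<notin> K \<Longrightarrow> f x = 0"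
  obtains B where "0 \<le> B" "\<And>x. \<bar>f x\<bar> \<le> B"
proof -
  have "bounded (f ` K)"
    using assms by (intro compact_imp_bounded compact_continuous_image) (auto intro: continuous_on_subset)
  then obtain B where "\<And>x. x \<in> K \<Longrightarrow> \<bar>f x\<bar> \<le> B"
    by (auto simp: bounded_iff)
  then have "\<bar>f x\<bar> \<le> \<bar>B\<bar>" for x
    using assms(3)[of x] by (cases "x \<in> K") (auto intro: order_trans[of _ B])
  then show ?thesis by (intro that[of "\<bar>B\<bar>"]) auto
qed

lemma continuous_imp_lebesgue_on_measurable:
  fixes f :: "'a::euclidean_space \<Rightarrow> 'b::euclidean_space"
  assumes "continuous_on UNIV f" shows "f \<in> borel_measurable (lebesgue_on D)"
  using borel_measurable_continuous_onI[OF assms]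
  by (intro measurable_restrict_space1 measurable_completion) simp

lemma lborel_integral_translation:
  fixes f :: "'a::euclidean_space \<Rightarrow> real"
  assumes "f \<in> borel_measurable borel"
  shows "(LINT x|lborel. f (x + c)) = (LINT x|lborel. f x)"
proof -
  have "(LINT x|lborel. f x) = (LINT x|distr lborel borel ((+) c). f x)"
    by (simp add: lborel_distr_plus)
  also have "\<dots> = (LINT x|lborel. f (c + x))"
    using assms by (intro integral_distr) auto
  finally show ?thesis by (simp add: add.commute)
qed

lemma indicator_scaleR_eq_self:
  fixes f :: "'a \<Rightarrow> 'b::real_vector"
  assumes "\<And>x. x \<notin> A \<Longrightarrow> f x = 0"
  shows "(\<lambda>x. indicator A x *\<^sub>R f x) = f"
proof
  show "indicator A x *\<^sub>R f x = f x" for x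
    using assms[of x] by (cases "x \<in> A") auto
qed

text \<open>The integral of a difference quotient vanishes by translation invariance, and the quotients
converge dominatedly, with the mean value theorem providing the bound.\<close>

lemma integral_directional_derivative_eq_0:
  fixes \<psi> :: "'a::euclidean_space \<Rightarrow> real"
  assumes deriv: "\<And>x. (\<psi> has_derivative \<psi>' x) (at x)"
    and cont: "continuous_on UNIV (\<lambda>x. \<psi>' x v)"
    and K: "compact K" and zero: "\<And>x. x \<notin> K \<Longrightarrow> \<psi> x = 0"
  shows "(LINT x|lborel. \<psi>' x v) = 0"
proof -
  have \<psi>_cont: "continuous_on UNIV \<psi>"
    using deriv by (intro continuous_at_imp_continuous_on) (auto intro: has_derivative_continuous)
  have [measurable]: "\<psi> \<in> borel_measurable borel" "(\<lambda>x. \<psi>' x v) \<in> borel_measurable borel"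
    using \<psi>_cont cont by (auto intro: borel_measurable_continuous_onI)
  have zero': "\<psi>' x v = 0" if "x \<notin> K" for x
    by (rule derivative_zero_outside_support[OF compact_imp_closed[OF K] zero deriv that])
  obtain B where B: "0 \<le> B" "\<And>x. \<bar>\<psi>' x v\<bar> \<le> B"
    by (rule continuous_compact_support_bounded[OF cont K zero']) blast+
  obtain R where R: "\<And>x. x \<in> K \<Longrightarrow> norm x \<le> R"
    using compact_imp_bounded[OF K] by (auto simp: bounded_iff)
  have line: "((\<lambda>t. \<psi> (x + t *\<^sub>R v)) has_real_derivative \<psi>' (x + t *\<^sub>R v) v) (at t)" for x t
  proof -
    have "((\<lambda>t. \<psi> (x + t *\<^sub>R v)) has_derivative (\<lambda>h. \<psi>' (x + t *\<^sub>R v) (h *\<^sub>R v))) (at t)"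
      by (rule has_derivative_compose[OF _ deriv, of "\<lambda>t. x + t *\<^sub>R v"]) (auto intro!: derivative_eq_intros)
    moreover have "(\<lambda>h. \<psi>' (x + t *\<^sub>R v) (h *\<^sub>R v)) = (*) (\<psi>' (x + t *\<^sub>R v) v)"
      using linear_cmul[OF has_derivative_linear[OF deriv]] by (simp add: fun_eq_iff mult.commute)
    ultimately show ?thesis by (simp add: has_field_derivative_def)
  qed
  define h where "h n = inverse (real (Suc n))" for n
  have h: "0 < h n" "h n \<le> 1" for n by (auto simp: h_def field_simps)
  define q where "q n x = (\<psi> (x + h n *\<^sub>R v) - \<psi> x) / h n" for n x
  have [measurable]: "q n \<in> borel_measurable borel" for n
    unfolding q_def[abs_def] by measurable
  have \<psi>_int: "integrable lborel \<psi>"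
  proof -
    have "integrable lborel (\<lambda>x. indicator K x *\<^sub>R \<psi> x)"
      using borel_integrable_compact[OF K continuous_on_subset[OF \<psi>_cont]] by (simp add: set_integrable_def)
    moreover have "(\<lambda>x. indicator K x *\<^sub>R \<psi> x) = \<psi>"
      by (rule indicator_scaleR_eq_self[OF zero])
    ultimately show ?thesis by simp
  qed
  have "(LINT x|lborel. q n x) = 0" for n
  proof -
    have "integrable (distr lborel borel ((+) (h n *\<^sub>R v))) \<psi>"
      using \<psi>_int by (simp add: lborel_distr_plus)
    then have "integrable lborel (\<lambda>x. \<psi> (h n *\<^sub>R v + x))"
      by (rule integrable_distr[rotated]) simp
    then have "integrable lborel (\<lambda>x. \<psi> (x + h n *\<^sub>R v))"
      by (simp add: add.commute)
    then show ?thesis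
      unfolding q_def using \<psi>_int by (simp add: lborel_integral_translation)
  qed
  moreover have "(\<lambda>n. LINT x|lborel. q n x) \<longlonglongrightarrow> (LINT x|lborel. \<psi>' x v)"
  proof (rule integral_dominated_convergence[where w="\<lambda>x. B * indicator (cball 0 (R + norm v)) x"])
    show "integrable lborel (\<lambda>x. B * indicator (cball 0 (R + norm v)) (x::'a))"
      by (intro integrable_mult_right integrable_real_indicator emeasure_lborel_cball_finite) simp
    have "(\<lambda>n. q n x) \<longlonglongrightarrow> \<psi>' x v" for x
    proof -
      have "((\<lambda>t. (\<psi> (x + (0 + t) *\<^sub>R v) - \<psi> (x + 0 *\<^sub>R v)) / t) \<longlongrightarrow> \<psi>' (x + 0 *\<^sub>R v) v) (at 0)"
        using line[of x 0] unfolding DERIV_def .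
      moreover have "filterlim h (at 0) sequentially"
        using LIMSEQ_inverse_real_of_nat h(1) unfolding h_def filterlim_at
        by (auto intro!: always_eventually)
      ultimately have "(\<lambda>n. (\<psi> (x + (0 + h n) *\<^sub>R v) - \<psi> (x + 0 *\<^sub>R v)) / h n) \<longlonglongrightarrow> \<psi>' (x + 0 *\<^sub>R v) v"
        by (rule filterlim_compose)
      then show ?thesis by (simp add: q_def)
    qed
    then show "AE x in lborel. (\<lambda>n. q n x) \<longlonglongrightarrow> \<psi>' x v" by simp
    fix n
    have "norm (q n x) \<le> B * indicator (cball 0 (R + norm v)) x" for x
    proof (cases "x \<in> cball 0 (R + norm v)")
      case True
      obtain z where "\<psi> (x + h n *\<^sub>R v) - \<psi> (x + 0 *\<^sub>R v) = (h n - 0) * \<psi>' (x + z *\<^sub>R v) v"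
        using MVT2[OF h(1)[of n] line[of x]] by blast
      then have "q n x = \<psi>' (x + z *\<^sub>R v) v" using h(1)[of n] by (simp add: q_def)
      with True B show ?thesis by simp
    next
      case False
      then have far: "R + norm v < norm x" by simp
      have "norm (h n *\<^sub>R v) \<le> norm v"
        using h[of n] by (simp add: mult_left_le_one_le)
      then have "R < norm (x + h n *\<^sub>R v)" "R < norm x"
        using far norm_diff_ineq[of x "h n *\<^sub>R v"] norm_ge_zero[of v] by linarith+
      then have "\<psi> (x + h n *\<^sub>R v) = 0" "\<psi> x = 0"
        using R zero by (meson not_less)+
      with False show ?thesis by (simp add: q_def)
    qed
    then show "AE x in lborel. norm (q n x) \<le> B * indicator (cball 0 (R + norm v)) x" by simp
  qed auto
  ultimately show ?thesis by (simp add: LIMSEQ_const_iff)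
qed

locale bounded_open_set =
  fixes D :: "'a::euclidean_space set"
  assumes open_D: "open D" and bounded_D: "bounded D"
begin

lemma D_sets [simp]: "D \<in> sets lebesgue"
  by (rule fmeasurableD[OF lmeasurable_open[OF bounded_D open_D]])

lemma test_function_L2:
  assumes \<phi>: "test_function D \<phi>" shows "L2 D \<phi>"
proof -
  obtain K where K: "compact K" "\<And>x. x \<notin> K \<Longrightarrow> \<phi> x = 0"
    using \<phi> by (rule test_functionE) blast
  obtain B where B: "0 \<le> B" "\<And>x. \<bar>\<phi> x\<bar> \<le> B"
    by (rule continuous_compact_support_bounded[OF test_function_continuous[OF \<phi>] K]) blast+
  interpret finite_measure "lebesgue_on D"
    by (intro finite_measure_lebesgue_on lmeasurable_open bounded_D open_D)
  have meas [measurable]: "\<phi> \<in> borel_measurable (lebesgue_on D)"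
    by (rule continuous_imp_lebesgue_on_measurable[OF test_function_continuous[OF \<phi>]])
  have "(norm (\<phi> x))\<^sup>2 \<le> B\<^sup>2" for x
    using B by (intro power_mono) auto
  then have "integrable (lebesgue_on D) (\<lambda>x. (norm (\<phi> x))\<^sup>2)"
    by (intro integrable_const_bound[where B="B\<^sup>2"]) auto
  with meas show ?thesis by (simp add: L2_def)
qed

lemma classical_gradient_L2:
  assumes "test_function D \<phi>" shows "L2 D (classical_gradient \<phi>)"
  unfolding classical_gradient_def[abs_def]
proof (rule L2_sum)
  fix i :: 'a assume i: "i \<in> Basis"
  have L2: "L2 D (\<lambda>x. frechet_derivative \<phi> (at x) i)"
    by (rule test_function_L2[OF test_function_partial[OF assms i]])
  show "L2 D (\<lambda>x. frechet_derivative \<phi> (at x) i *\<^sub>R i)"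
    by (rule L2_dominated[OF L2, where C=1]) (use i L2_measurable[OF L2] in auto)
qed

text \<open>Integrate the derivative of \<open>(x \<bullet> i) * \<phi>\<^sup>2\<close> in the direction \<open>i\<close>, which has compact support in \<open>D\<close>; then
absorb half of \<open>\<integral> \<phi>\<^sup>2\<close>.\<close>

lemma Poincare_test_function:
  assumes R: "\<And>x. x \<in> D \<Longrightarrow> norm x \<le> R" and R0: "0 \<le> R" and \<phi>: "test_function D \<phi>"
  shows "L2_norm D \<phi> \<le> 2 * R * L2_norm D (classical_gradient \<phi>)"
proof -
  obtain i :: 'a where i: "i \<in> Basis"
    using nonempty_Basis by blast
  obtain K where K: "compact K" "K \<subseteq> D" "\<And>x. x \<notin> K \<Longrightarrow> \<phi> x = 0"
    using \<phi> by (rule test_functionE) blast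
  define d where "d x = frechet_derivative \<phi> (at x) i" for x
  have d: "test_function D d" unfolding d_def[abs_def] by (rule test_function_partial[OF \<phi> i])
  note [continuous_intros] =
    continuous_on_subset[OF test_function_continuous[OF \<phi>] subset_UNIV]
    continuous_on_subset[OF test_function_continuous[OF d] subset_UNIV]
  define g where "g x = (\<phi> x)\<^sup>2 + 2 * (x \<bullet> i) * \<phi> x * d x" for x
  have "(LINT x|lborel. (i \<bullet> i) * (\<phi> x)\<^sup>2 + (x \<bullet> i) * (2 * \<phi> x * d x)) = 0"
  proof (rule integral_directional_derivative_eq_0[where \<psi>="\<lambda>x. (x \<bullet> i) * (\<phi> x)\<^sup>2" and v=i
        and \<psi>'="\<lambda>x h. (h \<bullet> i) * (\<phi> x)\<^sup>2 + (x \<bullet> i) * (2 * \<phi> x * frechet_derivative \<phi> (at x) h)", folded d_def])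
    show "((\<lambda>x. (x \<bullet> i) * (\<phi> x)\<^sup>2) has_derivative
        (\<lambda>h. (h \<bullet> i) * (\<phi> x)\<^sup>2 + (x \<bullet> i) * (2 * \<phi> x * frechet_derivative \<phi> (at x) h))) (at x)" for x
      by (auto intro!: derivative_eq_intros test_function_has_derivative[OF \<phi>] simp: algebra_simps power2_eq_square)
    show "continuous_on UNIV (\<lambda>x. i \<bullet> i * (\<phi> x)\<^sup>2 + x \<bullet> i * (2 * \<phi> x * d x))"
      by (intro continuous_intros)
  qed (use K in auto)
  then have lborel0: "(LINT x|lborel. g x) = 0"
    using i by (simp add: g_def algebra_simps)
  have g_cont: "continuous_on UNIV g"
    unfolding g_def by (intro continuous_intros)
  have g_zero: "g x = 0" if "x \<notin> K" for x
    using K(3)[OF that] by (simp add: g_def)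
  have D_g: "(\<lambda>x. indicator D x *\<^sub>R g x) = g" and K_g: "(\<lambda>x. indicator K x *\<^sub>R g x) = g"
    by (rule indicator_scaleR_eq_self[OF g_zero]; use K(2) in blast)+
  have "(LINT x|lebesgue_on D. g x) = (LINT x|lebesgue. indicator D x *\<^sub>R g x)"
    by (simp add: integral_restrict_space)
  also have "(\<lambda>x. indicator D x *\<^sub>R g x) = g" by (fact D_g)
  also have "(LINT x|lebesgue. g x) = (LINT x|lborel. g x)"
    using borel_measurable_continuous_onI[OF g_cont] by (intro integral_completion) simp
  finally have g0: "(LINT x|lebesgue_on D. g x) = 0" by (simp only: lborel0)
  have \<phi>_int: "integrable (lebesgue_on D) (\<lambda>x. (\<phi> x)\<^sup>2)"
    using L2_integrable_square[OF test_function_L2[OF \<phi>]] by simp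
  have grad_int: "integrable (lebesgue_on D) (\<lambda>x. (norm (classical_gradient \<phi> x))\<^sup>2)"
    by (rule L2_integrable_square[OF classical_gradient_L2[OF \<phi>]])
  have le: "(\<phi> x)\<^sup>2 / 2 - 2 * R\<^sup>2 * (norm (classical_gradient \<phi> x))\<^sup>2 \<le> g x" if "x \<in> D" for x
  proof -
    have "\<bar>d x\<bar> \<le> norm (classical_gradient \<phi> x)"
      using Basis_le_norm[OF i, of "classical_gradient \<phi> x"] by (simp add: d_def classical_gradient_inner i)
    moreover have "\<bar>x \<bullet> i\<bar> \<le> R"
      using Basis_le_norm[OF i, of x] R[OF that] by simp
    ultimately have "\<bar>(x \<bullet> i) * d x\<bar> \<le> R * norm (classical_gradient \<phi> x)"
      unfolding abs_mult by (intro mult_mono) (auto simp: R0)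
    then have "\<bar>(x \<bullet> i) * d x\<bar>\<^sup>2 \<le> (R * norm (classical_gradient \<phi> x))\<^sup>2"
      by (rule power_mono) simp
    moreover have "0 \<le> (\<phi> x + 2 * ((x \<bullet> i) * d x))\<^sup>2" by simp
    ultimately show ?thesis
      by (simp add: g_def power2_sum power_mult_distrib algebra_simps)
  qed
  have g_int: "integrable (lebesgue_on D) g"
  proof -
    have "integrable lborel (\<lambda>x. indicator K x *\<^sub>R g x)"
      using borel_integrable_compact[OF K(1) continuous_on_subset[OF g_cont]] by (simp add: set_integrable_def)
    then have "integrable lborel g" by (simp only: K_g)
    then have "integrable lebesgue g"
      using integrable_completion[of g lborel] borel_measurable_continuous_onI[OF g_cont] by simp
    then have "integrable lebesgue (\<lambda>x. indicator D x *\<^sub>R g x)" by (simp only: D_g)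
    then show ?thesis by (simp add: integrable_restrict_space)
  qed
  have "(LINT x|lebesgue_on D. (\<phi> x)\<^sup>2 / 2 - 2 * R\<^sup>2 * (norm (classical_gradient \<phi> x))\<^sup>2)
      \<le> (LINT x|lebesgue_on D. g x)"
    using \<phi>_int grad_int g_int le by (intro integral_mono) (auto simp: space_restrict_space)
  then have "(L2_norm D \<phi>)\<^sup>2 / 2 - 2 * R\<^sup>2 * (L2_norm D (classical_gradient \<phi>))\<^sup>2 \<le> 0"
    using \<phi>_int grad_int by (simp add: g0 L2_norm_square)
  then have "(L2_norm D \<phi>)\<^sup>2 \<le> (2 * R * L2_norm D (classical_gradient \<phi>))\<^sup>2"
    by (simp add: power_mult_distrib)
  then show ?thesis
    by (rule power2_le_imp_le) (simp add: R0 L2_norm_nonneg)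
qed

end

lemma L2_component: 
  fixes g :: "'a::euclidean_space \<Rightarrow> 'b::euclidean_space"
  assumes g: "L2 D g" and i: "i \<in> Basis"
  shows "L2 D (\<lambda>x. g x \<bullet> i)"
proof (rule L2_dominated[OF g, where C=1])
  note [measurable] = L2_measurable[OF g]
  show "(\<lambda>x. g x \<bullet> i) \<in> borel_measurable (lebesgue_on D)" by simp
  show "AE x in lebesgue_on D. norm (g x \<bullet> i) \<le> 1 * norm (g x)"
    by (rule AE_I2) (simp add: Basis_le_norm[OF i])
qed

lemma H01_gradient_L2:
  assumes "H01_gradient D v g" shows "L2 D v" "L2 D g"
  using assms by (simp_all add: H01_gradient_def)

lemma L2_norm_lincomb:
  fixes F G :: "'a::euclidean_space \<Rightarrow> 'b::euclidean_space"
  assumes "L2 D F" "L2 D G"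
  shows "L2_norm D (\<lambda>x. a *\<^sub>R F x + b *\<^sub>R G x) \<le> \<bar>a\<bar> * L2_norm D F + \<bar>b\<bar> * L2_norm D G"
  using L2_norm_triangle[OF L2_cmult[OF assms(1)] L2_cmult[OF assms(2)], of a b]
  by (simp only: L2_norm_cmult)

lemma L2_tendsto_lincomb:
  fixes F :: "nat \<Rightarrow> 'a::euclidean_space \<Rightarrow> 'b::euclidean_space"
  assumes F: "\<And>n. L2 D (F n)" "L2 D F'" and G: "\<And>n. L2 D (G n)" "L2 D G'"
    and F_lim: "(\<lambda>n. L2_norm D (\<lambda>x. F n x - F' x)) \<longlonglongrightarrow> 0"
    and G_lim: "(\<lambda>n. L2_norm D (\<lambda>x. G n x - G' x)) \<longlonglongrightarrow> 0"
  shows "(\<lambda>n. L2_norm D (\<lambda>x. (a *\<^sub>R F n x + b *\<^sub>R G n x) - (a *\<^sub>R F' x + b *\<^sub>R G' x))) \<longlonglongrightarrow> 0"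
proof (rule Lim_null_comparison, intro always_eventually allI)
  fix n
  have "L2_norm D (\<lambda>x. a *\<^sub>R (F n x - F' x) + b *\<^sub>R (G n x - G' x))
      \<le> \<bar>a\<bar> * L2_norm D (\<lambda>x. F n x - F' x) + \<bar>b\<bar> * L2_norm D (\<lambda>x. G n x - G' x)"
    by (intro L2_norm_lincomb L2_diff F G)
  moreover have "a *\<^sub>R (F n x - F' x) + b *\<^sub>R (G n x - G' x)
      = (a *\<^sub>R F n x + b *\<^sub>R G n x) - (a *\<^sub>R F' x + b *\<^sub>R G' x)" for x
    by (simp add: algebra_simps)
  ultimately show "norm (L2_norm D (\<lambda>x. (a *\<^sub>R F n x + b *\<^sub>R G n x) - (a *\<^sub>R F' x + b *\<^sub>R G' x)))
      \<le> \<bar>a\<bar> * L2_norm D (\<lambda>x. F n x - F' x) + \<bar>b\<bar> * L2_norm D (\<lambda>x. G n x - G' x)"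
    by (simp add: L2_norm_nonneg)
  show "(\<lambda>n. \<bar>a\<bar> * L2_norm D (\<lambda>x. F n x - F' x) + \<bar>b\<bar> * L2_norm D (\<lambda>x. G n x - G' x)) \<longlonglongrightarrow> 0"
    using tendsto_add[OF tendsto_mult_left[OF F_lim, of "\<bar>a\<bar>"] tendsto_mult_left[OF G_lim, of "\<bar>b\<bar>"]]
    by simp
qed

section \<open>Completeness of the Sobolev space\<close>

context bounded_open_set
begin

lemma classical_gradient_component_L2:
  assumes "test_function D \<phi>" "i \<in> Basis"
  shows "L2 D (\<lambda>x. classical_gradient \<phi> x \<bullet> i)"
  by (rule L2_component[OF classical_gradient_L2[OF assms(1)] assms(2)])

lemma weak_gradient_lincomb:
  assumes v: "L2 D v" "L2 D g" "weak_gradient D v g"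
    and w: "L2 D w" "L2 D h" "weak_gradient D w h"
  shows "weak_gradient D (\<lambda>x. a * v x + b * w x) (\<lambda>x. a *\<^sub>R g x + b *\<^sub>R h x)"
  unfolding weak_gradient_def
proof (intro allI impI ballI)
  fix \<phi> :: "'a \<Rightarrow> real" and i :: 'a assume \<phi>: "test_function D \<phi>" and i: "i \<in> Basis"
  note L2_d = classical_gradient_component_L2[OF \<phi> i]
  have v_int: "integrable (lebesgue_on D) (\<lambda>x. v x * (classical_gradient \<phi> x \<bullet> i))"
    and w_int: "integrable (lebesgue_on D) (\<lambda>x. w x * (classical_gradient \<phi> x \<bullet> i))"
    and g_int: "integrable (lebesgue_on D) (\<lambda>x. (g x \<bullet> i) * \<phi> x)"
    and h_int: "integrable (lebesgue_on D) (\<lambda>x. (h x \<bullet> i) * \<phi> x)"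
    using L2_inner_integrable[OF v(1) L2_d] L2_inner_integrable[OF w(1) L2_d]
      L2_inner_integrable[OF L2_component[OF v(2) i] test_function_L2[OF \<phi>]]
      L2_inner_integrable[OF L2_component[OF w(2) i] test_function_L2[OF \<phi>]]
    by (simp_all add: inner_real_def)
  have "(LINT x|lebesgue_on D. (a * v x + b * w x) * (classical_gradient \<phi> x \<bullet> i))
      = (LINT x|lebesgue_on D. a * (v x * (classical_gradient \<phi> x \<bullet> i)) + b * (w x * (classical_gradient \<phi> x \<bullet> i)))"
    by (simp add: algebra_simps)
  also have "\<dots> = a * (LINT x|lebesgue_on D. v x * (classical_gradient \<phi> x \<bullet> i))
      + b * (LINT x|lebesgue_on D. w x * (classical_gradient \<phi> x \<bullet> i))"
    using v_int w_int by simp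
  also have "\<dots> = - (a * (LINT x|lebesgue_on D. (g x \<bullet> i) * \<phi> x) + b * (LINT x|lebesgue_on D. (h x \<bullet> i) * \<phi> x))"
    using v(3) w(3) \<phi> i by (simp add: weak_gradient_def)
  also have "\<dots> = - (LINT x|lebesgue_on D. a * ((g x \<bullet> i) * \<phi> x) + b * ((h x \<bullet> i) * \<phi> x))"
    using g_int h_int by simp
  also have "\<dots> = - (LINT x|lebesgue_on D. ((a *\<^sub>R g x + b *\<^sub>R h x) \<bullet> i) * \<phi> x)"
    by (simp add: inner_add_left algebra_simps)
  finally show "(LINT x|lebesgue_on D. (a * v x + b * w x) * (classical_gradient \<phi> x \<bullet> i))
      = - (LINT x|lebesgue_on D. ((a *\<^sub>R g x + b *\<^sub>R h x) \<bullet> i) * \<phi> x)" .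
qed

lemma H01_gradient_lincomb:
  assumes v: "H01_gradient D v g" and w: "H01_gradient D w h"
  shows "H01_gradient D (\<lambda>x. a * v x + b * w x) (\<lambda>x. a *\<^sub>R g x + b *\<^sub>R h x)"
proof -
  note L2 = H01_gradient_L2[OF v] H01_gradient_L2[OF w]
  obtain \<phi> where \<phi>: "\<And>n. test_function D (\<phi> n)"
    and \<phi>_lim: "(\<lambda>n. L2_norm D (\<lambda>x. \<phi> n x - v x)) \<longlonglongrightarrow> 0"
      "(\<lambda>n. L2_norm D (\<lambda>x. classical_gradient (\<phi> n) x - g x)) \<longlonglongrightarrow> 0"
    using v unfolding H01_gradient_def by blast
  obtain \<eta> where \<eta>: "\<And>n. test_function D (\<eta> n)"
    and \<eta>_lim: "(\<lambda>n. L2_norm D (\<lambda>x. \<eta> n x - w x)) \<longlonglongrightarrow> 0"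
      "(\<lambda>n. L2_norm D (\<lambda>x. classical_gradient (\<eta> n) x - h x)) \<longlonglongrightarrow> 0"
    using w unfolding H01_gradient_def by blast
  have grad_eq: "classical_gradient (\<lambda>x. a * \<phi> n x + b * \<eta> n x) x
      = a *\<^sub>R classical_gradient (\<phi> n) x + b *\<^sub>R classical_gradient (\<eta> n) x" for n x
    by (simp add: classical_gradient_add[OF test_function_cmult[OF \<phi>] test_function_cmult[OF \<eta>]]
        classical_gradient_cmult[OF \<phi>] classical_gradient_cmult[OF \<eta>])
  show ?thesis
    unfolding H01_gradient_def
  proof (intro conjI exI allI)
    show "L2 D (\<lambda>x. a * v x + b * w x)"
      using L2_add[OF L2_cmult[OF L2(1), of a] L2_cmult[OF L2(3), of b]] by simp
    show "L2 D (\<lambda>x. a *\<^sub>R g x + b *\<^sub>R h x)"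
      by (intro L2_add L2_cmult L2)
    show "weak_gradient D (\<lambda>x. a * v x + b * w x) (\<lambda>x. a *\<^sub>R g x + b *\<^sub>R h x)"
      using v w by (intro weak_gradient_lincomb) (simp_all add: H01_gradient_def)
    show "test_function D (\<lambda>x. a * \<phi> n x + b * \<eta> n x)" for n
      by (intro test_function_add test_function_cmult \<phi> \<eta>)
    show "(\<lambda>n. L2_norm D (\<lambda>x. (a * \<phi> n x + b * \<eta> n x) - (a * v x + b * w x))) \<longlonglongrightarrow> 0"
      using L2_tendsto_lincomb[OF test_function_L2[OF \<phi>] L2(1) test_function_L2[OF \<eta>] L2(3)
          \<phi>_lim(1) \<eta>_lim(1), of a b] by simp
    show "(\<lambda>n. L2_norm D (\<lambda>x. classical_gradient (\<lambda>x. a * \<phi> n x + b * \<eta> n x) x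
        - (a *\<^sub>R g x + b *\<^sub>R h x))) \<longlonglongrightarrow> 0"
      unfolding grad_eq
      by (rule L2_tendsto_lincomb[OF classical_gradient_L2[OF \<phi>] L2(2) classical_gradient_L2[OF \<eta>] L2(4)
          \<phi>_lim(2) \<eta>_lim(2)])
  qed
qed

text \<open>The difference \<open>k\<close> of two gradients is orthogonal to all test functions. Partial derivatives of
test functions are again test functions, so \<open>k\<close> is orthogonal to their gradients; but \<open>k\<close> is a limit
of such gradients, hence orthogonal to itself.\<close>

lemma H01_gradient_unique:
  assumes v: "H01_gradient D v g" and w: "H01_gradient D w h"
    and eq: "AE x in lebesgue_on D. v x = w x"
  shows "AE x in lebesgue_on D. g x = h x"
proof -
  define k where "k x = g x - h x" for x
  have H: "H01_gradient D (\<lambda>x. v x - w x) k"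
    using H01_gradient_lincomb[OF v w, of 1 "-1"] by (simp add: k_def[abs_def])
  note L2 = H01_gradient_L2[OF H]
  obtain \<phi> where \<phi>: "\<And>n. test_function D (\<phi> n)"
    and \<phi>_lim: "(\<lambda>n. L2_norm D (\<lambda>x. classical_gradient (\<phi> n) x - k x)) \<longlonglongrightarrow> 0"
    using H unfolding H01_gradient_def by blast
  have orth: "(LINT x|lebesgue_on D. (k x \<bullet> i) * \<eta> x) = 0"
    if \<eta>: "test_function D \<eta>" and i: "i \<in> Basis" for \<eta> i
  proof -
    have "(LINT x|lebesgue_on D. (v x - w x) * (classical_gradient \<eta> x \<bullet> i)) = 0"
      using eq by (intro integral_eq_zero_AE) auto
    then show ?thesis
      using H \<eta> i by (simp add: H01_gradient_def weak_gradient_def)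
  qed
  have "(LINT x|lebesgue_on D. classical_gradient (\<phi> n) x \<bullet> k x) = 0" for n
  proof -
    have "(LINT x|lebesgue_on D. classical_gradient (\<phi> n) x \<bullet> k x)
        = (LINT x|lebesgue_on D. (\<Sum>i\<in>Basis. (k x \<bullet> i) * frechet_derivative (\<phi> n) (at x) i))"
      by (subst euclidean_inner) (simp add: classical_gradient_inner mult.commute)
    also have "\<dots> = (\<Sum>i\<in>Basis. LINT x|lebesgue_on D. (k x \<bullet> i) * frechet_derivative (\<phi> n) (at x) i)"
      using L2_inner_integrable[OF L2_component[OF L2(2)] test_function_L2[OF test_function_partial[OF \<phi>]]]
      by (intro Bochner_Integration.integral_sum) simp
    also have "\<dots> = 0"
      by (intro sum.neutral ballI orth test_function_partial \<phi>)
    finally show ?thesis .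
  qed
  then have "(LINT x|lebesgue_on D. k x \<bullet> k x) = 0"
    using L2_inner_tendsto[OF classical_gradient_L2[OF \<phi>] L2(2) L2(2) \<phi>_lim]
    by (simp add: LIMSEQ_const_iff)
  then have "L2_norm D k = 0"
    by (simp add: L2_norm_def power2_norm_eq_inner)
  then have "AE x in lebesgue_on D. k x = 0"
    by (rule L2_norm_eq_0[OF L2(2)])
  then show ?thesis by eventually_elim (simp add: k_def)
qed

lemma grad_H01_gradient: "v \<in> H01 D \<Longrightarrow> H01_gradient D v (grad D v)"
  unfolding H01_def grad_def by (simp add: someI_ex)

lemma H01_gradient_in_H01: "H01_gradient D v g \<Longrightarrow> v \<in> H01 D"
  by (auto simp: H01_def)

lemma grad_AE:
  assumes "H01_gradient D v g" shows "AE x in lebesgue_on D. grad D v x = g x"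
  by (rule H01_gradient_unique[OF grad_H01_gradient[OF H01_gradient_in_H01[OF assms]] assms]) simp

lemma V_norm_eq:
  assumes "H01_gradient D v g" shows "V_norm D v = L2_norm D g"
  unfolding V_norm_def
  by (rule L2_norm_cong_AE[OF grad_AE[OF assms]])
    (use assms grad_H01_gradient[OF H01_gradient_in_H01[OF assms]] in \<open>auto dest: H01_gradient_L2\<close>)

lemma Poincare:
  obtains C where "0 \<le> C" "\<And>v g. H01_gradient D v g \<Longrightarrow> L2_norm D v \<le> C * L2_norm D g"
proof -
  obtain R where R: "\<And>x. x \<in> D \<Longrightarrow> norm x \<le> R"
    using bounded_D by (auto simp: bounded_iff)
  have R': "\<And>x. x \<in> D \<Longrightarrow> norm x \<le> \<bar>R\<bar>"
    using R by force
  show ?thesis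
  proof (rule that[of "2 * \<bar>R\<bar>"])
    fix v g assume H: "H01_gradient D v g"
    then obtain \<phi> where \<phi>: "\<And>n. test_function D (\<phi> n)"
      and \<phi>_lim: "(\<lambda>n. L2_norm D (\<lambda>x. \<phi> n x - v x)) \<longlonglongrightarrow> 0"
        "(\<lambda>n. L2_norm D (\<lambda>x. classical_gradient (\<phi> n) x - g x)) \<longlonglongrightarrow> 0"
      unfolding H01_gradient_def by blast
    show "L2_norm D v \<le> 2 * \<bar>R\<bar> * L2_norm D g"
    proof (rule LIMSEQ_le)
      show "(\<lambda>n. L2_norm D (\<phi> n)) \<longlonglongrightarrow> L2_norm D v"
        by (rule L2_norm_tendsto[OF test_function_L2[OF \<phi>] H01_gradient_L2(1)[OF H] \<phi>_lim(1)])
      show "(\<lambda>n. 2 * \<bar>R\<bar> * L2_norm D (classical_gradient (\<phi> n))) \<longlonglongrightarrow> 2 * \<bar>R\<bar> * L2_norm D g"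
        by (rule tendsto_mult_left[OF L2_norm_tendsto[OF classical_gradient_L2[OF \<phi>]
              H01_gradient_L2(2)[OF H] \<phi>_lim(2)]])
      show "\<exists>N. \<forall>n\<ge>N. L2_norm D (\<phi> n) \<le> 2 * \<bar>R\<bar> * L2_norm D (classical_gradient (\<phi> n))"
        using Poincare_test_function[OF R' _ \<phi>] by simp
    qed
  qed simp
qed

lemma weak_gradient_limit:
  assumes v: "\<And>n. L2 D (v n)" "L2 D v'" and g: "\<And>n. L2 D (g n)" "L2 D g'"
    and v_lim: "(\<lambda>n. L2_norm D (\<lambda>x. v n x - v' x)) \<longlonglongrightarrow> 0"
    and g_lim: "(\<lambda>n. L2_norm D (\<lambda>x. g n x - g' x)) \<longlonglongrightarrow> 0"
    and weak: "\<And>n. weak_gradient D (v n) (g n)"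
  shows "weak_gradient D v' g'"
  unfolding weak_gradient_def
proof (intro allI impI ballI)
  fix \<phi> :: "'a \<Rightarrow> real" and i :: 'a assume \<phi>: "test_function D \<phi>" and i: "i \<in> Basis"
  have "L2 D (\<lambda>x. \<phi> x *\<^sub>R i)"
    by (rule L2_dominated[OF test_function_L2[OF \<phi>], where C=1])
      (use L2_measurable[OF test_function_L2[OF \<phi>]] i in auto)
  note g_conv = L2_inner_tendsto[OF g this g_lim]
  have eq: "(LINT x|lebesgue_on D. v n x * (classical_gradient \<phi> x \<bullet> i))
      = - (LINT x|lebesgue_on D. g n x \<bullet> (\<phi> x *\<^sub>R i))" for n
    using weak[of n] \<phi> i by (simp add: weak_gradient_def mult.commute)
  have "(\<lambda>n. LINT x|lebesgue_on D. v n x * (classical_gradient \<phi> x \<bullet> i))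
      \<longlonglongrightarrow> (LINT x|lebesgue_on D. v' x * (classical_gradient \<phi> x \<bullet> i))"
    using L2_inner_tendsto[OF v classical_gradient_component_L2[OF \<phi> i] v_lim] by simp
  moreover have "(\<lambda>n. LINT x|lebesgue_on D. v n x * (classical_gradient \<phi> x \<bullet> i))
      \<longlonglongrightarrow> - (LINT x|lebesgue_on D. g' x \<bullet> (\<phi> x *\<^sub>R i))"
    unfolding eq by (rule tendsto_minus[OF g_conv])
  ultimately have "(LINT x|lebesgue_on D. v' x * (classical_gradient \<phi> x \<bullet> i))
      = - (LINT x|lebesgue_on D. g' x \<bullet> (\<phi> x *\<^sub>R i))"
    by (rule LIMSEQ_unique)
  then show "(LINT x|lebesgue_on D. v' x * (classical_gradient \<phi> x \<bullet> i))
      = - (LINT x|lebesgue_on D. (g' x \<bullet> i) * \<phi> x)"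
    by (simp add: mult.commute)
qed

lemma H01_gradient_approx:
  assumes H: "H01_gradient D v g" and e: "0 < e"
  shows "\<exists>\<phi>. test_function D \<phi> \<and> L2_norm D (\<lambda>x. \<phi> x - v x) < e \<and>
      L2_norm D (\<lambda>x. classical_gradient \<phi> x - g x) < e"
proof -
  obtain \<phi> where \<phi>: "\<And>n. test_function D (\<phi> n)"
    and \<phi>_lim: "(\<lambda>n. L2_norm D (\<lambda>x. \<phi> n x - v x)) \<longlonglongrightarrow> 0"
      "(\<lambda>n. L2_norm D (\<lambda>x. classical_gradient (\<phi> n) x - g x)) \<longlonglongrightarrow> 0"
    using H unfolding H01_gradient_def by blast
  have "\<forall>\<^sub>F n in sequentially. L2_norm D (\<lambda>x. \<phi> n x - v x) < e \<and>
      L2_norm D (\<lambda>x. classical_gradient (\<phi> n) x - g x) < e"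
    by (intro eventually_conj order_tendstoD(2)[OF \<phi>_lim(1) e] order_tendstoD(2)[OF \<phi>_lim(2) e])
  then show ?thesis using \<phi> by (auto simp: eventually_sequentially)
qed

text \<open>By the Poincare inequality it suffices that the gradients form a Cauchy sequence. The limit pair
inherits the integration by parts formula and is approximated by test functions chosen along a
diagonal.\<close>

theorem H01_complete:
  assumes H: "\<And>n. H01_gradient D (v n) (g n)" and Cauchy: "L2_Cauchy D g"
  obtains v' g' where "H01_gradient D v' g'" "(\<lambda>n. L2_norm D (\<lambda>x. g n x - g' x)) \<longlonglongrightarrow> 0"
proof -
  note L2 = H01_gradient_L2[OF H]
  obtain C where C: "0 \<le> C" "\<And>v g. H01_gradient D v g \<Longrightarrow> L2_norm D v \<le> C * L2_norm D g"
    by (rule Poincare) blast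
  have v_Cauchy: "L2_Cauchy D v"
    unfolding L2_Cauchy_def
  proof (intro allI impI)
    fix e :: real assume e: "0 < e"
    then have "0 < e / (C + 1)" using C by simp
    then obtain N where N: "\<And>m n. m \<ge> N \<Longrightarrow> n \<ge> N \<Longrightarrow> L2_norm D (\<lambda>x. g m x - g n x) < e / (C + 1)"
      using Cauchy unfolding L2_Cauchy_def by blast
    have "L2_norm D (\<lambda>x. v m x - v n x) < e" if "m \<ge> N" "n \<ge> N" for m n
    proof -
      have "H01_gradient D (\<lambda>x. v m x - v n x) (\<lambda>x. g m x - g n x)"
        using H01_gradient_lincomb[OF H[of m] H[of n], of 1 "-1"] by simp
      then have "L2_norm D (\<lambda>x. v m x - v n x) \<le> C * L2_norm D (\<lambda>x. g m x - g n x)"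
        by (rule C)
      also have "\<dots> \<le> C * (e / (C + 1))"
        using N[OF that] C by (intro mult_left_mono) auto
      also have "\<dots> < e" using C e by (simp add: field_simps)
      finally show ?thesis .
    qed
    then show "\<exists>N. \<forall>m\<ge>N. \<forall>n\<ge>N. L2_norm D (\<lambda>x. v m x - v n x) < e" by blast
  qed
  obtain v' where v': "L2 D v'" and v_lim: "(\<lambda>n. L2_norm D (\<lambda>x. v n x - v' x)) \<longlonglongrightarrow> 0"
    by (rule L2_complete[where F=v, OF L2(1) v_Cauchy])
  obtain g' where g': "L2 D g'" and g_lim: "(\<lambda>n. L2_norm D (\<lambda>x. g n x - g' x)) \<longlonglongrightarrow> 0"
    by (rule L2_complete[where F=g, OF L2(2) Cauchy])
  define e where "e n = inverse (real (Suc n))" for n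
  have e: "0 < e n" and e_lim: "e \<longlonglongrightarrow> 0" for n
    unfolding e_def[abs_def] by (simp, rule LIMSEQ_inverse_real_of_nat)
  obtain \<phi> where \<phi>: "\<And>n. test_function D (\<phi> n)"
    and \<phi>_close: "\<And>n. L2_norm D (\<lambda>x. \<phi> n x - v n x) < e n"
      "\<And>n. L2_norm D (\<lambda>x. classical_gradient (\<phi> n) x - g n x) < e n"
  proof -
    have "\<forall>n. \<exists>\<phi>. test_function D \<phi> \<and> L2_norm D (\<lambda>x. \<phi> x - v n x) < e n \<and>
        L2_norm D (\<lambda>x. classical_gradient \<phi> x - g n x) < e n"
      by (intro allI H01_gradient_approx H e)
    from choice[OF this] show ?thesis using that by blast
  qed
  have "H01_gradient D v' g'"
    unfolding H01_gradient_def
  proof (intro conjI exI allI)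
    show "weak_gradient D v' g'"
      using H by (intro weak_gradient_limit[OF L2(1) v' L2(2) g' v_lim g_lim]) (simp add: H01_gradient_def)
    show "(\<lambda>n. L2_norm D (\<lambda>x. \<phi> n x - v' x)) \<longlonglongrightarrow> 0"
    proof (rule Lim_null_comparison, intro always_eventually allI)
      show "norm (L2_norm D (\<lambda>x. \<phi> n x - v' x)) \<le> e n + L2_norm D (\<lambda>x. v n x - v' x)" for n
        using L2_norm_triangle_diff[OF test_function_L2[OF \<phi>[of n]] L2(1)[of n] v'] \<phi>_close(1)[of n]
        by (simp add: L2_norm_nonneg)
      show "(\<lambda>n. e n + L2_norm D (\<lambda>x. v n x - v' x)) \<longlonglongrightarrow> 0"
        using tendsto_add[OF e_lim v_lim] by simp
    qed
    show "(\<lambda>n. L2_norm D (\<lambda>x. classical_gradient (\<phi> n) x - g' x)) \<longlonglongrightarrow> 0"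
    proof (rule Lim_null_comparison, intro always_eventually allI)
      show "norm (L2_norm D (\<lambda>x. classical_gradient (\<phi> n) x - g' x))
          \<le> e n + L2_norm D (\<lambda>x. g n x - g' x)" for n
        using L2_norm_triangle_diff[OF classical_gradient_L2[OF \<phi>[of n]] L2(2)[of n] g'] \<phi>_close(2)[of n]
        by (simp add: L2_norm_nonneg)
      show "(\<lambda>n. e n + L2_norm D (\<lambda>x. g n x - g' x)) \<longlonglongrightarrow> 0"
        using tendsto_add[OF e_lim g_lim] by simp
    qed
  qed (fact v' g' \<phi>)+
  then show ?thesis using g_lim by (rule that)
qed

end

section \<open>Weighted bilinear forms\<close>

definition bounded_weight :: "'a::euclidean_space set \<Rightarrow> real \<Rightarrow> ('a \<Rightarrow> real) \<Rightarrow> bool" where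
  "bounded_weight D C m \<longleftrightarrow> m \<in> borel_measurable (lebesgue_on D) \<and> (AE x in lebesgue_on D. \<bar>m x\<bar> \<le> C)"

definition weighted_form ::
  "'a::euclidean_space set \<Rightarrow> ('a \<Rightarrow> real) \<Rightarrow> ('a \<Rightarrow> 'b::euclidean_space) \<Rightarrow> ('a \<Rightarrow> 'b) \<Rightarrow> real" where
  "weighted_form D m F G = (LINT x|lebesgue_on D. m x * (F x \<bullet> G x))"

lemma weighted_form_integrable:
  fixes F G :: "'a::euclidean_space \<Rightarrow> 'b::euclidean_space"
  assumes "bounded_weight D C m" "L2 D F" "L2 D G"
  shows "integrable (lebesgue_on D) (\<lambda>x. m x * (F x \<bullet> G x))"
  using assms unfolding bounded_weight_def by (blast intro: L2_weighted_inner_integrable)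

lemma weighted_form_commute: "weighted_form D m F G = weighted_form D m G F"
  by (simp add: weighted_form_def inner_commute)

lemma weighted_form_lincomb:
  fixes F G H :: "'a::euclidean_space \<Rightarrow> 'b::euclidean_space"
  assumes m: "bounded_weight D C m" and F: "L2 D F" and G: "L2 D G" and H: "L2 D H"
  shows "weighted_form D m (\<lambda>x. a *\<^sub>R F x + b *\<^sub>R G x) H
    = a * weighted_form D m F H + b * weighted_form D m G H"
proof -
  have "weighted_form D m (\<lambda>x. a *\<^sub>R F x + b *\<^sub>R G x) H
      = (LINT x|lebesgue_on D. a * (m x * (F x \<bullet> H x)) + b * (m x * (G x \<bullet> H x)))"
    by (simp add: weighted_form_def inner_add_left algebra_simps)
  then show ?thesis
    using weighted_form_integrable[OF m F H] weighted_form_integrable[OF m G H]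
    by (simp add: weighted_form_def)
qed

lemma weighted_form_cmult: "weighted_form D m (\<lambda>x. c *\<^sub>R F x) H = c * weighted_form D m F H"
proof -
  have "weighted_form D m (\<lambda>x. c *\<^sub>R F x) H = (LINT x|lebesgue_on D. c * (m x * (F x \<bullet> H x)))"
    by (simp add: weighted_form_def mult.left_commute)
  then show ?thesis by (simp add: weighted_form_def)
qed

lemma weighted_form_bound:
  fixes F G :: "'a::euclidean_space \<Rightarrow> 'b::euclidean_space"
  assumes m: "bounded_weight D C m" and C: "0 \<le> C" and F: "L2 D F" and G: "L2 D G"
  shows "\<bar>weighted_form D m F G\<bar> \<le> C * L2_norm D F * L2_norm D G"
proof -
  have m': "m \<in> borel_measurable (lebesgue_on D)" "AE x in lebesgue_on D. \<bar>m x\<bar> \<le> C"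
    using m by (simp_all add: bounded_weight_def)
  have "\<bar>weighted_form D m F G\<bar> \<le> L2_norm D (\<lambda>x. m x *\<^sub>R F x) * L2_norm D G"
    using L2_Cauchy_Schwarz[OF L2_weight[OF F m'] G] by (simp add: weighted_form_def)
  also have "\<dots> \<le> C * L2_norm D F * L2_norm D G"
    by (intro mult_right_mono L2_norm_weight F m' C L2_norm_nonneg)
  finally show ?thesis .
qed

lemma weighted_form_tendsto:
  fixes F :: "nat \<Rightarrow> 'a::euclidean_space \<Rightarrow> 'b::euclidean_space"
  assumes m: "bounded_weight D C m" and C: "0 \<le> C"
    and F: "\<And>n. L2 D (F n)" "L2 D F'" and G: "L2 D G"
    and lim: "(\<lambda>n. L2_norm D (\<lambda>x. F n x - F' x)) \<longlonglongrightarrow> 0"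
  shows "(\<lambda>n. weighted_form D m (F n) G) \<longlonglongrightarrow> weighted_form D m F' G"
proof -
  have "(\<lambda>n. weighted_form D m (F n) G - weighted_form D m F' G) \<longlonglongrightarrow> 0"
  proof (rule Lim_null_comparison, intro always_eventually allI)
    fix n
    have "weighted_form D m (F n) G - weighted_form D m F' G = weighted_form D m (\<lambda>x. F n x - F' x) G"
      using weighted_form_lincomb[OF m F(1)[of n] F(2) G, of 1 "-1"] by simp
    then show "norm (weighted_form D m (F n) G - weighted_form D m F' G)
        \<le> C * L2_norm D (\<lambda>x. F n x - F' x) * L2_norm D G"
      using weighted_form_bound[OF m C L2_diff[OF F(1)[of n] F(2)] G] by simp
    show "(\<lambda>n. C * L2_norm D (\<lambda>x. F n x - F' x) * L2_norm D G) \<longlonglongrightarrow> 0"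
      using tendsto_mult_right[OF tendsto_mult_left[OF lim, of C], of "L2_norm D G"] by simp
  qed
  then show ?thesis by (simp add: LIM_zero_iff)
qed

lemma weighted_form_mono:
  fixes F :: "'a::euclidean_space \<Rightarrow> 'b::euclidean_space"
  assumes "bounded_weight D C m" "bounded_weight D C' m'" "L2 D F"
    and "AE x in lebesgue_on D. m x \<le> m' x"
  shows "weighted_form D m F F \<le> weighted_form D m' F F"
  unfolding weighted_form_def
proof (rule integral_mono_AE)
  show "AE x in lebesgue_on D. m x * (F x \<bullet> F x) \<le> m' x * (F x \<bullet> F x)"
    using assms(4) by eventually_elim (simp add: mult_right_mono)
qed (intro weighted_form_integrable[OF assms(1)] weighted_form_integrable[OF assms(2)] assms)+

lemma weighted_form_const:
  "weighted_form D (\<lambda>x. c) F F = c * (L2_norm D F)\<^sup>2"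
  by (simp add: weighted_form_def L2_norm_square power2_norm_eq_inner)

lemma bounded_weight_const: "\<bar>c\<bar> \<le> C \<Longrightarrow> bounded_weight D C (\<lambda>x. c)"
  by (simp add: bounded_weight_def)

text \<open>The ellipticity of the form for a weight bounded below by \<open>\<alpha>\<close>.\<close>

lemma weighted_form_coercive:
  fixes F :: "'a::euclidean_space \<Rightarrow> 'b::euclidean_space"
  assumes "bounded_weight D C m" "L2 D F" "AE x in lebesgue_on D. \<alpha> \<le> m x"
  shows "\<alpha> * (L2_norm D F)\<^sup>2 \<le> weighted_form D m F F"
  using weighted_form_mono[OF bounded_weight_const[OF order_refl] assms(1,2), of \<alpha>] assms(3)
  by (simp add: weighted_form_const)

section \<open>Weak equations in a closed space of fields\<close>

text \<open>A closed linear subspace of $L^2(D)$ on the level of representatives, modelled on the space of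
gradients of $H^1_0$ functions.\<close>

locale closed_field_space =
  fixes D :: "'a::euclidean_space set" and G :: "('a \<Rightarrow> 'b::euclidean_space) set"
  assumes nonempty: "G \<noteq> {}"
    and G_L2: "g \<in> G \<Longrightarrow> L2 D g"
    and G_lincomb: "g \<in> G \<Longrightarrow> h \<in> G \<Longrightarrow> (\<lambda>x. c *\<^sub>R g x + d *\<^sub>R h x) \<in> G"
    and G_complete: "(\<And>n. gs n \<in> G) \<Longrightarrow> L2_Cauchy D gs \<Longrightarrow>
      \<exists>h\<in>G. (\<lambda>n. L2_norm D (\<lambda>x. gs n x - h x)) \<longlonglongrightarrow> 0"
begin

text \<open>For a quadratic functional the hypothesis \<open>convex\<close> is the parallelogram law.\<close>

lemma minimizing_sequence_Cauchy:
  fixes J :: "('a \<Rightarrow> 'b) \<Rightarrow> real"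
  assumes g: "\<And>n. g n \<in> G" and \<alpha>: "0 < \<alpha>"
    and near: "\<And>n. J (g n) \<le> I + inverse (real (Suc n))" and lower: "\<And>h. h \<in> G \<Longrightarrow> I \<le> J h"
    and convex: "\<And>h k. h \<in> G \<Longrightarrow> k \<in> G \<Longrightarrow>
      \<alpha> * (L2_norm D (\<lambda>x. h x - k x))\<^sup>2 \<le> 2 * J h + 2 * J k - 4 * J (\<lambda>x. (1/2) *\<^sub>R h x + (1/2) *\<^sub>R k x)"
  shows "L2_Cauchy D g"
  unfolding L2_Cauchy_def
proof (intro allI impI)
  fix e :: real assume e: "0 < e"
  then have "0 < \<alpha> * e\<^sup>2 / 4" using \<alpha> by simp
  then obtain N where N: "inverse (real (Suc N)) < \<alpha> * e\<^sup>2 / 4"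
    using reals_Archimedean by blast
  have "L2_norm D (\<lambda>x. g m x - g n x) < e" if "N \<le> m" "N \<le> n" for m n
  proof -
    have small: "inverse (real (Suc k)) < \<alpha> * e\<^sup>2 / 4" if "N \<le> k" for k
      using that by (intro le_less_trans[OF _ N] le_imp_inverse_le) auto
    have "\<alpha> * (L2_norm D (\<lambda>x. g m x - g n x))\<^sup>2
        \<le> 2 * J (g m) + 2 * J (g n) - 4 * J (\<lambda>x. (1/2) *\<^sub>R g m x + (1/2) *\<^sub>R g n x)"
      by (rule convex[OF g g])
    also have "\<dots> \<le> 2 * inverse (real (Suc m)) + 2 * inverse (real (Suc n))"
      using near[of m] near[of n] lower[OF G_lincomb[OF g[of m] g[of n], of "1/2" "1/2"]] by linarith
    also have "\<dots> < \<alpha> * e\<^sup>2"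
      using small[OF that(1)] small[OF that(2)] by linarith
    finally have "(L2_norm D (\<lambda>x. g m x - g n x))\<^sup>2 < e\<^sup>2"
      using \<alpha> by simp
    then show ?thesis
      by (rule power2_less_imp_less) (use e in simp)
  qed
  then show "\<exists>N. \<forall>m\<ge>N. \<forall>n\<ge>N. L2_norm D (\<lambda>x. g m x - g n x) < e" by blast
qed

text \<open>The solution minimizes the energy \<open>J h = \<integral> a \<bar>h\<bar>\<^sup>2 - 2 \<integral> F \<bullet> h\<close>. The equation is obtained from the
minimizing sequence itself, by perturbing it in the direction \<open>t h\<close> and passing to the limit.\<close>

theorem weak_equation_solvable:
  fixes F :: "'a \<Rightarrow> 'b"
  assumes a: "bounded_weight D \<beta> a" and \<beta>: "0 \<le> \<beta>" and \<alpha>: "0 < \<alpha>"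
    and coercive: "AE x in lebesgue_on D. \<alpha> \<le> a x" and F: "L2 D F"
  shows "\<exists>g\<in>G. \<forall>h\<in>G. weighted_form D a g h = (LINT x|lebesgue_on D. F x \<bullet> h x)"
proof -
  define l where "l h = weighted_form D (\<lambda>x. 1) F h" for h
  define Q :: "('a \<Rightarrow> 'b) \<Rightarrow> ('a \<Rightarrow> 'b) \<Rightarrow> real" where "Q = weighted_form D a"
  define J where "J h = Q h h - 2 * l h" for h
  have one: "bounded_weight D 1 (\<lambda>x. 1)" by (rule bounded_weight_const) simp
  have l_lin: "l (\<lambda>x. c *\<^sub>R h x + d *\<^sub>R k x) = c * l h + d * l k" if "h \<in> G" "k \<in> G" for c d h k
    using weighted_form_lincomb[OF one G_L2[OF that(1)] G_L2[OF that(2)] F]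
    by (simp add: l_def weighted_form_commute[of D _ F])
  have Q_lin: "Q (\<lambda>x. c *\<^sub>R h x + d *\<^sub>R k x) w = c * Q h w + d * Q k w"
    if "h \<in> G" "k \<in> G" "w \<in> G" for c d h k w
    using weighted_form_lincomb[OF a G_L2 G_L2 G_L2, OF that] by (simp add: Q_def)
  have Q_comm: "Q h k = Q k h" for h k
    by (simp add: Q_def weighted_form_commute)
  have Q_square: "Q (\<lambda>x. c *\<^sub>R h x + d *\<^sub>R k x) (\<lambda>x. c *\<^sub>R h x + d *\<^sub>R k x)
      = c\<^sup>2 * Q h h + 2 * c * d * Q h k + d\<^sup>2 * Q k k" if "h \<in> G" "k \<in> G" for c d h k
  proof -
    define w where "w x = c *\<^sub>R h x + d *\<^sub>R k x" for x
    have w: "w \<in> G" and w_lin: "Q w z = c * Q h z + d * Q k z" if "z \<in> G" for z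
      unfolding w_def[abs_def] using G_lincomb Q_lin that \<open>h \<in> G\<close> \<open>k \<in> G\<close> by blast+
    have "Q w w = c * Q h w + d * Q k w" by (rule w_lin[OF w[OF that(1)]])
    also have "\<dots> = c * Q w h + d * Q w k" by (simp only: Q_comm[of h w] Q_comm[of k w])
    also have "\<dots> = c\<^sup>2 * Q h h + 2 * c * d * Q h k + d\<^sup>2 * Q k k"
      unfolding w_lin[OF that(1)] w_lin[OF that(2)] Q_comm[of k h] by (simp add: power2_eq_square algebra_simps)
    finally show ?thesis unfolding w_def[abs_def] .
  qed
  have Q_coercive: "\<alpha> * (L2_norm D h)\<^sup>2 \<le> Q h h" if "h \<in> G" for h
    unfolding Q_def by (rule weighted_form_coercive[OF a G_L2[OF that] coercive])
  have J_lower: "- ((L2_norm D F)\<^sup>2 / \<alpha>) \<le> J h" if "h \<in> G" for h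
  proof -
    have "l h \<le> L2_norm D F * L2_norm D h"
      using weighted_form_bound[OF one _ F G_L2[OF that]] by (simp add: l_def)
    moreover have "0 \<le> (\<alpha> * L2_norm D h - L2_norm D F)\<^sup>2 / \<alpha>" using \<alpha> by simp
    then have "2 * (L2_norm D F * L2_norm D h) \<le> \<alpha> * (L2_norm D h)\<^sup>2 + (L2_norm D F)\<^sup>2 / \<alpha>"
      using \<alpha> by (simp add: power2_eq_square field_simps)
    ultimately show ?thesis using Q_coercive[OF that] by (simp add: J_def)
  qed
  define I where "I = Inf (J ` G)"
  have bdd: "bdd_below (J ` G)" using J_lower by (auto intro!: bdd_belowI2)
  have I_lower: "I \<le> J h" if "h \<in> G" for h
    unfolding I_def by (rule cInf_lower[OF _ bdd]) (use that in simp)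
  have "\<forall>n. \<exists>g\<in>G. J g < I + inverse (real (Suc n))"
  proof
    fix n
    have "Inf (J ` G) < I + inverse (real (Suc n))" by (simp add: I_def)
    then show "\<exists>g\<in>G. J g < I + inverse (real (Suc n))"
      using cInf_less_iff[OF _ bdd] nonempty by auto
  qed
  then have "\<exists>g. \<forall>n. g n \<in> G \<and> J (g n) < I + inverse (real (Suc n))"
    by (intro choice) blast
  then obtain g where g: "\<And>n. g n \<in> G" and g_near: "\<And>n. J (g n) < I + inverse (real (Suc n))"
    by blast
  have "L2_Cauchy D g"
  proof (rule minimizing_sequence_Cauchy[OF g \<alpha> less_imp_le[OF g_near] I_lower])
    fix h k assume hk: "h \<in> G" "k \<in> G"
    have "\<alpha> * (L2_norm D (\<lambda>x. h x - k x))\<^sup>2 \<le> Q (\<lambda>x. h x - k x) (\<lambda>x. h x - k x)"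
      using Q_coercive[OF G_lincomb[OF hk, of 1 "-1"]] by simp
    also have "\<dots> = Q h h - 2 * Q h k + Q k k"
      using Q_square[OF hk, of 1 "-1"] by simp
    also have "\<dots> = 2 * J h + 2 * J k - 4 * J (\<lambda>x. (1/2) *\<^sub>R h x + (1/2) *\<^sub>R k x)"
      unfolding J_def Q_square[OF hk] l_lin[OF hk] by (simp add: power2_eq_square)
    finally show "\<alpha> * (L2_norm D (\<lambda>x. h x - k x))\<^sup>2
        \<le> 2 * J h + 2 * J k - 4 * J (\<lambda>x. (1/2) *\<^sub>R h x + (1/2) *\<^sub>R k x)" .
  qed
  then obtain g' where g': "g' \<in> G" and g_lim: "(\<lambda>n. L2_norm D (\<lambda>x. g n x - g' x)) \<longlonglongrightarrow> 0"
    using G_complete[of g] g by blast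
  have "Q g' h = l h" if h: "h \<in> G" for h
  proof -
    have "0 \<le> 2 * t * (Q g' h - l h) + t\<^sup>2 * Q h h" for t
    proof (rule LIMSEQ_le_const)
      have conv: "(\<lambda>n. Q (g n) h) \<longlonglongrightarrow> Q g' h"
        unfolding Q_def by (rule weighted_form_tendsto[OF a \<beta> G_L2[OF g] G_L2[OF g'] G_L2[OF h] g_lim])
      have "(\<lambda>n. 2 * t * (Q (g n) h - l h) + t\<^sup>2 * Q h h + inverse (real (Suc n)))
          \<longlonglongrightarrow> 2 * t * (Q g' h - l h) + t\<^sup>2 * Q h h + 0"
        by (intro tendsto_add tendsto_mult tendsto_diff tendsto_const conv LIMSEQ_inverse_real_of_nat)
      then show "(\<lambda>n. 2 * t * (Q (g n) h - l h) + t\<^sup>2 * Q h h + inverse (real (Suc n)))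
          \<longlonglongrightarrow> 2 * t * (Q g' h - l h) + t\<^sup>2 * Q h h"
        by simp
      have "0 \<le> 2 * t * (Q (g n) h - l h) + t\<^sup>2 * Q h h + inverse (real (Suc n))" for n
      proof -
        have "J (\<lambda>x. 1 *\<^sub>R g n x + t *\<^sub>R h x) = J (g n) + 2 * t * (Q (g n) h - l h) + t\<^sup>2 * Q h h"
          unfolding J_def Q_square[OF g h] l_lin[OF g h] by (simp add: algebra_simps)
        then show ?thesis
          using I_lower[OF G_lincomb[OF g[of n] h, of 1 t]] g_near[of n] by linarith
      qed
      then show "\<exists>N. \<forall>n\<ge>N. 0 \<le> 2 * t * (Q (g n) h - l h) + t\<^sup>2 * Q h h + inverse (real (Suc n))"
        by blast
    qed
    note quadratic = this
    define r q where "r = Q g' h - l h" and "q = Q h h"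
    have q: "0 \<le> q"
      using Q_coercive[OF h] \<alpha> by (simp add: q_def order_trans[rotated])
    \<comment> \<open>The step \<open>- r / q\<close> of steepest descent, shifted so that \<open>q = 0\<close> is covered.\<close>
    have "0 \<le> 2 * (- r / (q + 1)) * r + (- r / (q + 1))\<^sup>2 * q"
      using quadratic[of "- r / (q + 1)"] by (simp only: r_def q_def)
    also have "\<dots> = - (r\<^sup>2 * (q + 2) / (q + 1)\<^sup>2)"
      using q by (simp add: power2_eq_square divide_simps) (simp add: algebra_simps)
    finally have "r\<^sup>2 * (q + 2) / (q + 1)\<^sup>2 \<le> 0" by simp
    then have "r = 0"
      using q by (simp add: divide_le_0_iff mult_le_0_iff)
    then show ?thesis by (simp add: r_def)
  qed
  then show ?thesis using g' by (auto simp: Q_def l_def weighted_form_def)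
qed

end

section \<open>Mixed fields of a parametric equation\<close>

lemma L2_bounded_weight:
  fixes F :: "'a::euclidean_space \<Rightarrow> 'b::euclidean_space"
  shows "bounded_weight D C m \<Longrightarrow> L2 D F \<Longrightarrow> L2 D (\<lambda>x. m x *\<^sub>R F x)"
  unfolding bounded_weight_def by (blast intro: L2_weight)

text \<open>The map \<open>u\<close> solves one equation with a fixed right-hand side \<open>l\<close> for each parameter, and the
coefficient is affine in each single parameter, with slope \<open>\<psi> j\<close>.\<close>

locale parametric_equation = closed_field_space D G
  for D :: "'a::euclidean_space set" and G :: "('a \<Rightarrow> 'b::euclidean_space) set" +
  fixes a :: "(nat \<Rightarrow> real) \<Rightarrow> 'a \<Rightarrow> real" and \<psi> :: "nat \<Rightarrow> 'a \<Rightarrow> real"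
    and \<alpha> \<beta> C :: real and l :: "('a \<Rightarrow> 'b) \<Rightarrow> real" and u :: "(nat \<Rightarrow> real) \<Rightarrow> 'a \<Rightarrow> 'b"
  assumes \<alpha>: "0 < \<alpha>" and \<beta>: "0 \<le> \<beta>" and C: "0 \<le> C"
    and a_weight: "y \<in> param_domain \<Longrightarrow> bounded_weight D \<beta> (a y)"
    and a_coercive: "y \<in> param_domain \<Longrightarrow> AE x in lebesgue_on D. \<alpha> \<le> a y x"
    and \<psi>_weight: "bounded_weight D C (\<psi> j)"
    and a_affine: "y \<in> param_domain \<Longrightarrow> y(j := y j + h) \<in> param_domain \<Longrightarrow>
      AE x in lebesgue_on D. a (y(j := y j + h)) x = a y x + h * \<psi> j x"
    and u_G: "y \<in> param_domain \<Longrightarrow> u y \<in> G"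
    and u_eq: "y \<in> param_domain \<Longrightarrow> v \<in> G \<Longrightarrow> weighted_form D (a y) (u y) v = l v"
begin

text \<open>The recursion that the gradients of the mixed derivatives satisfy at the fixed parameter \<open>y\<close>.\<close>

definition is_mixed_family :: "(nat \<Rightarrow> real) \<Rightarrow> (nat set \<Rightarrow> 'a \<Rightarrow> 'b) \<Rightarrow> bool" where
  "is_mixed_family y U \<longleftrightarrow> U {} = u y \<and>
     (\<forall>S. finite S \<longrightarrow> U S \<in> G) \<and>
     (\<forall>S. finite S \<longrightarrow> S \<noteq> {} \<longrightarrow> (\<forall>v\<in>G.
        weighted_form D (a y) (U S) v = - (\<Sum>i\<in>S. weighted_form D (\<psi> i) (U (S - {i})) v)))"

text \<open>The recursion determines \<open>U S\<close> only up to null sets, so the fields are chosen by well-founded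
recursion along strict inclusion of finite sets.\<close>

lemma mixed_family_exists:
  assumes y: "y \<in> param_domain"
  shows "\<exists>U. is_mixed_family y U"
proof -
  define P where "P U S r \<longleftrightarrow> (finite S \<longrightarrow> r \<in> G \<and> (S = {} \<longrightarrow> r = u y) \<and>
      (S \<noteq> {} \<longrightarrow> (\<forall>v\<in>G. weighted_form D (a y) r v = - (\<Sum>i\<in>S. weighted_form D (\<psi> i) (U (S - {i})) v))))"
    for U :: "nat set \<Rightarrow> 'a \<Rightarrow> 'b" and S r
  have smaller: "(S - {i}, S) \<in> finite_psubset" if "finite S" "i \<in> S" for S :: "nat set" and i
    using that by (auto simp: finite_psubset_def)
  have "\<exists>U. \<forall>S. P U S (U S)"
  proof (rule dependent_wf_choice[OF wf_finite_psubset])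
    fix U U' :: "nat set \<Rightarrow> 'a \<Rightarrow> 'b" and S r
    assume eq: "\<And>T. (T, S) \<in> finite_psubset \<Longrightarrow> U T = U' T"
    have "(\<Sum>i\<in>S. weighted_form D (\<psi> i) (U (S - {i})) v) = (\<Sum>i\<in>S. weighted_form D (\<psi> i) (U' (S - {i})) v)"
      if "finite S" for v
      using eq[OF smaller[OF that]] by simp
    then show "P U S r = P U' S r" by (cases "finite S") (simp_all add: P_def)
  next
    fix S :: "nat set" and U :: "nat set \<Rightarrow> 'a \<Rightarrow> 'b"
    assume IH: "\<And>T. (T, S) \<in> finite_psubset \<Longrightarrow> P U T (U T)"
    show "\<exists>r. P U S r"
    proof (cases "finite S \<and> S \<noteq> {}")
      case False
      then show ?thesis using u_G[OF y] by (auto simp: P_def)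
    next
      case True
      then have S: "finite S" "S \<noteq> {}" by auto
      have U_L2: "L2 D (U (S - {i}))" if "i \<in> S" for i
        using IH[OF smaller[OF S(1) that]] S(1) by (auto simp: P_def intro: G_L2)
      define F where "F x = - (\<Sum>i\<in>S. \<psi> i x *\<^sub>R U (S - {i}) x)" for x
      have "L2 D F"
        unfolding F_def[abs_def] by (intro L2_uminus L2_sum L2_bounded_weight[OF \<psi>_weight] U_L2)
      from weak_equation_solvable[OF a_weight[OF y] \<beta> \<alpha> a_coercive[OF y] this]
      obtain g where g: "g \<in> G" and g_eq: "\<And>h. h \<in> G \<Longrightarrow> weighted_form D (a y) g h = (LINT x|lebesgue_on D. F x \<bullet> h x)"
        by blast
      have "(LINT x|lebesgue_on D. F x \<bullet> v x) = - (\<Sum>i\<in>S. weighted_form D (\<psi> i) (U (S - {i})) v)"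
        if v: "v \<in> G" for v
      proof -
        have "(LINT x|lebesgue_on D. F x \<bullet> v x)
            = - (LINT x|lebesgue_on D. (\<Sum>i\<in>S. \<psi> i x * (U (S - {i}) x \<bullet> v x)))"
          by (simp add: F_def inner_sum_left)
        also have "(LINT x|lebesgue_on D. (\<Sum>i\<in>S. \<psi> i x * (U (S - {i}) x \<bullet> v x)))
            = (\<Sum>i\<in>S. LINT x|lebesgue_on D. \<psi> i x * (U (S - {i}) x \<bullet> v x))"
          by (intro Bochner_Integration.integral_sum weighted_form_integrable[OF \<psi>_weight] U_L2 G_L2[OF v])
        finally show ?thesis by (simp add: weighted_form_def)
      qed
      then have "P U S g" using g g_eq S by (simp add: P_def)
      then show ?thesis by blast
    qed
  qed
  then obtain U where "\<And>S. P U S (U S)" by blast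
  then have "is_mixed_family y U" by (auto simp: P_def is_mixed_family_def)
  then show ?thesis by blast
qed

definition mixed_field :: "(nat \<Rightarrow> real) \<Rightarrow> nat set \<Rightarrow> 'a \<Rightarrow> 'b" where
  "mixed_field y = (SOME U. is_mixed_family y U)"

lemma is_mixed_family_mixed_field: "y \<in> param_domain \<Longrightarrow> is_mixed_family y (mixed_field y)"
  unfolding mixed_field_def by (rule someI_ex[OF mixed_family_exists])

lemma mixed_field_empty: "y \<in> param_domain \<Longrightarrow> mixed_field y {} = u y"
  using is_mixed_family_mixed_field by (simp add: is_mixed_family_def)

lemma mixed_field_G: "y \<in> param_domain \<Longrightarrow> finite S \<Longrightarrow> mixed_field y S \<in> G"
  using is_mixed_family_mixed_field by (simp add: is_mixed_family_def)

lemma mixed_field_recursion: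
  "y \<in> param_domain \<Longrightarrow> finite S \<Longrightarrow> S \<noteq> {} \<Longrightarrow> v \<in> G \<Longrightarrow>
    weighted_form D (a y) (mixed_field y S) v = - (\<Sum>i\<in>S. weighted_form D (\<psi> i) (mixed_field y (S - {i})) v)"
  using is_mixed_family_mixed_field by (simp add: is_mixed_family_def)

text \<open>With the load included, one formula covers the solution and its derivatives. The load is the same
for all parameters and therefore cancels in difference quotients.\<close>

lemma mixed_field_equation:
  assumes "y \<in> param_domain" "finite S" "v \<in> G"
  shows "weighted_form D (a y) (mixed_field y S) v
    = (if S = {} then l v else 0) - (\<Sum>i\<in>S. weighted_form D (\<psi> i) (mixed_field y (S - {i})) v)"
  using assms by (cases "S = {}") (simp_all add: mixed_field_empty u_eq mixed_field_recursion)

text \<open>Difference quotient in the \<open>j\<close>-th parameter minus its expected limit, nested as the linear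
combinations under which the field space is closed.\<close>

definition quotient_error :: "(nat \<Rightarrow> real) \<Rightarrow> nat \<Rightarrow> nat set \<Rightarrow> real \<Rightarrow> 'a \<Rightarrow> 'b" where
  "quotient_error y j S h =
    (\<lambda>x. 1 *\<^sub>R ((1/h) *\<^sub>R mixed_field (y(j := y j + h)) S x + (-1/h) *\<^sub>R mixed_field y S x)
       + (-1) *\<^sub>R mixed_field y (insert j S) x)"

lemma quotient_error_G:
  assumes "y \<in> param_domain" "y(j := y j + h) \<in> param_domain" "finite S"
  shows "quotient_error y j S h \<in> G"
  unfolding quotient_error_def by (intro G_lincomb mixed_field_G) (use assms in auto)

lemma weighted_form_quotient_error:
  assumes "y \<in> param_domain" "y(j := y j + h) \<in> param_domain" "finite S" "v \<in> G" "bounded_weight D B m"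
  shows "weighted_form D m (quotient_error y j S h) v
    = (weighted_form D m (mixed_field (y(j := y j + h)) S) v - weighted_form D m (mixed_field y S) v) / h
      - weighted_form D m (mixed_field y (insert j S)) v"
proof -
  have L2: "L2 D (mixed_field y S)" "L2 D (mixed_field (y(j := y j + h)) S)"
    "L2 D (mixed_field y (insert j S))" "L2 D v"
    using assms by (auto intro: G_L2 mixed_field_G)
  have L2': "L2 D (\<lambda>x. (1/h) *\<^sub>R mixed_field (y(j := y j + h)) S x + (-1/h) *\<^sub>R mixed_field y S x)"
    by (intro L2_add L2_cmult L2)
  show ?thesis
    unfolding quotient_error_def weighted_form_lincomb[OF assms(5) L2' L2(3,4)]
      weighted_form_lincomb[OF assms(5) L2(2,1,4)]
    by (simp add: diff_divide_distrib)
qed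

text \<open>Subtract the equations of \<open>mixed_field (y(j := y j + h)) S\<close>, \<open>mixed_field y S\<close> and
\<open>mixed_field y (insert j S)\<close>. Moving all of them to the coefficient at the shifted parameter
produces \<open>\<psi> j\<close> terms: the one with \<open>mixed_field y S\<close> cancels against the summand \<open>j\<close> of the recursion for
\<open>insert j S\<close>, the other one carries the factor \<open>h\<close>.\<close>

lemma quotient_error_equation:
  assumes y: "y \<in> param_domain" and y': "y(j := y j + h) \<in> param_domain"
    and S: "finite S" "j \<notin> S" and v: "v \<in> G" and h: "h \<noteq> 0"
  shows "weighted_form D (a (y(j := y j + h))) (quotient_error y j S h) v
    = - (\<Sum>i\<in>S. weighted_form D (\<psi> i) (quotient_error y j (S - {i}) h) v)
      - h * weighted_form D (\<psi> j) (mixed_field y (insert j S)) v"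
proof -
  define y' where "y' = y(j := y j + h)"
  note y' = assms(2)[folded y'_def]
  have shift: "weighted_form D (a y') F v = weighted_form D (a y) F v + h * weighted_form D (\<psi> j) F v"
    if F: "F \<in> G" for F
  proof -
    have "weighted_form D (a y') F v
        = (LINT x|lebesgue_on D. a y x * (F x \<bullet> v x) + h * (\<psi> j x * (F x \<bullet> v x)))"
      unfolding weighted_form_def
    proof (rule integral_cong_AE)
      show "AE x in lebesgue_on D. a y' x * (F x \<bullet> v x) = a y x * (F x \<bullet> v x) + h * (\<psi> j x * (F x \<bullet> v x))"
        using a_affine[OF assms(1,2)] unfolding y'_def by eventually_elim (simp add: algebra_simps)
    qed (use a_weight[OF y] a_weight[OF y'] \<psi>_weight[of j] G_L2[OF F] G_L2[OF v] in
        \<open>auto dest!: L2_measurable simp: bounded_weight_def\<close>)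
    then show ?thesis
      using weighted_form_integrable[OF a_weight[OF y] G_L2[OF F] G_L2[OF v]]
        weighted_form_integrable[OF \<psi>_weight G_L2[OF F] G_L2[OF v]]
      by (simp add: weighted_form_def)
  qed
  let ?W = "\<lambda>i T. weighted_form D (\<psi> i) T v"
  have plus: "(\<Sum>i\<in>insert j S. ?W i (mixed_field y (insert j S - {i})))
      = ?W j (mixed_field y S) + (\<Sum>i\<in>S. ?W i (mixed_field y (insert j (S - {i}))))"
  proof -
    have "insert j S - {i} = insert j (S - {i})" if "i \<in> S" for i
      using that S by auto
    moreover have "insert j S - {j} = S" using S by auto
    ultimately show ?thesis using S by (simp cong: sum.cong)
  qed
  have "weighted_form D (a y') (quotient_error y j S h) v
      = (weighted_form D (a y') (mixed_field y' S) v - weighted_form D (a y) (mixed_field y S) v) / h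
        - ?W j (mixed_field y S) - weighted_form D (a y) (mixed_field y (insert j S)) v
        - h * ?W j (mixed_field y (insert j S))"
    using h weighted_form_quotient_error[OF assms(1,2) S(1) v a_weight[OF y'], folded y'_def]
    by (simp add: shift mixed_field_G y S field_simps)
  \<comment> \<open>In \<open>plus\<close> the summand for \<open>j\<close> cancels against the term produced by the shift.\<close>
  also have "\<dots> = - (\<Sum>i\<in>S. (?W i (mixed_field y' (S - {i})) - ?W i (mixed_field y (S - {i}))) / h
        - ?W i (mixed_field y (insert j (S - {i})))) - h * ?W j (mixed_field y (insert j S))"
    using S
    by (simp add: mixed_field_equation[OF y' S(1) v] mixed_field_equation[OF y S(1) v]
        mixed_field_equation[OF y _ v] plus sum_subtractf sum_divide_distrib[symmetric] diff_divide_distrib)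
  also have "\<dots> = - (\<Sum>i\<in>S. ?W i (quotient_error y j (S - {i}) h)) - h * ?W j (mixed_field y (insert j S))"
    using weighted_form_quotient_error[OF assms(1,2) _ v \<psi>_weight] S by (simp add: y'_def)
  finally show ?thesis by (simp add: y'_def)
qed

text \<open>Test the equation of the error with the error.\<close>

lemma quotient_error_bound:
  assumes y: "y \<in> param_domain" and y': "y(j := y j + h) \<in> param_domain"
    and S: "finite S" "j \<notin> S" and h: "h \<noteq> 0"
  shows "\<alpha> * L2_norm D (quotient_error y j S h)
    \<le> C * ((\<Sum>i\<in>S. L2_norm D (quotient_error y j (S - {i}) h)) + \<bar>h\<bar> * L2_norm D (mixed_field y (insert j S)))"
proof -
  let ?E = "\<lambda>T. quotient_error y j T h"
  have E: "?E T \<in> G" if "finite T" for T using quotient_error_G[OF y y' that] .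
  define e where "e = L2_norm D (?E S)"
  have bound: "\<bar>weighted_form D (\<psi> i) F (?E S)\<bar> \<le> C * L2_norm D F * e" if "F \<in> G" for i F
    unfolding e_def by (rule weighted_form_bound[OF \<psi>_weight C G_L2[OF that] G_L2[OF E[OF S(1)]]])
  have "\<alpha> * e\<^sup>2 \<le> weighted_form D (a (y(j := y j + h))) (?E S) (?E S)"
    unfolding e_def by (rule weighted_form_coercive[OF a_weight[OF y'] G_L2[OF E[OF S(1)]] a_coercive[OF y']])
  also have "\<dots> = - (\<Sum>i\<in>S. weighted_form D (\<psi> i) (?E (S - {i})) (?E S))
      - h * weighted_form D (\<psi> j) (mixed_field y (insert j S)) (?E S)"
    by (rule quotient_error_equation[OF y y' S E[OF S(1)] h])
  also have "\<dots> \<le> \<bar>\<Sum>i\<in>S. weighted_form D (\<psi> i) (?E (S - {i})) (?E S)\<bar>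
      + \<bar>h\<bar> * \<bar>weighted_form D (\<psi> j) (mixed_field y (insert j S)) (?E S)\<bar>"
    by (simp flip: abs_mult)
  also have "\<dots> \<le> (\<Sum>i\<in>S. C * L2_norm D (?E (S - {i})) * e) + \<bar>h\<bar> * (C * L2_norm D (mixed_field y (insert j S)) * e)"
    by (intro add_mono mult_left_mono order_trans[OF sum_abs] sum_mono bound E mixed_field_G) (use S y in auto)
  also have "\<dots> = (C * ((\<Sum>i\<in>S. L2_norm D (?E (S - {i}))) + \<bar>h\<bar> * L2_norm D (mixed_field y (insert j S)))) * e"
    by (simp add: sum_distrib_left sum_distrib_right algebra_simps)
  finally have *: "(\<alpha> * e) * e \<le> (C * ((\<Sum>i\<in>S. L2_norm D (?E (S - {i}))) + \<bar>h\<bar> * L2_norm D (mixed_field y (insert j S)))) * e"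
    by (simp add: power2_eq_square mult.assoc)
  show ?thesis
  proof (cases "e = 0")
    case True
    then show ?thesis
      unfolding e_def using C by (auto intro!: mult_nonneg_nonneg add_nonneg_nonneg sum_nonneg L2_norm_nonneg)
  next
    case False
    then have "0 < e" using L2_norm_nonneg[of D "?E S"] by (simp add: e_def)
    then show ?thesis using * by (simp add: e_def)
  qed
qed

theorem quotient_error_tendsto_0:
  assumes y: "y \<in> param_domain" and S: "finite S" "j \<notin> S"
  shows "((\<lambda>h. L2_norm D (quotient_error y j S h)) \<longlongrightarrow> 0) (at 0 within {h. y(j := y j + h) \<in> param_domain})"
  using S
proof (induction S rule: finite_psubset_induct)
  case (psubset S)
  let ?F = "at 0 within {h. y(j := y j + h) \<in> param_domain}"
  let ?B = "\<lambda>h. (C / \<alpha>) * ((\<Sum>i\<in>S. L2_norm D (quotient_error y j (S - {i}) h)) + \<bar>h\<bar> * L2_norm D (mixed_field y (insert j S)))"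
  have "(?B \<longlongrightarrow> (C / \<alpha>) * ((\<Sum>i\<in>S. 0) + \<bar>0\<bar> * L2_norm D (mixed_field y (insert j S)))) ?F"
    by (intro tendsto_mult tendsto_const tendsto_add tendsto_sum tendsto_rabs tendsto_ident_at psubset.IH)
      (use psubset.prems in auto)
  then have B_lim: "(?B \<longlongrightarrow> 0) ?F" by simp
  show ?case
  proof (rule Lim_null_comparison[OF _ B_lim])
    show "\<forall>\<^sub>F h in ?F. norm (L2_norm D (quotient_error y j S h)) \<le> ?B h"
      unfolding eventually_at_filter
    proof (rule always_eventually, intro allI impI)
      fix h :: real assume "h \<noteq> 0" "h \<in> {h. y(j := y j + h) \<in> param_domain}"
      then have "\<alpha> * L2_norm D (quotient_error y j S h) \<le> C *
          ((\<Sum>i\<in>S. L2_norm D (quotient_error y j (S - {i}) h)) + \<bar>h\<bar> * L2_norm D (mixed_field y (insert j S)))"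
        using psubset by (intro quotient_error_bound y) auto
      then show "norm (L2_norm D (quotient_error y j S h)) \<le> ?B h"
        using \<alpha> by (simp add: L2_norm_nonneg pos_le_divide_eq mult.commute)
    qed
  qed
qed

end

section \<open>The energy bound for mixed fields\<close>

lemma weighted_form_cmult_both:
  "weighted_form D m (\<lambda>x. c *\<^sub>R F x) (\<lambda>x. c *\<^sub>R F x) = c\<^sup>2 * weighted_form D m F F"
  unfolding weighted_form_cmult
  by (subst weighted_form_commute) (simp add: weighted_form_cmult power2_eq_square)

lemma weighted_form_nonneg:
  "AE x in lebesgue_on D. 0 \<le> m x \<Longrightarrow> 0 \<le> weighted_form D m F F"
  unfolding weighted_form_def by (rule integral_nonneg_AE) (auto elim: eventually_mono)

lemma weighted_form_cmult_weight: "weighted_form D (\<lambda>x. c * m x) F H = c * weighted_form D m F H"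
  by (simp add: weighted_form_def mult.assoc)

lemma weighted_form_sum_weight:
  fixes F H :: "'a::euclidean_space \<Rightarrow> 'b::euclidean_space"
  assumes "\<And>j. j \<in> T \<Longrightarrow> bounded_weight D (C j) (m j)" "L2 D F" "L2 D H"
  shows "(\<Sum>j\<in>T. weighted_form D (m j) F H) = weighted_form D (\<lambda>x. \<Sum>j\<in>T. m j x) F H"
proof -
  have "weighted_form D (\<lambda>x. \<Sum>j\<in>T. m j x) F H = (LINT x|lebesgue_on D. (\<Sum>j\<in>T. m j x * (F x \<bullet> H x)))"
    by (simp add: weighted_form_def sum_distrib_right)
  also have "\<dots> = (\<Sum>j\<in>T. LINT x|lebesgue_on D. m j x * (F x \<bullet> H x))"
    by (intro Bochner_Integration.integral_sum weighted_form_integrable[OF assms(1)] assms(2,3))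
  finally show ?thesis by (simp add: weighted_form_def)
qed

lemma bounded_weight_cmult:
  assumes "bounded_weight D C m" shows "bounded_weight D (\<bar>c\<bar> * C) (\<lambda>x. c * m x)"
  using assms unfolding bounded_weight_def
  by (auto simp: abs_mult intro!: mult_left_mono elim!: eventually_mono)

lemma bounded_weight_abs: "bounded_weight D C m \<Longrightarrow> bounded_weight D C (\<lambda>x. \<bar>m x\<bar>)"
  by (auto simp: bounded_weight_def intro: borel_measurable_abs)

lemma bounded_weight_sum:
  assumes "finite T" "\<And>j. j \<in> T \<Longrightarrow> bounded_weight D (C j) (m j)"
  shows "bounded_weight D (\<Sum>j\<in>T. C j) (\<lambda>x. \<Sum>j\<in>T. m j x)"
  unfolding bounded_weight_def
proof
  show "(\<lambda>x. \<Sum>j\<in>T. m j x) \<in> borel_measurable (lebesgue_on D)"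
    by (rule borel_measurable_sum) (use assms in \<open>simp add: bounded_weight_def\<close>)
  have "AE x in lebesgue_on D. \<forall>j\<in>T. \<bar>m j x\<bar> \<le> C j"
    using assms by (intro AE_finite_allI) (auto simp: bounded_weight_def)
  then show "AE x in lebesgue_on D. \<bar>\<Sum>j\<in>T. m j x\<bar> \<le> (\<Sum>j\<in>T. C j)"
    by eventually_elim (intro order_trans[OF sum_abs] sum_mono, blast)
qed

text \<open>Young's inequality with the weight \<open>\<bar>m\<bar>\<close> kept inside both integrals; bounding it by a constant here
would lose the summability over the parameters.\<close>

lemma weighted_form_Young:
  fixes F H :: "'a::euclidean_space \<Rightarrow> 'b::euclidean_space"
  assumes m: "bounded_weight D C m" and F: "L2 D F" and H: "L2 D H" and e: "0 < e"
  shows "- weighted_form D m F H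
    \<le> weighted_form D (\<lambda>x. \<bar>m x\<bar>) F F / (2 * e) + e / 2 * weighted_form D (\<lambda>x. \<bar>m x\<bar>) H H"
proof -
  note int = weighted_form_integrable[OF m F H] weighted_form_integrable[OF bounded_weight_abs[OF m] F F]
    weighted_form_integrable[OF bounded_weight_abs[OF m] H H]
  have "- (m x * (F x \<bullet> H x)) \<le> \<bar>m x\<bar> * (F x \<bullet> F x) / (2 * e) + e / 2 * (\<bar>m x\<bar> * (H x \<bullet> H x))" for x
  proof -
    have "0 \<le> (norm (F x) - e * norm (H x))\<^sup>2 / (2 * e)" using e by simp
    then have "norm (F x) * norm (H x) \<le> (norm (F x))\<^sup>2 / (2 * e) + e / 2 * (norm (H x))\<^sup>2"
      using e by (simp add: power2_eq_square field_simps)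
    then have "\<bar>m x\<bar> * \<bar>F x \<bullet> H x\<bar> \<le> \<bar>m x\<bar> * ((F x \<bullet> F x) / (2 * e) + e / 2 * (H x \<bullet> H x))"
      using Cauchy_Schwarz_ineq2[of "F x" "H x"]
      by (intro mult_left_mono) (auto simp: power2_norm_eq_inner)
    moreover have "- (m x * (F x \<bullet> H x)) \<le> \<bar>m x\<bar> * \<bar>F x \<bullet> H x\<bar>"
      by (simp flip: abs_mult)
    ultimately show ?thesis by (simp add: algebra_simps)
  qed
  then have "(LINT x|lebesgue_on D. - (m x * (F x \<bullet> H x)))
      \<le> (LINT x|lebesgue_on D. \<bar>m x\<bar> * (F x \<bullet> F x) / (2 * e) + e / 2 * (\<bar>m x\<bar> * (H x \<bullet> H x)))"
    using int by (intro integral_mono) auto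
  then show ?thesis using int by (simp add: weighted_form_def)
qed

text \<open>Both sides sum over the pairs of a set \<open>R\<close> with \<open>m\<close> elements and a further element \<open>j\<close> of \<open>S\<close>; on the
left they are listed by \<open>T = insert j R\<close>.\<close>

lemma sum_remove_element_reindex:
  fixes g :: "nat \<Rightarrow> nat set \<Rightarrow> real"
  assumes S: "finite S"
  shows "(\<Sum>T\<in>{T. T \<subseteq> S \<and> card T = Suc m}. \<Sum>j\<in>T. g j (T - {j}))
    = (\<Sum>R\<in>{R. R \<subseteq> S \<and> card R = m}. \<Sum>j\<in>S - R. g j R)"
proof -
  have fin: "finite {T. T \<subseteq> S \<and> card T = k}" for k
    by (rule finite_subset[of _ "Pow S"]) (use S in auto)
  have fin': "finite T" if "T \<subseteq> S" for T using S that by (rule rev_finite_subset)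
  have "(\<Sum>T\<in>{T. T \<subseteq> S \<and> card T = Suc m}. \<Sum>j\<in>T. g j (T - {j}))
      = (\<Sum>(T, j)\<in>(SIGMA T:{T. T \<subseteq> S \<and> card T = Suc m}. T). g j (T - {j}))"
    by (intro sum.Sigma fin) (auto intro: fin')
  also have "\<dots> = (\<Sum>(R, j)\<in>(SIGMA R:{R. R \<subseteq> S \<and> card R = m}. S - R). g j R)"
    by (rule sum.reindex_bij_witness[where j="\<lambda>(T, j). (T - {j}, j)" and i="\<lambda>(R, j). (insert j R, j)"])
      (auto simp: insert_absorb card_insert_if fin')
  also have "\<dots> = (\<Sum>R\<in>{R. R \<subseteq> S \<and> card R = m}. \<Sum>j\<in>S - R. g j R)"
    by (intro sum.Sigma[symmetric] fin) (use S in auto)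
  finally show ?thesis .
qed

context parametric_equation
begin

text \<open>Here \<open>\<theta>\<close> is the lower bound of the coefficient relative to the reference weight \<open>w\<close>. All subsets of \<open>S\<close>
of one size are estimated together, as explained at the beginning: \<open>step\<close> is the energy estimate
for one subset, \<open>layers\<close> the resulting recursion over the size.\<close>

theorem mixed_field_energy_bound:
  assumes y: "y \<in> param_domain" and S: "finite S" and b: "\<And>j. 0 < b j"
    and w: "bounded_weight D A w" "AE x in lebesgue_on D. 0 \<le> w x"
    and \<theta>: "0 < \<theta>" "AE x in lebesgue_on D. \<theta> * w x \<le> a y x"
    and K: "0 < K" "AE x in lebesgue_on D. (\<Sum>j\<in>S. \<bar>\<psi> j x\<bar> / b j) \<le> 2 * K * w x"
  shows "weighted_form D w (mixed_field y S) (mixed_field y S)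
    \<le> (prod b S * (2 * K / \<theta>) ^ card S)\<^sup>2 * weighted_form D w (u y) (u y)"
proof -
  define s where "s T x = (1 / prod b T) *\<^sub>R mixed_field y T x" for T x
  define N where "N T = weighted_form D w (s T) (s T)" for T
  define p where "p j T = weighted_form D (\<lambda>x. \<bar>\<psi> j x\<bar> / b j) (s T) (s T)" for j T
  have fin: "finite T" if "T \<subseteq> S" for T using S that by (rule rev_finite_subset)
  have s_L2: "L2 D (s T)" if "T \<subseteq> S" for T
    unfolding s_def[abs_def] by (intro L2_cmult G_L2 mixed_field_G y fin that)
  have s_G: "s T \<in> G" if "T \<subseteq> S" for T
    using G_lincomb[OF mixed_field_G[OF y fin[OF that]] mixed_field_G[OF y fin[OF that]], of "1 / prod b T" 0]
    by (simp add: s_def[abs_def])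
  have weight: "bounded_weight D (\<bar>1 / b j\<bar> * C) (\<lambda>x. \<bar>\<psi> j x\<bar> / b j)" for j
    using bounded_weight_cmult[OF bounded_weight_abs[OF \<psi>_weight[of j]], of "1 / b j"] by simp
  have p_nonneg: "0 \<le> p j T" for j T
    unfolding p_def by (rule weighted_form_nonneg) (simp add: less_imp_le[OF b])
  have p_sum: "(\<Sum>j\<in>T. p j R) \<le> 2 * K * N R" if T: "T \<subseteq> S" and R: "R \<subseteq> S" for T R
  proof -
    have "(\<Sum>j\<in>T. p j R) \<le> (\<Sum>j\<in>S. p j R)"
      by (intro sum_mono2 S T p_nonneg)
    also have "\<dots> = weighted_form D (\<lambda>x. \<Sum>j\<in>S. \<bar>\<psi> j x\<bar> / b j) (s R) (s R)"
      unfolding p_def by (rule weighted_form_sum_weight[OF weight s_L2[OF R] s_L2[OF R]])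
    also have "\<dots> \<le> weighted_form D (\<lambda>x. 2 * K * w x) (s R) (s R)"
      by (rule weighted_form_mono[OF bounded_weight_sum[OF S weight] bounded_weight_cmult[OF w(1)] s_L2[OF R] K(2)])
    finally show ?thesis by (simp add: N_def weighted_form_cmult_weight)
  qed
  have step: "N T \<le> 2 * K / \<theta>\<^sup>2 * (\<Sum>j\<in>T. p j (T - {j}))" if T: "T \<subseteq> S" "T \<noteq> {}" for T
  proof -
    \<comment> \<open>The Young parameter for which the second half of the products is absorbed by half of the left side.\<close>
    define e where "e = \<theta> / (2 * K)"
    have e: "0 < e" using \<theta>(1) K(1) by (simp add: e_def)
    have sub: "T - {j} \<subseteq> S" for j using T by auto
    have scaled: "1 / prod b T * weighted_form D (\<psi> j) (mixed_field y (T - {j})) (s T)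
        = weighted_form D (\<lambda>x. 1 / b j * \<psi> j x) (s (T - {j})) (s T)" if j: "j \<in> T" for j
    proof -
      have "prod b T = b j * prod b (T - {j})"
        by (rule prod.remove[OF fin[OF T(1)] j])
      then show ?thesis
        unfolding weighted_form_cmult_weight s_def[of "T - {j}"] weighted_form_cmult by simp
    qed
    have "\<theta> * N T = weighted_form D (\<lambda>x. \<theta> * w x) (s T) (s T)"
      by (simp add: N_def weighted_form_cmult_weight)
    also have "\<dots> \<le> weighted_form D (a y) (s T) (s T)"
      by (rule weighted_form_mono[OF bounded_weight_cmult[OF w(1)] a_weight[OF y] s_L2[OF T(1)] \<theta>(2)])
    also have "\<dots> = 1 / prod b T * weighted_form D (a y) (mixed_field y T) (s T)"
      unfolding s_def[of T] weighted_form_cmult by simp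
    also have "\<dots> = (\<Sum>j\<in>T. - (1 / prod b T * weighted_form D (\<psi> j) (mixed_field y (T - {j})) (s T)))"
      by (simp only: mixed_field_recursion[OF y fin[OF T(1)] T(2) s_G[OF T(1)]]
          sum_distrib_left sum_negf mult_minus_right)
    also have "\<dots> = (\<Sum>j\<in>T. - weighted_form D (\<lambda>x. 1 / b j * \<psi> j x) (s (T - {j})) (s T))"
      by (intro sum.cong refl arg_cong[where f=uminus] scaled)
    also have "\<dots> \<le> (\<Sum>j\<in>T. p j (T - {j}) / (2 * e) + e / 2 * p j T)"
    proof (rule sum_mono)
      fix j
      have "\<bar>b j\<bar> = b j" using b[of j] by simp
      then show "- weighted_form D (\<lambda>x. 1 / b j * \<psi> j x) (s (T - {j})) (s T)
          \<le> p j (T - {j}) / (2 * e) + e / 2 * p j T"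
        using weighted_form_Young[OF bounded_weight_cmult[OF \<psi>_weight, of "1 / b j" j] s_L2[OF sub] s_L2[OF T(1)] e, of j]
        by (simp add: p_def)
    qed
    also have "\<dots> = (\<Sum>j\<in>T. p j (T - {j})) / (2 * e) + e / 2 * (\<Sum>j\<in>T. p j T)"
      by (simp add: sum.distrib sum_divide_distrib sum_distrib_left)
    also have "\<dots> \<le> (\<Sum>j\<in>T. p j (T - {j})) / (2 * e) + e / 2 * (2 * K * N T)"
      using e p_sum[OF T(1) T(1)] by (intro add_left_mono mult_left_mono) auto
    also have "e / 2 * (2 * K * N T) = \<theta> / 2 * N T"
      using K(1) by (simp add: e_def)
    also have "(\<Sum>j\<in>T. p j (T - {j})) / (2 * e) = K / \<theta> * (\<Sum>j\<in>T. p j (T - {j}))"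
      using K(1) \<theta>(1) by (simp add: e_def)
    finally show ?thesis
      using \<theta>(1) by (simp add: power2_eq_square field_simps)
  qed
  define L where "L m = {T. T \<subseteq> S \<and> card T = m}" for m
  have layers: "(\<Sum>T\<in>L m. N T) \<le> ((2 * K / \<theta>)\<^sup>2) ^ m * N {}" for m
  proof (induction m)
    case 0
    have "L 0 = {{}}" by (auto simp: L_def dest: fin)
    then show ?case by simp
  next
    case (Suc m)
    have "(\<Sum>T\<in>L (Suc m). N T) \<le> (\<Sum>T\<in>L (Suc m). 2 * K / \<theta>\<^sup>2 * (\<Sum>j\<in>T. p j (T - {j})))"
      by (intro sum_mono step) (auto simp: L_def)
    also have "\<dots> = 2 * K / \<theta>\<^sup>2 * (\<Sum>R\<in>L m. \<Sum>j\<in>S - R. p j R)"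
      unfolding sum_distrib_left[symmetric] L_def sum_remove_element_reindex[OF S] ..
    also have "\<dots> \<le> 2 * K / \<theta>\<^sup>2 * (\<Sum>R\<in>L m. 2 * K * N R)"
      using K(1) by (intro mult_left_mono sum_mono p_sum) (auto simp: L_def)
    also have "\<dots> = (2 * K / \<theta>)\<^sup>2 * (\<Sum>R\<in>L m. N R)"
      by (simp add: sum_distrib_left[symmetric] power2_eq_square)
    also have "\<dots> \<le> (2 * K / \<theta>)\<^sup>2 * (((2 * K / \<theta>)\<^sup>2) ^ m * N {})"
      by (intro mult_left_mono Suc.IH) simp
    finally show ?case by (simp add: mult.assoc)
  qed
  have "L (card S) = {S}"
    using S card_subset_eq[OF S] by (auto simp: L_def)
  then have "N S \<le> ((2 * K / \<theta>)\<^sup>2) ^ card S * N {}"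
    using layers[of "card S"] by simp
  moreover have "((2 * K / \<theta>)\<^sup>2) ^ card S = ((2 * K / \<theta>) ^ card S)\<^sup>2"
    by (simp only: power_mult[symmetric] mult.commute)
  moreover have "N {} = weighted_form D w (u y) (u y)"
    by (simp add: N_def s_def[abs_def] mixed_field_empty y)
  moreover have "N S = (1 / prod b S)\<^sup>2 * weighted_form D w (mixed_field y S) (mixed_field y S)"
    unfolding N_def s_def[abs_def] by (rule weighted_form_cmult_both)
  ultimately have "(1 / prod b S)\<^sup>2 * weighted_form D w (mixed_field y S) (mixed_field y S)
      \<le> ((2 * K / \<theta>) ^ card S)\<^sup>2 * weighted_form D w (u y) (u y)"
    by (simp only:)
  moreover have "0 < (prod b S)\<^sup>2" using b by (simp add: prod_zero_iff S less_imp_neq[symmetric])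
  ultimately show ?thesis
    unfolding power_mult_distrib[of "prod b S"] power_one_over
    by (simp only: pos_divide_le_eq mult_ac times_divide_eq_left times_divide_eq_right mult_1_left mult_1_right)
qed

end

section \<open>Gradient fields, the dual norm and the diffusion coefficient\<close>

context bounded_open_set
begin

definition gradient_fields :: "('a \<Rightarrow> 'a) set" where
  "gradient_fields = {g. \<exists>v. H01_gradient D v g}"

lemma H01_gradient_zero: "H01_gradient D (\<lambda>x. 0) (\<lambda>x. 0)"
proof -
  have "Ck k (\<lambda>x::'a. 0)" for k by (induction k) auto
  then have "test_function D (\<lambda>x. 0)" by (auto intro: test_functionI[of _ "{}"])
  moreover have "classical_gradient (\<lambda>x::'a. 0) = (\<lambda>x. 0)"
    by (simp add: classical_gradient_def fun_eq_iff)
  ultimately show ?thesis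
    unfolding H01_gradient_def
    by (intro conjI exI[of _ "\<lambda>n x. 0"]) (simp_all add: L2_zero L2_norm_zero weak_gradient_def)
qed

definition potential :: "('a \<Rightarrow> 'a) \<Rightarrow> 'a \<Rightarrow> real" where
  "potential g = (SOME v. H01_gradient D v g)"

lemma H01_gradient_potential: "g \<in> gradient_fields \<Longrightarrow> H01_gradient D (potential g) g"
  unfolding potential_def gradient_fields_def mem_Collect_eq
  by (rule someI_ex[of "\<lambda>v. H01_gradient D v g"])

lemma closed_field_space_gradient_fields: "closed_field_space D gradient_fields"
proof
  show "gradient_fields \<noteq> {}"
    using H01_gradient_zero by (auto simp: gradient_fields_def)
  show "L2 D g" if "g \<in> gradient_fields" for g
    using that by (auto simp: gradient_fields_def dest: H01_gradient_L2)
  show "(\<lambda>x. c *\<^sub>R g x + d *\<^sub>R h x) \<in> gradient_fields"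
    if "g \<in> gradient_fields" "h \<in> gradient_fields" for g h c d
    using that unfolding gradient_fields_def by (blast intro: H01_gradient_lincomb)
  show "\<exists>h\<in>gradient_fields. (\<lambda>n. L2_norm D (\<lambda>x. g n x - h x)) \<longlonglongrightarrow> 0"
    if g: "\<And>n. g n \<in> gradient_fields" and Cauchy: "L2_Cauchy D g" for g
  proof -
    have "\<forall>n. \<exists>v. H01_gradient D v (g n)" using g by (simp add: gradient_fields_def)
    from choice[OF this] obtain v where v: "\<And>n. H01_gradient D (v n) (g n)" by blast
    obtain v' g' where "H01_gradient D v' g'" "(\<lambda>n. L2_norm D (\<lambda>x. g n x - g' x)) \<longlonglongrightarrow> 0"
      by (rule H01_complete[OF v Cauchy])
    then show ?thesis unfolding gradient_fields_def by blast
  qed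
qed

text \<open>Gradient representatives may be exchanged on null sets.\<close>

lemma H01_gradient_cong_AE:
  assumes H: "H01_gradient D v g" and h: "L2 D h" and eq: "AE x in lebesgue_on D. g x = h x"
  shows "H01_gradient D v h"
proof -
  note L2 = H01_gradient_L2[OF H]
  obtain \<phi> where \<phi>: "\<And>n. test_function D (\<phi> n)"
    and \<phi>_lim: "(\<lambda>n. L2_norm D (\<lambda>x. \<phi> n x - v x)) \<longlonglongrightarrow> 0"
      "(\<lambda>n. L2_norm D (\<lambda>x. classical_gradient (\<phi> n) x - g x)) \<longlonglongrightarrow> 0"
    using H unfolding H01_gradient_def by blast
  have "(LINT x|lebesgue_on D. (h x \<bullet> i) * \<eta> x) = (LINT x|lebesgue_on D. (g x \<bullet> i) * \<eta> x)"
    if "test_function D \<eta>" "i \<in> Basis" for \<eta> i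
  proof (rule integral_cong_AE)
    note [measurable] = L2_measurable[OF h] L2_measurable[OF L2(2)] L2_measurable[OF test_function_L2[OF that(1)]]
    show "(\<lambda>x. (h x \<bullet> i) * \<eta> x) \<in> borel_measurable (lebesgue_on D)"
      "(\<lambda>x. (g x \<bullet> i) * \<eta> x) \<in> borel_measurable (lebesgue_on D)" by measurable
    show "AE x in lebesgue_on D. (h x \<bullet> i) * \<eta> x = (g x \<bullet> i) * \<eta> x"
      using eq by eventually_elim simp
  qed
  then have "weak_gradient D v h"
    using H by (simp add: H01_gradient_def weak_gradient_def)
  moreover have "L2_norm D (\<lambda>x. classical_gradient (\<phi> n) x - h x)
      = L2_norm D (\<lambda>x. classical_gradient (\<phi> n) x - g x)" for n
    using eq by (intro L2_norm_cong_AE L2_diff classical_gradient_L2 \<phi> h L2) (auto elim: eventually_mono)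
  ultimately show ?thesis
    unfolding H01_gradient_def using L2(1) h \<phi> \<phi>_lim
    by (intro conjI exI[of _ \<phi>]) simp_all
qed

lemma V_norm_cmult:
  assumes "v \<in> H01 D" shows "V_norm D (\<lambda>x. c * v x) = \<bar>c\<bar> * V_norm D v"
proof -
  have "H01_gradient D (\<lambda>x. c * v x) (\<lambda>x. c *\<^sub>R grad D v x)"
    using H01_gradient_lincomb[OF grad_H01_gradient[OF assms] grad_H01_gradient[OF assms], of c 0] by simp
  then show ?thesis
    by (simp add: V_norm_eq L2_norm_cmult V_norm_eq[OF grad_H01_gradient[OF assms]])
qed

lemma H01_cmult: "v \<in> H01 D \<Longrightarrow> (\<lambda>x. c * v x) \<in> H01 D"
  using H01_gradient_lincomb[OF grad_H01_gradient grad_H01_gradient, of v v c 0]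
  by (auto dest: H01_gradient_in_H01)

lemma V_norm_nonneg: "0 \<le> V_norm D v"
  by (simp add: V_norm_def L2_norm_nonneg)

lemma V_dual_bounded:
  assumes "f \<in> V_dual D"
  obtains B where "\<And>v. v \<in> H01 D \<Longrightarrow> \<bar>f v\<bar> \<le> B * V_norm D v"
  using assms unfolding V_dual_def by blast

lemma V_dual_unit_ball_bdd:
  assumes "f \<in> V_dual D"
  shows "bdd_above ((\<lambda>v. \<bar>f v\<bar>) ` {v \<in> H01 D. V_norm D v \<le> 1})"
proof -
  obtain B where B: "\<And>v. v \<in> H01 D \<Longrightarrow> \<bar>f v\<bar> \<le> B * V_norm D v"
    using assms by (rule V_dual_bounded) blast
  show ?thesis
  proof (intro bdd_aboveI2)
    fix v assume v: "v \<in> {v \<in> H01 D. V_norm D v \<le> 1}"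
    then have "\<bar>f v\<bar> \<le> B * V_norm D v" by (intro B) simp
    also have "\<dots> \<le> \<bar>B\<bar> * 1"
      using v by (intro mult_mono) (auto simp: V_norm_nonneg)
    finally show "\<bar>f v\<bar> \<le> \<bar>B\<bar>" by simp
  qed
qed

lemma V_dual_norm_upper:
  assumes "f \<in> V_dual D" "v \<in> H01 D" "V_norm D v \<le> 1"
  shows "\<bar>f v\<bar> \<le> V_dual_norm D f"
  unfolding V_dual_norm_def
  by (rule cSUP_upper[OF _ V_dual_unit_ball_bdd[OF assms(1)]]) (use assms in simp)

text \<open>The dual norm is a supremum over the unit ball only; scaling extends it, except for functions of
norm 0, on which a bounded functional vanishes.\<close>

lemma V_dual_norm_bound:
  assumes f: "f \<in> V_dual D" and v: "v \<in> H01 D"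
  shows "\<bar>f v\<bar> \<le> V_dual_norm D f * V_norm D v"
proof (cases "V_norm D v = 0")
  case True
  obtain B where "\<And>v. v \<in> H01 D \<Longrightarrow> \<bar>f v\<bar> \<le> B * V_norm D v"
    using f by (rule V_dual_bounded) blast
  then show ?thesis using v True by force
next
  case False
  define c where "c = 1 / V_norm D v"
  have n: "0 < V_norm D v" using False V_norm_nonneg[of v] by simp
  have "V_norm D (\<lambda>x. c * v x) = 1"
    unfolding V_norm_cmult[OF v] using n by (simp add: c_def)
  then have "\<bar>f (\<lambda>x. c * v x)\<bar> \<le> V_dual_norm D f"
    by (intro V_dual_norm_upper f H01_cmult v) simp
  moreover have "f (\<lambda>x. c * v x) = c * f v"
    using f v by (simp add: V_dual_def)
  ultimately show ?thesis
    using n by (simp add: c_def abs_mult pos_divide_le_eq)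
qed

lemma V_dual_norm_nonneg:
  assumes "f \<in> V_dual D" shows "0 \<le> V_dual_norm D f"
proof -
  have "\<bar>f (\<lambda>x. 0)\<bar> \<le> V_dual_norm D f"
    using H01_gradient_zero
    by (intro V_dual_norm_upper assms) (simp_all add: H01_gradient_in_H01 V_norm_eq L2_norm_zero)
  then show ?thesis by linarith
qed

end

lemma param_domain_abs_le: "y \<in> param_domain \<Longrightarrow> \<bar>y j\<bar> \<le> 1/2"
  unfolding param_domain_def abs_le_iff by (drule CollectD, drule spec[of _ j]) linarith

text \<open>At an endpoint of the parameter interval only increments of one sign are admissible, but there
are always arbitrarily small ones, so limits along them are unique.\<close>

lemma at_0_within_admissible_increments_nontrivial:
  assumes "y \<in> param_domain"
  shows "at 0 within {h. y(j := y j + h) \<in> param_domain} \<noteq> bot"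
proof -
  let ?A = "{h. y(j := y j + h) \<in> param_domain}"
  have yj: "-1/2 \<le> y j" "y j \<le> 1/2"
    using assms by (auto simp: param_domain_def)
  have A: "h \<in> ?A" if "-1/2 \<le> y j + h" "y j + h \<le> 1/2" for h
    using assms that by (auto simp: param_domain_def)
  have "0 \<in> closure (?A - {0})"
  proof (cases "y j \<le> 0")
    case True
    have "{0<..<1/2} \<subseteq> ?A - {0}" using True yj by (intro subsetI DiffI A) auto
    then have "closure {0<..<1/2::real} \<subseteq> closure (?A - {0})" by (rule closure_mono)
    then show ?thesis by (auto simp: closure_greaterThanLessThan)
  next
    case False
    have "{-1/2<..<0} \<subseteq> ?A - {0}" using False yj by (intro subsetI DiffI A) auto
    then have "closure {-1/2<..<0::real} \<subseteq> closure (?A - {0})" by (rule closure_mono)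
    then show ?thesis by (auto simp: closure_greaterThanLessThan)
  qed
  then show ?thesis by (simp add: at_within_eq_bot_iff)
qed

locale affine_diffusion = bounded_open_set D
  for D :: "'a::euclidean_space set" +
  fixes a0 :: "'a \<Rightarrow> real" and \<psi> :: "nat \<Rightarrow> 'a \<Rightarrow> real" and a0_min a0_max \<kappa>_bar :: real
  assumes a0_meas: "a0 \<in> borel_measurable (lebesgue_on D)"
    and psi_meas: "\<And>j. \<psi> j \<in> borel_measurable (lebesgue_on D)"
    and a0_min_pos: "0 < a0_min"
    and a0_bounds: "AE x in lebesgue_on D. a0_min \<le> a0 x \<and> a0 x \<le> a0_max"
    and kappa_bar_range: "0 < \<kappa>_bar" "\<kappa>_bar < 1"
    and kappa_bar: "Linf_norm D (\<lambda>x. \<Sum>j. ennreal (\<bar>\<psi> j x\<bar> / (2 * a0 x))) \<le> ennreal \<kappa>_bar"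
begin

text \<open>Almost everywhere the series of the coefficient converges absolutely, relative to \<open>a0\<close>; all
bounds on the coefficient are pointwise consequences.\<close>

lemma AE_psi_summable:
  "AE x in lebesgue_on D. a0_min \<le> a0 x \<and> a0 x \<le> \<bar>a0_max\<bar> \<and> summable (\<lambda>j. \<bar>\<psi> j x\<bar>) \<and> (\<Sum>j. \<bar>\<psi> j x\<bar>) \<le> 2 * \<kappa>_bar * a0 x"
  using a0_bounds esssup_AE[of "\<lambda>x. \<Sum>j. ennreal (\<bar>\<psi> j x\<bar> / (2 * a0 x))" "lebesgue_on D"]
proof eventually_elim
  case (elim x)
  then have a0: "0 < a0 x" using a0_min_pos by linarith
  have le: "(\<Sum>j. ennreal (\<bar>\<psi> j x\<bar> / (2 * a0 x))) \<le> ennreal \<kappa>_bar"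
    using elim(2) kappa_bar unfolding Linf_norm_def by (rule order_trans)
  then have s: "summable (\<lambda>j. \<bar>\<psi> j x\<bar> / (2 * a0 x))"
    using a0 by (intro summable_suminf_not_top) (auto simp: top_unique)
  have "(\<Sum>j. \<bar>\<psi> j x\<bar> / (2 * a0 x)) \<le> \<kappa>_bar"
    using le a0 s kappa_bar_range by (simp add: suminf_ennreal2 ennreal_le_iff)
  moreover have s': "summable (\<lambda>j. \<bar>\<psi> j x\<bar>)"
    using summable_mult[OF s, of "2 * a0 x"] a0 by simp
  ultimately have "(\<Sum>j. \<bar>\<psi> j x\<bar>) \<le> 2 * \<kappa>_bar * a0 x"
    using a0 by (simp only: suminf_divide[OF s']) (simp add: pos_divide_le_eq mult_ac)
  with s' elim(1) show ?case by auto
qed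

lemma AE_psi_le: "AE x in lebesgue_on D. \<bar>\<psi> j x\<bar> \<le> 2 * \<bar>a0_max\<bar>"
  using AE_psi_summable
proof eventually_elim
  case (elim x)
  have "\<bar>\<psi> j x\<bar> = (\<Sum>i\<in>{j}. \<bar>\<psi> i x\<bar>)" by simp
  also have "\<dots> \<le> (\<Sum>j. \<bar>\<psi> j x\<bar>)"
    using elim by (intro sum_le_suminf) auto
  also have "\<dots> \<le> 2 * \<kappa>_bar * a0 x" using elim by simp
  also have "\<dots> \<le> 2 * 1 * \<bar>a0_max\<bar>"
    using elim kappa_bar_range a0_min_pos by (intro mult_mono) auto
  finally show ?case by simp
qed

lemma AE_diffusion_bounds:
  assumes y: "y \<in> param_domain"
  shows "AE x in lebesgue_on D. (1 - \<kappa>_bar) * a0 x \<le> diffusion a0 \<psi> y x \<and>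
    diffusion a0 \<psi> y x \<le> (1 + \<kappa>_bar) * a0 x"
  using AE_psi_summable
proof eventually_elim
  case (elim x)
  have le: "\<bar>y j * \<psi> j x\<bar> \<le> 1/2 * \<bar>\<psi> j x\<bar>" for j
  proof -
    have "\<bar>y j\<bar> \<le> 1/2" by (rule param_domain_abs_le[OF y])
    then show ?thesis unfolding abs_mult by (rule mult_right_mono) simp
  qed
  have s: "summable (\<lambda>j. 1/2 * \<bar>\<psi> j x\<bar>)" using elim by (intro summable_mult) simp
  have s': "summable (\<lambda>j. \<bar>y j * \<psi> j x\<bar>)"
    by (rule summable_comparison_test'[OF s, of 0]) (simp only: real_norm_def abs_abs le)
  have "\<bar>\<Sum>j. y j * \<psi> j x\<bar> \<le> (\<Sum>j. \<bar>y j * \<psi> j x\<bar>)"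
    using summable_norm[of "\<lambda>j. y j * \<psi> j x"] s' by simp
  also have "\<dots> \<le> (\<Sum>j. 1/2 * \<bar>\<psi> j x\<bar>)" by (rule suminf_le[OF le s' s])
  also have "\<dots> = 1/2 * (\<Sum>j. \<bar>\<psi> j x\<bar>)" using elim by (intro suminf_mult) simp
  also have "\<dots> \<le> \<kappa>_bar * a0 x" using elim by simp
  finally show ?case by (simp add: diffusion_def abs_le_iff algebra_simps)
qed

lemma diffusion_measurable: "diffusion a0 \<psi> y \<in> borel_measurable (lebesgue_on D)"
proof -
  note [measurable] = a0_meas psi_meas
  show ?thesis unfolding diffusion_def[abs_def] by measurable
qed

lemma diffusion_weight:
  assumes "y \<in> param_domain" shows "bounded_weight D ((1 + \<kappa>_bar) * \<bar>a0_max\<bar>) (diffusion a0 \<psi> y)"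
  unfolding bounded_weight_def
proof (intro conjI diffusion_measurable)
  show "AE x in lebesgue_on D. \<bar>diffusion a0 \<psi> y x\<bar> \<le> (1 + \<kappa>_bar) * \<bar>a0_max\<bar>"
    using AE_diffusion_bounds[OF assms] AE_psi_summable
  proof eventually_elim
    case (elim x)
    have "(1 + \<kappa>_bar) * a0 x \<le> (1 + \<kappa>_bar) * \<bar>a0_max\<bar>"
      using elim kappa_bar_range by (intro mult_left_mono) auto
    moreover have "0 \<le> (1 - \<kappa>_bar) * a0 x"
      using elim kappa_bar_range a0_min_pos by (intro mult_nonneg_nonneg) auto
    ultimately show ?case using elim by linarith
  qed
qed

lemma diffusion_coercive:
  assumes "y \<in> param_domain"
  shows "AE x in lebesgue_on D. (1 - \<kappa>_bar) * a0_min \<le> diffusion a0 \<psi> y x"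
  using AE_diffusion_bounds[OF assms] AE_psi_summable
proof eventually_elim
  case (elim x)
  have "(1 - \<kappa>_bar) * a0_min \<le> (1 - \<kappa>_bar) * a0 x"
    using elim kappa_bar_range by (intro mult_left_mono) auto
  with elim show ?case by linarith
qed

lemma diffusion_affine:
  assumes y: "y \<in> param_domain"
  shows "AE x in lebesgue_on D. diffusion a0 \<psi> (y(j := y j + h)) x = diffusion a0 \<psi> y x + h * \<psi> j x"
  using AE_psi_summable
proof eventually_elim
  case (elim x)
  have le: "norm (y i * \<psi> i x) \<le> \<bar>\<psi> i x\<bar>" for i
  proof -
    have "\<bar>y i\<bar> \<le> 1" using param_domain_abs_le[OF y, of i] by simp
    then have "\<bar>y i\<bar> * \<bar>\<psi> i x\<bar> \<le> 1 * \<bar>\<psi> i x\<bar>" by (rule mult_right_mono) simp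
    then show ?thesis by (simp add: abs_mult)
  qed
  have "summable (\<lambda>i. \<bar>\<psi> i x\<bar>)" using elim by simp
  then have "summable (\<lambda>i. y i * \<psi> i x)"
    by (rule summable_comparison_test'[where N=0]) (rule le)
  then have "(\<lambda>i. y i * \<psi> i x + (if i = j then h * \<psi> j x else 0)) sums ((\<Sum>i. y i * \<psi> i x) + h * \<psi> j x)"
    by (intro sums_add summable_sums sums_single)
  moreover have "(\<lambda>i. y i * \<psi> i x + (if i = j then h * \<psi> j x else 0)) = (\<lambda>i. (y(j := y j + h)) i * \<psi> i x)"
    by (auto simp: algebra_simps)
  ultimately show ?case by (simp add: diffusion_def sums_unique[symmetric])
qed

lemma a0_weight: "bounded_weight D \<bar>a0_max\<bar> a0"
  unfolding bounded_weight_def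
proof (intro conjI a0_meas)
  show "AE x in lebesgue_on D. \<bar>a0 x\<bar> \<le> \<bar>a0_max\<bar>"
    using AE_psi_summable by eventually_elim (use a0_min_pos in auto)
qed

end

section \<open>Mixed derivatives of the weak solution\<close>

text \<open>The weak solutions for all parameters, for one fixed load \<open>f\<close>.\<close>

locale diffusion_solution = affine_diffusion D a0 \<psi> a0_min a0_max \<kappa>_bar
  for D :: "'a::euclidean_space set" and a0 :: "'a \<Rightarrow> real" and \<psi> :: "nat \<Rightarrow> 'a \<Rightarrow> real"
    and a0_min a0_max \<kappa>_bar :: real +
  fixes f :: "('a \<Rightarrow> real) \<Rightarrow> real" and u :: "(nat \<Rightarrow> real) \<Rightarrow> 'a \<Rightarrow> real"
  assumes f: "f \<in> V_dual D"
    and solution: "\<And>y. y \<in> param_domain \<Longrightarrow> weak_solution D (diffusion a0 \<psi> y) f (u y)"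
begin

lemma u_H01: "y \<in> param_domain \<Longrightarrow> u y \<in> H01 D"
  using solution by (simp add: weak_solution_def)

text \<open>The functional \<open>f\<close> acts on functions, whereas the parametric theory is phrased for their gradients.\<close>

definition load :: "('a \<Rightarrow> 'a) \<Rightarrow> real" where
  "load g = f (potential g)"

lemma weak_solution_load:
  assumes y: "y \<in> param_domain" and g: "g \<in> gradient_fields"
  shows "weighted_form D (diffusion a0 \<psi> y) (grad D (u y)) g = load g"
proof -
  define v where "v = potential g"
  have v: "H01_gradient D v g"
    unfolding v_def by (rule H01_gradient_potential[OF g])
  note v_H01 = H01_gradient_in_H01[OF v]
  have "weighted_form D (diffusion a0 \<psi> y) (grad D (u y)) g
      = weighted_form D (diffusion a0 \<psi> y) (grad D (u y)) (grad D v)"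
    unfolding weighted_form_def
  proof (rule integral_cong_AE)
    note [measurable] = diffusion_measurable L2_measurable[OF H01_gradient_L2(2)[OF v]]
      L2_measurable[OF H01_gradient_L2(2)[OF grad_H01_gradient[OF v_H01]]]
      L2_measurable[OF H01_gradient_L2(2)[OF grad_H01_gradient[OF u_H01[OF y]]]]
    show "(\<lambda>x. diffusion a0 \<psi> y x * (grad D (u y) x \<bullet> g x)) \<in> borel_measurable (lebesgue_on D)"
      "(\<lambda>x. diffusion a0 \<psi> y x * (grad D (u y) x \<bullet> grad D v x)) \<in> borel_measurable (lebesgue_on D)"
      by measurable
    show "AE x in lebesgue_on D. diffusion a0 \<psi> y x * (grad D (u y) x \<bullet> g x)
        = diffusion a0 \<psi> y x * (grad D (u y) x \<bullet> grad D v x)"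
      using grad_AE[OF v] by eventually_elim simp
  qed
  also have "\<dots> = f v"
    using solution[OF y] v_H01 by (simp add: weak_solution_def weighted_form_def)
  finally show ?thesis by (simp add: load_def v_def)
qed

sublocale parametric_equation D gradient_fields "diffusion a0 \<psi>" \<psi>
  "(1 - \<kappa>_bar) * a0_min" "(1 + \<kappa>_bar) * \<bar>a0_max\<bar>" "2 * \<bar>a0_max\<bar>" load "\<lambda>y. grad D (u y)"
proof (intro parametric_equation.intro parametric_equation_axioms.intro closed_field_space_gradient_fields)
  show "bounded_weight D (2 * \<bar>a0_max\<bar>) (\<psi> j)" for j
    using psi_meas AE_psi_le by (simp add: bounded_weight_def)
  show "grad D (u y) \<in> gradient_fields" if "y \<in> param_domain" for y
    using grad_H01_gradient[OF u_H01[OF that]] by (auto simp: gradient_fields_def)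
qed (use kappa_bar_range a0_min_pos in
    \<open>simp_all add: diffusion_weight diffusion_coercive diffusion_affine weak_solution_load\<close>)

text \<open>The derivative for \<open>S = {}\<close> has to be \<open>u\<close> itself, since derivatives of order 0 are compared with \<open>u\<close> and
not only with its gradient.\<close>

definition mixed_derivative :: "nat set \<Rightarrow> (nat \<Rightarrow> real) \<Rightarrow> 'a \<Rightarrow> real" where
  "mixed_derivative S y = (if S = {} then u y else potential (mixed_field y S))"

lemma H01_gradient_mixed_derivative:
  assumes "y \<in> param_domain" "finite S"
  shows "H01_gradient D (mixed_derivative S y) (mixed_field y S)"
proof (cases "S = {}")
  case True
  then show ?thesis
    using assms grad_H01_gradient[OF u_H01] by (simp add: mixed_derivative_def mixed_field_empty)
next
  case False
  then show ?thesis
    using H01_gradient_potential[OF mixed_field_G[OF assms]] by (simp add: mixed_derivative_def)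
qed

lemma V_norm_difference_quotient:
  assumes y: "y \<in> param_domain" and y': "y(j := y j + h) \<in> param_domain"
    and v: "\<And>y. y \<in> param_domain \<Longrightarrow> H01_gradient D (v y) (mixed_field y S)"
    and w: "H01_gradient D w g"
  shows "V_norm D (\<lambda>x. (v (y(j := y j + h)) x - v y x) / h - w x)
    = L2_norm D (\<lambda>x. 1 *\<^sub>R ((1/h) *\<^sub>R mixed_field (y(j := y j + h)) S x + (-1/h) *\<^sub>R mixed_field y S x) + (-1) *\<^sub>R g x)"
proof -
  have "H01_gradient D (\<lambda>x. 1 * ((1/h) * v (y(j := y j + h)) x + (-1/h) * v y x) + (-1) * w x)
      (\<lambda>x. 1 *\<^sub>R ((1/h) *\<^sub>R mixed_field (y(j := y j + h)) S x + (-1/h) *\<^sub>R mixed_field y S x) + (-1) *\<^sub>R g x)"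
    by (intro H01_gradient_lincomb v w y y')
  moreover have "(\<lambda>x. 1 * ((1/h) * v (y(j := y j + h)) x + (-1/h) * v y x) + (-1) * w x)
      = (\<lambda>x. (v (y(j := y j + h)) x - v y x) / h - w x)"
    by (simp add: diff_divide_distrib)
  ultimately show ?thesis by (simp only: V_norm_eq)
qed

lemma has_partial_derivative_mixed:
  assumes y: "y \<in> param_domain" and S: "finite S" "j \<notin> S"
    and v: "\<And>y. y \<in> param_domain \<Longrightarrow> H01_gradient D (v y) (mixed_field y S)"
    and w: "H01_gradient D w (mixed_field y (insert j S))"
  shows "has_partial_derivative D j v y w"
  unfolding has_partial_derivative_def
proof
  show "w \<in> H01 D" using w by (rule H01_gradient_in_H01)
  have "V_norm D (\<lambda>x. (v (y(j := y j + h)) x - v y x) / h - w x) = L2_norm D (quotient_error y j S h)"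
    if "y(j := y j + h) \<in> param_domain" for h
    unfolding quotient_error_def by (rule V_norm_difference_quotient[OF y that v w])
  then have "\<forall>\<^sub>F h in at 0 within {h. y(j := y j + h) \<in> param_domain}.
      L2_norm D (quotient_error y j S h) = V_norm D (\<lambda>x. (v (y(j := y j + h)) x - v y x) / h - w x)"
    unfolding eventually_at_filter by (intro always_eventually) simp
  then show "((\<lambda>h. V_norm D (\<lambda>x. (v (y(j := y j + h)) x - v y x) / h - w x)) \<longlongrightarrow> 0)
      (at 0 within {h. y(j := y j + h) \<in> param_domain})"
    by (rule Lim_transform_eventually[OF quotient_error_tendsto_0[OF y S]])
qed

text \<open>Any partial derivative has the mixed field as a gradient: both are limits of the same difference
quotients.\<close>

lemma partial_derivative_unique:
  assumes y: "y \<in> param_domain" and S: "finite S" "j \<notin> S"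
    and v: "\<And>y. y \<in> param_domain \<Longrightarrow> H01_gradient D (v y) (mixed_field y S)"
    and w: "has_partial_derivative D j v y w"
  shows "H01_gradient D w (mixed_field y (insert j S))"
proof -
  let ?F = "at 0 within {h. y(j := y j + h) \<in> param_domain}"
  let ?q = "\<lambda>h x. (1/h) *\<^sub>R mixed_field (y(j := y j + h)) S x + (-1/h) *\<^sub>R mixed_field y S x"
  let ?m = "mixed_field y (insert j S)"
  have w_grad: "H01_gradient D w (grad D w)"
    using w by (simp add: has_partial_derivative_def grad_H01_gradient)
  have m_L2: "L2 D ?m" using S by (intro G_L2 mixed_field_G y) simp
  have g_L2: "L2 D (grad D w)" by (rule H01_gradient_L2[OF w_grad])
  let ?B = "\<lambda>h. V_norm D (\<lambda>x. (v (y(j := y j + h)) x - v y x) / h - w x) + L2_norm D (quotient_error y j S h)"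
  have "(?B \<longlongrightarrow> 0 + 0) ?F"
    using w unfolding has_partial_derivative_def
    by (intro tendsto_add quotient_error_tendsto_0[OF y S]) simp
  then have B_lim: "(?B \<longlongrightarrow> 0) ?F" by simp
  have "L2_norm D (\<lambda>x. grad D w x - ?m x) \<le> ?B h" if y': "y(j := y j + h) \<in> param_domain" for h
  proof -
    have q: "L2 D (?q h)"
      using S by (intro L2_add L2_cmult G_L2 mixed_field_G y y')
    have "V_norm D (\<lambda>x. (v (y(j := y j + h)) x - v y x) / h - w x) = L2_norm D (\<lambda>x. ?q h x - grad D w x)"
      using V_norm_difference_quotient[where v=v, OF y y' v w_grad] by simp
    moreover have "L2_norm D (quotient_error y j S h) = L2_norm D (\<lambda>x. ?q h x - ?m x)"
      by (simp add: quotient_error_def)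
    ultimately show ?thesis
      using L2_norm_triangle_diff[OF g_L2 q m_L2] by (simp add: L2_norm_minus_commute[of D "grad D w"])
  qed
  then have "\<forall>\<^sub>F h in ?F. L2_norm D (\<lambda>x. grad D w x - ?m x) \<le> ?B h"
    unfolding eventually_at_filter by (intro always_eventually) simp
  then have "L2_norm D (\<lambda>x. grad D w x - ?m x) \<le> 0"
    by (rule tendsto_lowerbound[OF B_lim _ at_0_within_admissible_increments_nontrivial[OF y]])
  then have "L2_norm D (\<lambda>x. grad D w x - ?m x) = 0"
    using L2_norm_nonneg[of D "\<lambda>x. grad D w x - ?m x"] by linarith
  from L2_norm_eq_0[OF L2_diff[OF g_L2 m_L2] this]
  have "AE x in lebesgue_on D. grad D w x = ?m x" by eventually_elim simp
  then show ?thesis by (rule H01_gradient_cong_AE[OF w_grad m_L2])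
qed

text \<open>The mixed derivative depends on the set of the directions only, so the same family serves for
every order of differentiation.\<close>

lemma iterated_partials_mixed_derivative:
  "distinct js \<Longrightarrow> iterated_partials D js u (mixed_derivative (set js))"
proof (induction js)
  case Nil
  then show ?case by (simp add: mixed_derivative_def u_H01)
next
  case (Cons j js)
  have "has_partial_derivative D j (mixed_derivative (set js)) y (mixed_derivative (set (j # js)) y)"
    if y: "y \<in> param_domain" for y
    using Cons.prems H01_gradient_mixed_derivative[OF y, of "set (j # js)"]
    by (intro has_partial_derivative_mixed[OF y, of "set js"] H01_gradient_mixed_derivative) simp_all
  with Cons show ?case by auto
qed

text \<open>The intermediate derivatives in the definition of \<open>iterated_partials\<close> are arbitrary; the claim holds
for each of them, from the innermost one outwards.\<close>

lemma iterated_partials_gradient: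
  assumes "iterated_partials D js u w" "distinct js" "y \<in> param_domain"
  shows "H01_gradient D (w y) (mixed_field y (set js))"
  using assms
proof (induction js arbitrary: w y)
  case Nil
  then have w: "w y \<in> H01 D" "AE x in lebesgue_on D. w y x = u y x" by auto
  note u = grad_H01_gradient[OF u_H01[OF Nil.prems(3)]]
  have "H01_gradient D (w y) (grad D (u y))"
    by (rule H01_gradient_cong_AE[OF grad_H01_gradient[OF w(1)] H01_gradient_L2(2)[OF u]
          H01_gradient_unique[OF grad_H01_gradient[OF w(1)] u w(2)]])
  then show ?case by (simp add: mixed_field_empty Nil.prems)
next
  case (Cons j js)
  then obtain v where v: "iterated_partials D js u v"
    "\<And>y. y \<in> param_domain \<Longrightarrow> has_partial_derivative D j v y (w y)" by auto
  have "H01_gradient D (w y) (mixed_field y (insert j (set js)))"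
    using Cons.prems Cons.IH[OF v(1)] v(2)
    by (intro partial_derivative_unique[of y "set js" j v]) auto
  then show ?case by simp
qed

text \<open>Test the equation with the solution. Since the coefficient is at least \<open>(1 - \<kappa>_bar) * a0\<close>, the energy
is at most \<open>V_dual_norm D f / (1 - \<kappa>_bar)\<close> times the norm, and since \<open>a0\<close> is at least \<open>a0_min\<close>, the norm
is controlled by the root of the energy.\<close>

lemma solution_energy_bound:
  assumes y: "y \<in> param_domain"
  shows "weighted_form D a0 (grad D (u y)) (grad D (u y))
    \<le> a0_min * (V_dual_norm D f / ((1 - \<kappa>_bar) * a0_min))\<^sup>2"
proof -
  define N n F \<theta> where "N = weighted_form D a0 (grad D (u y)) (grad D (u y))" and "n = V_norm D (u y)"
    and "F = V_dual_norm D f" and "\<theta> = 1 - \<kappa>_bar"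
  note u_grad = grad_H01_gradient[OF u_H01[OF y]]
  note L2 = H01_gradient_L2(2)[OF u_grad]
  have \<theta>: "0 < \<theta>" using kappa_bar_range by (simp add: \<theta>_def)
  have n: "0 \<le> n" "n = L2_norm D (grad D (u y))" by (simp_all add: n_def V_norm_def L2_norm_nonneg)
  have F: "0 \<le> F" unfolding F_def by (rule V_dual_norm_nonneg[OF f])
  have lower: "a0_min * n\<^sup>2 \<le> N"
    unfolding N_def n(2) by (rule weighted_form_coercive[OF a0_weight L2])
      (use a0_bounds in \<open>auto elim: eventually_mono\<close>)
  have "\<theta> * N = weighted_form D (\<lambda>x. \<theta> * a0 x) (grad D (u y)) (grad D (u y))"
    by (simp add: N_def weighted_form_cmult_weight)
  also have "\<dots> \<le> weighted_form D (diffusion a0 \<psi> y) (grad D (u y)) (grad D (u y))"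
    by (rule weighted_form_mono[OF bounded_weight_cmult[OF a0_weight] diffusion_weight[OF y] L2])
      (use AE_diffusion_bounds[OF y] in \<open>auto simp: \<theta>_def elim: eventually_mono\<close>)
  also have "\<dots> = f (u y)"
    using solution[OF y] u_H01[OF y] by (simp add: weak_solution_def weighted_form_def)
  also have "\<dots> \<le> F * n"
    using V_dual_norm_bound[OF f u_H01[OF y]] by (simp add: F_def n_def)
  finally have upper: "\<theta> * N \<le> F * n" .
  have N: "0 \<le> N"
    using lower a0_min_pos by (meson mult_nonneg_nonneg order_trans less_imp_le zero_le_power2)
  have "N \<le> F\<^sup>2 / (\<theta>\<^sup>2 * a0_min)"
  proof (cases "N = 0")
    case True
    then show ?thesis using a0_min_pos by simp
  next
    case False
    have "a0_min * (\<theta> * N)\<^sup>2 \<le> a0_min * (F * n)\<^sup>2"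
      using upper \<theta> N a0_min_pos by (intro mult_left_mono power_mono) auto
    also have "\<dots> = F\<^sup>2 * (a0_min * n\<^sup>2)" by (simp add: power_mult_distrib)
    also have "\<dots> \<le> F\<^sup>2 * N" by (intro mult_left_mono lower) simp
    finally have "N * (N * (\<theta>\<^sup>2 * a0_min)) \<le> N * F\<^sup>2" by (simp add: power2_eq_square mult_ac)
    then have "N * (\<theta>\<^sup>2 * a0_min) \<le> F\<^sup>2" using False N by simp
    then show ?thesis using \<theta> a0_min_pos by (simp add: pos_le_divide_eq)
  qed
  also have "\<dots> = a0_min * (F / (\<theta> * a0_min))\<^sup>2"
    using a0_min_pos by (simp add: power2_eq_square)
  finally show ?thesis by (simp add: N_def F_def \<theta>_def)
qed

text \<open>The Young parameter in the energy bound is \<open>\<theta> / (2 * K)\<close> and excludes \<open>K = 0\<close>. The bound is therefore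
taken for \<open>K' > K\<close>, and \<open>K'\<close> tends to \<open>K\<close>.\<close>

theorem mixed_field_norm_bound:
  assumes y: "y \<in> param_domain" and S: "finite S" and b: "\<And>j. 0 < b j"
    and K: "0 \<le> K" "AE x in lebesgue_on D. (\<Sum>j\<in>S. \<bar>\<psi> j x\<bar> / b j) \<le> 2 * K * a0 x"
  shows "L2_norm D (mixed_field y S)
    \<le> prod b S * (2 * K / (1 - \<kappa>_bar)) ^ card S * (V_dual_norm D f / ((1 - \<kappa>_bar) * a0_min))"
proof -
  define M where "M = V_dual_norm D f / ((1 - \<kappa>_bar) * a0_min)"
  have M: "0 \<le> M"
    using V_dual_norm_nonneg[OF f] kappa_bar_range a0_min_pos by (simp add: M_def)
  have pos: "0 < prod b S" by (rule prod_pos) (simp add: b)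
  have m_L2: "L2 D (mixed_field y S)" by (intro G_L2 mixed_field_G y S)
  have strict: "L2_norm D (mixed_field y S) \<le> prod b S * (2 * K' / (1 - \<kappa>_bar)) ^ card S * M"
    if K': "K < K'" for K'
  proof -
    define q where "q = prod b S * (2 * K' / (1 - \<kappa>_bar)) ^ card S"
    have q: "0 \<le> q" using pos K' K(1) kappa_bar_range by (simp add: q_def)
    have "a0_min * (L2_norm D (mixed_field y S))\<^sup>2 \<le> weighted_form D a0 (mixed_field y S) (mixed_field y S)"
      by (rule weighted_form_coercive[OF a0_weight m_L2]) (use a0_bounds in \<open>auto elim: eventually_mono\<close>)
    also have "\<dots> \<le> q\<^sup>2 * weighted_form D a0 (grad D (u y)) (grad D (u y))"
      unfolding q_def
    proof (rule mixed_field_energy_bound[OF y S b a0_weight])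
      show "AE x in lebesgue_on D. 0 \<le> a0 x"
        using a0_bounds by eventually_elim (use a0_min_pos in auto)
      show "AE x in lebesgue_on D. (1 - \<kappa>_bar) * a0 x \<le> diffusion a0 \<psi> y x"
        using AE_diffusion_bounds[OF y] by eventually_elim simp
      show "AE x in lebesgue_on D. (\<Sum>j\<in>S. \<bar>\<psi> j x\<bar> / b j) \<le> 2 * K' * a0 x"
        using K(2) a0_bounds
      proof eventually_elim
        case (elim x)
        have "2 * K * a0 x \<le> 2 * K' * a0 x"
          using K' elim a0_min_pos by (intro mult_right_mono) auto
        with elim show ?case by linarith
      qed
    qed (use K' K(1) kappa_bar_range in auto)
    also have "\<dots> \<le> q\<^sup>2 * (a0_min * M\<^sup>2)"
      unfolding M_def by (intro mult_left_mono solution_energy_bound y) simp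
    also have "\<dots> = a0_min * (q * M)\<^sup>2" by (simp add: power_mult_distrib)
    finally have "(L2_norm D (mixed_field y S))\<^sup>2 \<le> (q * M)\<^sup>2"
      using a0_min_pos by simp
    then have "L2_norm D (mixed_field y S) \<le> q * M"
      by (rule power2_le_imp_le) (simp add: q M)
    then show ?thesis by (simp add: q_def)
  qed
  have "((\<lambda>K'. prod b S * (2 * K' / (1 - \<kappa>_bar)) ^ card S * M) \<longlongrightarrow> prod b S * (2 * K / (1 - \<kappa>_bar)) ^ card S * M) (at_right K)"
    using kappa_bar_range by (intro tendsto_intros) auto
  then have "L2_norm D (mixed_field y S) \<le> prod b S * (2 * K / (1 - \<kappa>_bar)) ^ card S * M"
    by (rule tendsto_lowerbound) (auto simp: eventually_at_filter intro!: always_eventually strict)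
  then show ?thesis by (simp add: M_def)
qed

end

lemma supp_properties:
  assumes "\<nu> \<in> F1"
  shows "finite (supp \<nu>)" "mi_order \<nu> = card (supp \<nu>)" "mi_power b \<nu> = prod b (supp \<nu>)"
    "\<nu> j = of_bool (j \<in> supp \<nu>)"
proof -
  have 01: "\<nu> j = 0 \<or> \<nu> j = 1" for j using assms by (auto simp: F1_def)
  then have 1: "\<nu> j = 1" if "j \<in> supp \<nu>" for j using that 01[of j] by (auto simp: supp_def)
  show "finite (supp \<nu>)" using assms by (simp add: F1_def)
  show "mi_order \<nu> = card (supp \<nu>)" "mi_power b \<nu> = prod b (supp \<nu>)"
    by (simp_all add: mi_order_def mi_power_def 1)
  show "\<nu> j = of_bool (j \<in> supp \<nu>)" using 01[of j] by (auto simp: supp_def)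
qed

text \<open>For indices in \<open>F1\<close> an order of differentiation is an enumeration of the support.\<close>

lemma count_list_supp:
  assumes "\<nu> \<in> F1" "\<And>j. count_list js j = \<nu> j"
  shows "distinct js" "set js = supp \<nu>"
proof -
  show set: "set js = supp \<nu>"
  proof (rule set_eqI)
    show "j \<in> set js \<longleftrightarrow> j \<in> supp \<nu>" for j
      using assms(2)[of j] count_list_0_iff[of js j] by (auto simp: supp_def)
  qed
  show "distinct js"
    using assms(2) supp_properties(4)[OF assms(1)] set by (simp add: distinct_count_atmost_1 count_mset)
qed

lemma ex_enumeration_supp:
  assumes "\<nu> \<in> F1"
  obtains js where "\<And>j. count_list js j = \<nu> j"
proof -
  obtain js where js: "set js = supp \<nu>" "distinct js"
    using finite_distinct_list[OF supp_properties(1)[OF assms]] by blast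
  have "count_list js j = \<nu> j" for j
    using js supp_properties(4)[OF assms, of j] by (simp add: distinct_count_atmost_1 count_mset)
  then show ?thesis by (rule that)
qed

section \<open>The quantities kappa and the bound for the derivatives\<close>

lemma kappa_tilde_le_kappa_total:
  assumes "a0 \<in> borel_measurable (lebesgue_on D)" "\<And>j. \<psi> j \<in> borel_measurable (lebesgue_on D)"
    and "finite (supp \<nu>)"
  shows "kappa_tilde D a0 \<psi> b \<nu> \<le> kappa_total D a0 \<psi> b"
  unfolding kappa_tilde_def kappa_total_def Linf_norm_def
proof (rule esssup_mono)
  note [measurable] = assms(1,2)
  show "(\<lambda>x. \<Sum>j\<in>supp \<nu>. ennreal ((\<bar>\<psi> j x\<bar> / b j) / (2 * a0 x))) \<in> borel_measurable (lebesgue_on D)"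
    by measurable
  show "(\<Sum>j\<in>supp \<nu>. ennreal ((\<bar>\<psi> j x\<bar> / b j) / (2 * a0 x)))
      \<le> (\<Sum>j. ennreal ((\<bar>\<psi> j x\<bar> / b j) / (2 * a0 x)))" for x
    by (rule sum_le_suminf) (use assms(3) in auto)
qed

lemma kappa_order_le_kappa_total:
  assumes "a0 \<in> borel_measurable (lebesgue_on D)" "\<And>j. \<psi> j \<in> borel_measurable (lebesgue_on D)"
  shows "kappa_order D a0 \<psi> b k \<le> kappa_total D a0 \<psi> b"
  unfolding kappa_order_def
  by (rule SUP_least) (use assms in \<open>auto intro: kappa_tilde_le_kappa_total supp_properties(1)\<close>)

lemma kappa_tilde_le_kappa_order:
  "\<nu> \<in> F1 \<Longrightarrow> kappa_tilde D a0 \<psi> b \<nu> \<le> kappa_order D a0 \<psi> b (mi_order \<nu>)"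
  unfolding kappa_order_def by (rule SUP_upper) simp

lemma AE_sum_le_kappa_tilde:
  assumes a0: "AE x in lebesgue_on D. 0 < a0 x" and b: "\<And>j. 0 < b j"
    and le: "kappa_tilde D a0 \<psi> b \<nu> \<le> ennreal K" and K: "0 \<le> K"
  shows "AE x in lebesgue_on D. (\<Sum>j\<in>supp \<nu>. \<bar>\<psi> j x\<bar> / b j) \<le> 2 * K * a0 x"
  using a0 esssup_AE[of "\<lambda>x. \<Sum>j\<in>supp \<nu>. ennreal ((\<bar>\<psi> j x\<bar> / b j) / (2 * a0 x))" "lebesgue_on D"]
proof eventually_elim
  case (elim x)
  have "(\<Sum>j\<in>supp \<nu>. ennreal ((\<bar>\<psi> j x\<bar> / b j) / (2 * a0 x))) \<le> ennreal K"
    using elim(2) le unfolding kappa_tilde_def Linf_norm_def by (rule order_trans)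
  moreover have "0 \<le> (\<bar>\<psi> j x\<bar> / b j) / (2 * a0 x)" for j
    using elim(1) less_imp_le[OF b[of j]] by simp
  ultimately have "(\<Sum>j\<in>supp \<nu>. (\<bar>\<psi> j x\<bar> / b j) / (2 * a0 x)) \<le> K"
    using K by (simp add: sum_ennreal)
  then have "(\<Sum>j\<in>supp \<nu>. \<bar>\<psi> j x\<bar> / b j) / (2 * a0 x) \<le> K"
    by (simp only: sum_divide_distrib)
  then show ?case
    using elim(1) by (simp add: pos_divide_le_eq mult_ac)
qed

theorem corollary1:
  fixes D :: "(real ^ 'd) set"
    and a0 :: "real ^ 'd \<Rightarrow> real"
    and \<psi> :: "nat \<Rightarrow> real ^ 'd \<Rightarrow> real"
    and b :: "nat \<Rightarrow> real"
    and a0_min a0_max \<kappa>_bar :: real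
  assumes dim: "CARD('d) \<in> {1, 2, 3}"
    and D_domain: "open D" "connected D" "D \<noteq> {}"
    and D_bounded: "bounded D"
    and D_convex: "convex D"
    and D_lipschitz: "lipschitz_boundary D"
    and D_polyhedral: "polyhedron (closure D)"
    and a0_meas: "a0 \<in> borel_measurable (lebesgue_on D)"
    and psi_meas: "\<And>j. \<psi> j \<in> borel_measurable (lebesgue_on D)"
    and a0_min_pos: "0 < a0_min"
    and a0_bounds: "AE x in lebesgue_on D. a0_min \<le> a0 x \<and> a0 x \<le> a0_max"
    and kappa_bar_range: "0 < \<kappa>_bar" "\<kappa>_bar < 1"
    and kappa_bar: "Linf_norm D (\<lambda>x. \<Sum>j. ennreal (\<bar>\<psi> j x\<bar> / (2 * a0 x))) \<le> ennreal \<kappa>_bar"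
    and b_range: "\<And>j. 0 < b j" "\<And>j. b j \<le> 1"
    and kappa: "kappa_total D a0 \<psi> b < 1"
    and kappa_bar_le: "ennreal \<kappa>_bar \<le> kappa_total D a0 \<psi> b"
  shows "(\<forall>k\<ge>1.
            (\<forall>\<nu>\<in>F1. mi_order \<nu> = k \<longrightarrow> kappa_tilde D a0 \<psi> b \<nu> \<le> kappa_order D a0 \<psi> b k) \<and>
            kappa_order D a0 \<psi> b k \<le> kappa_total D a0 \<psi> b \<and>
            kappa_total D a0 \<psi> b < 1) \<and>
         (\<forall>\<nu>\<in>F1. \<forall>f\<in>V_dual D. \<forall>u.
            (\<forall>y\<in>param_domain. weak_solution D (diffusion a0 \<psi> y) f (u y)) \<longrightarrow>
            (\<exists>w. has_mixed_partial D \<nu> u w) \<and>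
            (\<forall>w. has_mixed_partial D \<nu> u w \<longrightarrow> (\<forall>y\<in>param_domain.
               V_norm D (w y) \<le>
                 mi_power b \<nu>
                 * (2 * enn2real (kappa_order D a0 \<psi> b (mi_order \<nu>)) / (1 - \<kappa>_bar)) ^ mi_order \<nu>
                 * (V_dual_norm D f / ((1 - \<kappa>_bar) * a0_min)))))"
proof -
  interpret affine_diffusion D a0 \<psi> a0_min a0_max \<kappa>_bar
    by unfold_locales (use assms in auto)
  have bound: "V_norm D (w y) \<le> mi_power b \<nu>
      * (2 * enn2real (kappa_order D a0 \<psi> b (mi_order \<nu>)) / (1 - \<kappa>_bar)) ^ mi_order \<nu>
      * (V_dual_norm D f / ((1 - \<kappa>_bar) * a0_min))"
    if \<nu>: "\<nu> \<in> F1" and f: "f \<in> V_dual D"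
      and sol: "\<And>y. y \<in> param_domain \<Longrightarrow> weak_solution D (diffusion a0 \<psi> y) f (u y)"
      and w: "has_mixed_partial D \<nu> u w" and y: "y \<in> param_domain" for \<nu> f u w y
  proof -
    interpret diffusion_solution D a0 \<psi> a0_min a0_max \<kappa>_bar f u
      by unfold_locales (use f sol in auto)
    define K where "K = enn2real (kappa_order D a0 \<psi> b (mi_order \<nu>))"
    note S = supp_properties[OF \<nu>]
    obtain js where js: "\<And>j. count_list js j = \<nu> j"
      by (rule ex_enumeration_supp[OF \<nu>]) blast
    have "iterated_partials D js u w"
      using w js by (simp add: has_mixed_partial_def)
    then have "H01_gradient D (w y) (mixed_field y (supp \<nu>))"
      using iterated_partials_gradient[OF _ count_list_supp(1)[OF \<nu> js] y] count_list_supp(2)[OF \<nu> js] by simp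
    then have norm: "V_norm D (w y) = L2_norm D (mixed_field y (supp \<nu>))"
      by (rule V_norm_eq)
    have "kappa_order D a0 \<psi> b (mi_order \<nu>) < 1"
      using kappa_order_le_kappa_total[OF a0_meas psi_meas] kappa by (rule le_less_trans)
    then have "kappa_order D a0 \<psi> b (mi_order \<nu>) = ennreal K"
      unfolding K_def by (intro ennreal_enn2real[symmetric]) (auto intro: less_trans)
    then have "kappa_tilde D a0 \<psi> b \<nu> \<le> ennreal K"
      using kappa_tilde_le_kappa_order[OF \<nu>, of D a0 \<psi> b] by simp
    moreover have "AE x in lebesgue_on D. 0 < a0 x"
      using a0_bounds by eventually_elim (use a0_min_pos in auto)
    ultimately have "AE x in lebesgue_on D. (\<Sum>j\<in>supp \<nu>. \<bar>\<psi> j x\<bar> / b j) \<le> 2 * K * a0 x"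
      by (intro AE_sum_le_kappa_tilde b_range(1)) (simp_all add: K_def)
    then show ?thesis
      using mixed_field_norm_bound[OF y S(1) b_range(1), of K]
      by (simp add: norm S(2,3) K_def)
  qed
  have existence: "\<exists>w. has_mixed_partial D \<nu> u w"
    if \<nu>: "\<nu> \<in> F1" and f: "f \<in> V_dual D"
      and sol: "\<And>y. y \<in> param_domain \<Longrightarrow> weak_solution D (diffusion a0 \<psi> y) f (u y)" for \<nu> f u
  proof -
    interpret diffusion_solution D a0 \<psi> a0_min a0_max \<kappa>_bar f u
      by unfold_locales (use f sol in auto)
    have "has_mixed_partial D \<nu> u (mixed_derivative (supp \<nu>))"
      unfolding has_mixed_partial_def
    proof (intro allI impI)
      fix js assume "\<forall>j. count_list js j = \<nu> j"
      then have js: "\<And>j. count_list js j = \<nu> j" by blast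
      show "iterated_partials D js u (mixed_derivative (supp \<nu>))"
        using iterated_partials_mixed_derivative[OF count_list_supp(1)[OF \<nu> js]]
        by (simp only: count_list_supp(2)[OF \<nu> js])
    qed
    then show ?thesis by blast
  qed
  show ?thesis
  proof (intro conjI allI ballI impI)
    show "kappa_tilde D a0 \<psi> b \<nu> \<le> kappa_order D a0 \<psi> b k" if "\<nu> \<in> F1" "mi_order \<nu> = k" for \<nu> k
      using kappa_tilde_le_kappa_order[OF that(1)] by (simp add: that(2))
    show "kappa_order D a0 \<psi> b k \<le> kappa_total D a0 \<psi> b" for k
      by (rule kappa_order_le_kappa_total[OF a0_meas psi_meas])
    show "kappa_total D a0 \<psi> b < 1" by (rule kappa)
  next
    fix \<nu> f u
    assume \<nu>: "\<nu> \<in> F1" and f: "f \<in> V_dual D"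
      and sol: "\<forall>y\<in>param_domain. weak_solution D (diffusion a0 \<psi> y) f (u y)"
    show "\<exists>w. has_mixed_partial D \<nu> u w"
      by (rule existence[OF \<nu> f]) (use sol in blast)
    show "V_norm D (w y) \<le> mi_power b \<nu>
        * (2 * enn2real (kappa_order D a0 \<psi> b (mi_order \<nu>)) / (1 - \<kappa>_bar)) ^ mi_order \<nu>
        * (V_dual_norm D f / ((1 - \<kappa>_bar) * a0_min))"
      if "has_mixed_partial D \<nu> u w" "y \<in> param_domain" for w y
      by (rule bound[OF \<nu> f _ that]) (use sol in blast)
  qed
qed

end
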